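(* Let $\chi=\chi_{l(0,0,0,1,0,1)}$ on $S_{(\mathrm{II})}$. (i) If $k=1$, then $C^{\infty}_{\chi}(S_{(\mathrm{II})}\backslash N\times A;I_{1}(\lambda))=\{0\}$. (ii) If $k=2$, put $x_{1}=a_{1}a_{2}$, $x_{2}=a_{1}^{-1}a_{2}$, $x_{3}=a_{3}a_{4}$, $x_{4}=a_{3}^{-1}a_{4}$. The space $C^{\infty}_{\chi}(S_{(\mathrm{II})}\backslash N\times A;I_{2}(\lambda))$ is the complex linear span of the functions $$x_{1}^{\frac{\lambda_{1}+\lambda_{2}-1}{2}}x_{2}^{\frac12}x_{3}^{\frac{\lambda_{1}+\lambda_{2}+1}{2}}x_{4}^{\frac12}f(2\pi x_{2})g(2\pi x_{4}),\qquad f,g\in\mathfrak{MB}\big(\tfrac{\lambda_{1}-\lambda_{2}-2}{2};x\big).$$ Thus $\dim_{\mathbb{C}}C^{\infty}_{\chi}(S_{(\mathrm{II})}\backslash N\times A;I_{2}(\lambda))=4$. There exists in this space a slowly increasing function on the domain $\{(x_{1},\dots,x_{4},u)\mid x_{i}\in\mathbb{R}_{>0},u\in\mathbb{R}\}$, and it is unique up to constant.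
   Context: $G=GL(4,\mathbb{R})$, $K=O(4)$, $A$ is the group of diagonal matrices $\mathrm{diag}(a_1,\dots,a_4)$ with $a_i>0$, $N$ is the group of lower triangular matrices with $1$s on the diagonal, $\mathfrak{n}=\mathrm{Lie}(N)$, $E_{ij}$ are the matrix units. $U(\mathfrak{g})$, the universal enveloping algebra of $\mathfrak{gl}(4,\mathbb{C})$, acts on $C^{\infty}(G)$ by extending $R_{X}f(g)=\frac{d}{dt}f(g\exp tX)|_{t=0}$. $(\lambda_{1},\lambda_{2})\in\mathbb{C}^{2}$ with $\lambda_{1}-\lambda_{2}\notin\mathbb{Z}$. With $\mathbb{E}=(E_{ij})\in M(4;U(\mathfrak{g}))$ and $k\in\{1,2\}$, $I_{k}(\lambda)$ is the left ideal $\sum_{i,j=1}^{4}U(\mathfrak{g})\big((\mathbb{E}-\lambda_{1})(\mathbb{E}-\lambda_{2}-k)\big)_{ij}+U(\mathfrak{g})\big(\sum_{i=1}^{4}E_{ii}-k\lambda_{1}-(4-k)\lambda_{2}\big)$. $l(\alpha,\beta_1,\beta_2,\gamma_1,\gamma_2,\gamma_3)\in\mathfrak{n}^{*}$ is the linear form sending the strictly lower triangular matrix with entries $x_1,x_2,x_3$ at $(2,1),(3,2),(4,3)$, $y_1,y_2$ at $(3,1),(4,2)$ and $z$ at $(4,1)$ to $\alpha z+\beta_1y_1+\beta_2y_2+\gamma_1x_1+\gamma_2x_2+\gamma_3x_3$; and $\chi_{l}(\exp X)=e^{2\pi\sqrt{-1}\,l(X)}$. $S_{(\mathrm{II})}=\exp(\mathbb{R}E_{21}+\mathbb{R}E_{43}+\mathbb{R}E_{31}+\mathbb{R}E_{42}+\mathbb{R}E_{41})$.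 $C^{\infty}_{\chi}(S_{(\mathrm{II})}\backslash G/K;I_{k}(\lambda))=\{f\in C^{\infty}(G)\mid f(sgk')=\chi(s)f(g)\ (s\in S_{(\mathrm{II})},k'\in K),\ R_{X}f=0\ (X\in I_{k}(\lambda))\}$. $S_{(\mathrm{II})}\backslash N\times A$ has coordinates $(u;a_1,\dots,a_4)\in\mathbb{R}\times(\mathbb{R}_{>0})^{4}$ and $\Xi_{(\mathrm{II})}(f)(u;a)=f(\exp(uE_{32})a)$. $C^{\infty}_{\chi}(S_{(\mathrm{II})}\backslash N\times A;I_{k}(\lambda))$ is the image of $C^{\infty}_{\chi}(S_{(\mathrm{II})}\backslash G/K;I_{k}(\lambda))$ under $\Xi_{(\mathrm{II})}$. $\mathfrak{MB}(\nu;x)$ is the ($2$-dimensional) solution space of the modified Bessel equation $[\frac{d^{2}}{dx^{2}}+\frac1x\frac{d}{dx}-(1+\frac{\nu^{2}}{x^{2}})]f(x)=0$ on $x>0$. A function $f$ on a domain $D\subset\mathbb{R}^{m}$ is slowly increasing on $D$ if there is $M\in\mathbb{N}$ with $\sup_{x\in D}(1+|x|)^{-M}|f(x)|<\infty$, $|x|$ the Euclidean norm.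
   Formalization: A nonzero slowly increasing function on the full domain is claimed only if Re(λ1+λ2)≥1 and |Re(λ1−λ2)−2|≤1, as otherwise none exists (blow-up as x1, x2 or x4→0); uniqueness is kept for all λ, and existence and uniqueness on all domains x_i>ε are added for all λ. *)

theory Defs
  imports "HOL-Analysis.Analysis" "HOL-Library.Poly_Mapping" "HOL-Library.Function_Algebras"
begin

section \<open>The enveloping algebra\<close>

datatype 'a free_monoid = Word (letters: "'a list")

instantiation free_monoid :: (type) monoid_add
begin
definition zero_free_monoid :: "'a free_monoid" where
  "zero_free_monoid = Word []"
definition plus_free_monoid :: "'a free_monoid \<Rightarrow> 'a free_monoid \<Rightarrow> 'a free_monoid" where
  "plus_free_monoid v w = Word (letters v @ letters w)"
instance
  by standard (auto simp: zero_free_monoid_def plus_free_monoid_def)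
end

text \<open>The free complex associative algebra on the underlying set of \<open>gl(4,\<complex>)\<close>.
  Its product is the convolution product of \<^type>\<open>poly_mapping\<close> over the (additively written)
  free monoid of words.\<close>

type_synonym gl4C = "complex ^ 4 ^ 4"
type_synonym free_alg = "gl4C free_monoid \<Rightarrow>\<^sub>0 complex"

definition gen :: "gl4C \<Rightarrow> free_alg" where
  "gen X = Poly_Mapping.single (Word [X]) 1"

definition const :: "complex \<Rightarrow> free_alg" where
  "const c = Poly_Mapping.single 0 c"

definition cscale :: "complex \<Rightarrow> gl4C \<Rightarrow> gl4C" where
  "cscale c X = (\<chi> i j. c * X $ i $ j)"

text \<open>The two-sided ideal generated by the linear relations (which cut the free algebra down to
  the tensor algebra of \<open>gl(4,\<complex>)\<close>) and by \<open>XY - YX - [X,Y]\<close>.\<close>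

inductive_set env_rel :: "free_alg set" where
  zero: "0 \<in> env_rel"
| plus: "s \<in> env_rel \<Longrightarrow> t \<in> env_rel \<Longrightarrow> s + t \<in> env_rel"
| left: "t \<in> env_rel \<Longrightarrow> s * t \<in> env_rel"
| right: "t \<in> env_rel \<Longrightarrow> t * s \<in> env_rel"
| add: "gen (X + Y) - gen X - gen Y \<in> env_rel"
| scale: "gen (cscale c X) - const c * gen X \<in> env_rel"
| bracket: "gen X * gen Y - gen Y * gen X - gen (X ** Y - Y ** X) \<in> env_rel"

lemma env_rel_uminus: "t \<in> env_rel \<Longrightarrow> - t \<in> env_rel"
  using env_rel.left[of t "-1"] by simp

lemma env_rel_minus: "s \<in> env_rel \<Longrightarrow> t \<in> env_rel \<Longrightarrow> s - t \<in> env_rel"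
  using env_rel.plus[of s "- t"] env_rel_uminus by simp

lemma env_rel_eqI: "s = t \<Longrightarrow> s - t \<in> env_rel"
  by (simp add: env_rel.zero)

quotient_type Ugl4 = free_alg / "\<lambda>s t. s - t \<in> env_rel"
proof (rule equivpI)
  show "reflp (\<lambda>s t. s - t \<in> env_rel)"
    by (simp add: reflp_def env_rel.zero)
  show "symp (\<lambda>s t. s - t \<in> env_rel)"
    using env_rel_uminus by (fastforce intro: sympI)
  show "transp (\<lambda>s t. s - t \<in> env_rel)"
  proof (rule transpI)
    fix x y z assume "x - y \<in> env_rel" "y - z \<in> env_rel"
    then have "(x - y) + (y - z) \<in> env_rel" by (rule env_rel.plus)
    then show "x - z \<in> env_rel" by simp
  qed
qed

lemma free_monoid_add_eq_0_iff: "(v::'a free_monoid) + w = 0 \<longleftrightarrow> v = 0 \<and> w = 0"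
  by (cases v; cases w) (auto simp: zero_free_monoid_def plus_free_monoid_def)

lemma lookup_times_0:
  fixes s t :: free_alg
  shows "Poly_Mapping.lookup (s * t) 0 = Poly_Mapping.lookup s 0 * Poly_Mapping.lookup t 0"
proof -
  have "Sum_any (\<lambda>q. Poly_Mapping.lookup t q when (0::gl4C free_monoid) = l + q) = (Poly_Mapping.lookup t 0 when l = 0)" for l
    by (cases "l = 0") (auto simp: eq_commute[of 0] free_monoid_add_eq_0_iff)
  then have "Poly_Mapping.lookup (s * t) 0 = Sum_any (\<lambda>l. Poly_Mapping.lookup s l * (Poly_Mapping.lookup t 0 when l = 0))"
    by (simp add: lookup_mult)
  also have "\<dots> = Poly_Mapping.lookup s 0 * Poly_Mapping.lookup t 0"
    by (simp add: mult_when)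
  finally show ?thesis .
qed

lemma lookup_gen_0: "Poly_Mapping.lookup (gen X) 0 = 0"
  by (simp add: gen_def zero_free_monoid_def lookup_single)

lemma lookup_env_rel_0: "t \<in> env_rel \<Longrightarrow> Poly_Mapping.lookup t 0 = 0"
  by (induction rule: env_rel.induct)
    (simp_all add: lookup_times_0 lookup_add lookup_minus lookup_gen_0)

instantiation Ugl4 :: ring_1
begin
lift_definition zero_Ugl4 :: Ugl4 is 0 .
lift_definition one_Ugl4 :: Ugl4 is 1 .
lift_definition plus_Ugl4 :: "Ugl4 \<Rightarrow> Ugl4 \<Rightarrow> Ugl4" is "(+)"
  by (simp only: add_diff_add env_rel.plus)
lift_definition uminus_Ugl4 :: "Ugl4 \<Rightarrow> Ugl4" is uminus
  by (simp only: minus_diff_minus env_rel_uminus)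
lift_definition minus_Ugl4 :: "Ugl4 \<Rightarrow> Ugl4 \<Rightarrow> Ugl4" is "(-)"
proof -
  fix s s' t t' :: free_alg assume "s - s' \<in> env_rel" "t - t' \<in> env_rel"
  then have "(s - s') - (t - t') \<in> env_rel" by (rule env_rel_minus)
  then show "s - t - (s' - t') \<in> env_rel" by (simp add: algebra_simps)
qed
lift_definition times_Ugl4 :: "Ugl4 \<Rightarrow> Ugl4 \<Rightarrow> Ugl4" is "(*)"
proof -
  fix s s' t t' :: free_alg assume "s - s' \<in> env_rel" "t - t' \<in> env_rel"
  then have "(s - s') * t + s' * (t - t') \<in> env_rel"
    by (intro env_rel.plus env_rel.left env_rel.right)
  then show "s * t - s' * t' \<in> env_rel" by (simp add: algebra_simps)
qed
instance
proof
  show "(0::Ugl4) \<noteq> 1"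
  proof transfer
    have "Poly_Mapping.lookup (0 - 1 :: free_alg) 0 \<noteq> 0"
      by (simp add: lookup_minus lookup_one)
    then show "0 - 1 \<notin> env_rel"
      using lookup_env_rel_0 by blast
  qed
qed (transfer, rule env_rel_eqI, rule mult.assoc mult_1_left mult_1_right add.assoc
    add.commute add_0_left left_minus diff_conv_add_uminus distrib_right distrib_left)+
end

definition of_gl4 :: "gl4C \<Rightarrow> Ugl4" where
  "of_gl4 X = abs_Ugl4 (gen X)"

definition of_scalar :: "complex \<Rightarrow> Ugl4" where
  "of_scalar c = abs_Ugl4 (const c)"

text \<open>The index type \<^typ>\<open>4\<close> has the elements \<open>1, 2, 3, 4\<close> with \<open>4 = 0\<close>; its order is never used.\<close>

definition munit :: "4 \<Rightarrow> 4 \<Rightarrow> 'a::zero_neq_one ^ 4 ^ 4" where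
  "munit p q = (\<chi> i j. if i = p \<and> j = q then 1 else 0)"

definition EE :: "Ugl4 ^ 4 ^ 4" where
  "EE = (\<chi> i j. of_gl4 (munit i j))"

text \<open>In the quotient type, \<^const>\<open>mat\<close> of a scalar is the scalar matrix, and \<open>**\<close> multiplies the entries
  in the order written, as required over a noncommutative ring.\<close>

definition I_ideal :: "nat \<Rightarrow> complex \<Rightarrow> complex \<Rightarrow> Ugl4 set" where
  "I_ideal k l\<^sub>1 l\<^sub>2 =
    {(\<Sum>i\<in>UNIV. \<Sum>j\<in>UNIV.
        u i j * ((EE - mat (of_scalar l\<^sub>1)) ** (EE - mat (of_scalar (l\<^sub>2 + of_nat k)))) $ i $ j)
      + v * ((\<Sum>i\<in>UNIV. EE $ i $ i) - of_scalar (of_nat k * l\<^sub>1 + (4 - of_nat k) * l\<^sub>2))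
     | u v. True}"

section \<open>Smooth functions on the group\<close>

primrec C_k :: "nat \<Rightarrow> 'a::real_normed_vector set \<Rightarrow> ('a \<Rightarrow> 'b::real_normed_vector) \<Rightarrow> bool" where
  "C_k 0 S f \<longleftrightarrow> continuous_on S f"
| "C_k (Suc n) S f \<longleftrightarrow>
     (\<forall>x\<in>S. f differentiable (at x)) \<and> (\<forall>v. C_k n S (\<lambda>x. frechet_derivative f (at x) v))"

definition smooth_on :: "'a::real_normed_vector set \<Rightarrow> ('a \<Rightarrow> 'b::real_normed_vector) \<Rightarrow> bool" where
  "smooth_on S f \<longleftrightarrow> (\<forall>n. C_k n S f)"

type_synonym mat4 = "real ^ 4 ^ 4"

definition GL4 :: "mat4 set" where
  "GL4 = {g. invertible g}"

definition O4 :: "mat4 set" where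
  "O4 = {k. orthogonal_matrix k}"

text \<open>A function on the group is represented by its extension by zero to all matrices.\<close>

definition Cinf_GL4 :: "(mat4 \<Rightarrow> complex) set" where
  "Cinf_GL4 = {f. smooth_on GL4 f \<and> (\<forall>g. g \<notin> GL4 \<longrightarrow> f g = 0)}"

definition mexp :: "mat4 \<Rightarrow> mat4" where
  "mexp X = suminf (\<lambda>n. (1 / fact n) *\<^sub>R ((**) X ^^ n) (mat 1))"

definition R_real :: "mat4 \<Rightarrow> (mat4 \<Rightarrow> complex) \<Rightarrow> mat4 \<Rightarrow> complex" where
  "R_real X f g =
    (if g \<in> GL4 then vector_derivative (\<lambda>t. f (g ** mexp (t *\<^sub>R X))) (at 0) else 0)"

definition R_gl4 :: "gl4C \<Rightarrow> (mat4 \<Rightarrow> complex) \<Rightarrow> mat4 \<Rightarrow> complex" where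
  "R_gl4 X f g = R_real (map_matrix Re X) f g + \<i> * R_real (map_matrix Im X) f g"

definition R_free :: "free_alg \<Rightarrow> (mat4 \<Rightarrow> complex) \<Rightarrow> mat4 \<Rightarrow> complex" where
  "R_free t f g =
    (\<Sum>w\<in>Poly_Mapping.keys t. Poly_Mapping.lookup t w * foldr R_gl4 (letters w) f g)"

text \<open>The action of the enveloping algebra, computed on a representative in the free algebra. By
  \<open>R_U_abs\<close> below the choice of the representative does not matter on \<^const>\<open>Cinf_GL4\<close>.\<close>

definition R_U :: "Ugl4 \<Rightarrow> (mat4 \<Rightarrow> complex) \<Rightarrow> mat4 \<Rightarrow> complex" where
  "R_U u = R_free (rep_Ugl4 u)"

text \<open>The facts up to \<open>R_U_mult\<close> show that the operators \<^const>\<open>R_gl4\<close> preserve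
  \<^const>\<open>Cinf_GL4\<close> and are there \<open>\<complex>\<close>-linear in \<open>X\<close> and compatible with brackets, so that
  \<^const>\<open>R_free\<close> factors through the quotient.\<close>

lemma C_k_cong:
  assumes "open S" "\<And>x. x \<in> S \<Longrightarrow> f x = g x"
  shows "C_k n S f \<Longrightarrow> C_k n S g"
  using assms(2)
proof (induction n arbitrary: f g)
  case 0
  then show ?case using continuous_on_cong[of S S f g] by auto
next
  case (Suc n)
  have d: "(g has_derivative frechet_derivative f (at x)) (at x)" if "x \<in> S" for x
  proof (rule has_derivative_transform_within_open[OF _ assms(1) that])
    show "(f has_derivative frechet_derivative f (at x)) (at x)"
      using Suc.prems(1) that by (simp add: frechet_derivative_works[symmetric])
  qed (use Suc.prems(2) in auto)
  have "frechet_derivative f (at x) v = frechet_derivative g (at x) v" if "x \<in> S" for x v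
    using d[OF that] by (metis frechet_derivative_at)
  then have "C_k n S (\<lambda>x. frechet_derivative g (at x) v)" for v
    using Suc.IH[of "\<lambda>x. frechet_derivative f (at x) v"] Suc.prems by simp
  then show ?case
    using d by (auto simp: differentiable_def)
qed

lemma C_k_SucI:
  assumes "open S" "\<And>x. x \<in> S \<Longrightarrow> (f has_derivative D x) (at x)" "\<And>v. C_k n S (\<lambda>x. D x v)"
  shows "C_k (Suc n) S f"
proof -
  have "D x v = frechet_derivative f (at x) v" if "x \<in> S" for x v
    using frechet_derivative_at[OF assms(2)[OF that]] by simp
  then have "C_k n S (\<lambda>x. frechet_derivative f (at x) v)" for v
    by (rule C_k_cong[OF assms(1) _ assms(3)[of v]])
  then show ?thesis using assms(2) by (auto simp: differentiable_def)
qed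

lemma smooth_on_cong:
  assumes "open S" "\<And>x. x \<in> S \<Longrightarrow> f x = g x" "smooth_on S f"
  shows "smooth_on S g"
  using assms C_k_cong unfolding smooth_on_def by metis

lemma C_k_Suc_imp: "C_k (Suc n) S f \<Longrightarrow> C_k n S f"
proof (induction n arbitrary: f)
  case 0
  then show ?case
    by (auto intro!: continuous_at_imp_continuous_on differentiable_imp_continuous_within)
next
  case (Suc n)
  then show ?case by (metis C_k.simps(2))
qed

lemma smooth_on_differentiable: "smooth_on S f \<Longrightarrow> x \<in> S \<Longrightarrow> f differentiable (at x)"
  unfolding smooth_on_def by (metis C_k.simps(2))

lemma smooth_on_deriv: "smooth_on S f \<Longrightarrow> smooth_on S (\<lambda>x. frechet_derivative f (at x) v)"
  unfolding smooth_on_def by (metis C_k.simps(2))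

lemma C_k_add:
  assumes "open S"
  shows "C_k n S f \<Longrightarrow> C_k n S g \<Longrightarrow> C_k n S (\<lambda>x. f x + g x)"
proof (induction n arbitrary: f g)
  case 0
  then show ?case by (auto intro: continuous_intros)
next
  case (Suc n)
  have d: "((\<lambda>x. f x + g x) has_derivative
      (\<lambda>v. frechet_derivative f (at x) v + frechet_derivative g (at x) v)) (at x)" if "x \<in> S" for x
    using Suc.prems that by (auto intro!: has_derivative_add simp: frechet_derivative_works[symmetric])
  show ?case
    by (rule C_k_SucI[OF assms d]) (use Suc in auto)
qed

lemma C_k_linear:
  assumes "open S" "bounded_linear h"
  shows "C_k n S f \<Longrightarrow> C_k n S (\<lambda>x. h (f x))"
proof (induction n arbitrary: f)
  case 0
  then show ?case by (simp add: bounded_linear.continuous_on[OF assms(2)])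
next
  case (Suc n)
  have d: "((\<lambda>x. h (f x)) has_derivative (\<lambda>v. h (frechet_derivative f (at x) v))) (at x)" if "x \<in> S" for x
    using Suc.prems that by (auto intro!: bounded_linear.has_derivative[OF assms(2)] simp: frechet_derivative_works[symmetric])
  show ?case
    by (rule C_k_SucI[OF assms(1) d]) (use Suc in auto)
qed

lemma C_k_scaleR_linear:
  assumes "open S" "bounded_linear h"
  shows "C_k n S f \<Longrightarrow> C_k n S (\<lambda>x. h x *\<^sub>R f x)"
proof (induction n arbitrary: f)
  case 0
  then show ?case
    by (simp add: continuous_on_scaleR bounded_linear.continuous_on[OF assms(2)] continuous_on_id)
next
  case (Suc n)
  have d: "((\<lambda>x. h x *\<^sub>R f x) has_derivative (\<lambda>v. h x *\<^sub>R frechet_derivative f (at x) v + h v *\<^sub>R f x)) (at x)"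
    if "x \<in> S" for x
    using Suc.prems that 
    by (auto intro!: has_derivative_scaleR bounded_linear.has_derivative[OF assms(2)] simp: frechet_derivative_works[symmetric])
  have "C_k n S (\<lambda>x. h x *\<^sub>R frechet_derivative f (at x) v + h v *\<^sub>R f x)" for v
    using Suc.prems C_k_Suc_imp[of n S f]
    by (intro C_k_add C_k_linear[OF _ bounded_linear_scaleR_right] Suc.IH assms) auto
  then show ?case using C_k_SucI[OF assms(1) d] by blast
qed

lemma smooth_on_add: "open S \<Longrightarrow> smooth_on S f \<Longrightarrow> smooth_on S g \<Longrightarrow> smooth_on S (\<lambda>x. f x + g x)"
  by (simp add: smooth_on_def C_k_add)

lemma smooth_on_linear: "open S \<Longrightarrow> bounded_linear h \<Longrightarrow> smooth_on S f \<Longrightarrow> smooth_on S (\<lambda>x. h (f x))"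
  by (simp add: smooth_on_def C_k_linear)

lemma smooth_on_scaleR_linear:
  "open S \<Longrightarrow> bounded_linear h \<Longrightarrow> smooth_on S f \<Longrightarrow> smooth_on S (\<lambda>x. h x *\<^sub>R f x)"
  by (simp add: smooth_on_def C_k_scaleR_linear)

lemma C_k_zero: "C_k n S (\<lambda>x. 0)"
  by (induction n) auto

lemma smooth_on_sum:
  "open S \<Longrightarrow> (\<And>i. i \<in> A \<Longrightarrow> smooth_on S (f i)) \<Longrightarrow> smooth_on S (\<lambda>x. \<Sum>i\<in>A. f i x)"
  by (induction A rule: infinite_finite_induct) (auto simp: smooth_on_def C_k_zero C_k_add)

lemma mvt_line:
  fixes f :: "'a::real_normed_vector \<Rightarrow> real"
  assumes "h > 0" "\<And>s. 0 \<le> s \<Longrightarrow> s \<le> h \<Longrightarrow> f differentiable (at (p + s *\<^sub>R v))"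
      "\<And>s. 0 \<le> s \<Longrightarrow> s \<le> h \<Longrightarrow> g differentiable (at (q + s *\<^sub>R v))"
  shows "\<exists>s. 0 < s \<and> s < h \<and> (f (p + h *\<^sub>R v) - g (q + h *\<^sub>R v)) - (f p - g q) =
     h * (frechet_derivative f (at (p + s *\<^sub>R v)) v - frechet_derivative g (at (q + s *\<^sub>R v)) v)"
proof -
  have der: "((\<lambda>s. f (p + s *\<^sub>R v)) has_real_derivative frechet_derivative f (at (p + s *\<^sub>R v)) v) (at s)"
    if "f differentiable (at (p + s *\<^sub>R v))" for s and f :: "'a \<Rightarrow> real" and p
  proof -
    have 1: "(f has_derivative frechet_derivative f (at (p + s *\<^sub>R v))) (at (p + s *\<^sub>R v))"
      using that by (simp add: frechet_derivative_works[symmetric])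
    have "((\<lambda>s. f (p + s *\<^sub>R v)) has_derivative (\<lambda>t. frechet_derivative f (at (p + s *\<^sub>R v)) (t *\<^sub>R v))) (at s)"
      by (rule has_derivative_compose[where f="\<lambda>s. p + s *\<^sub>R v", OF _ 1])
         (auto intro!: derivative_eq_intros)
    moreover have "frechet_derivative f (at (p + s *\<^sub>R v)) (t *\<^sub>R v) = t * frechet_derivative f (at (p + s *\<^sub>R v)) v" for t
      using has_derivative_linear[OF 1] by (simp add: linear_cmul)
    ultimately have "((\<lambda>s. f (p + s *\<^sub>R v)) has_derivative (\<lambda>t. t * frechet_derivative f (at (p + s *\<^sub>R v)) v)) (at s)"
      by simp
    then show ?thesis
      unfolding has_field_derivative_def by (rule has_derivative_eq_rhs) (simp add: fun_eq_iff)
  qed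
  have "\<exists>s>0. s < h \<and> (f (p + h *\<^sub>R v) - g (q + h *\<^sub>R v)) - (f (p + 0 *\<^sub>R v) - g (q + 0 *\<^sub>R v)) =
     (h - 0) * (frechet_derivative f (at (p + s *\<^sub>R v)) v - frechet_derivative g (at (q + s *\<^sub>R v)) v)"
    by (rule MVT2[OF assms(1)]) (intro DERIV_diff der assms; simp)
  then show ?thesis by auto
qed

lemma second_derivative_symmetric_real:
  fixes f :: "'a::real_normed_vector \<Rightarrow> real"
  assumes S: "open S" and f: "smooth_on S f" and x: "x \<in> S"
  shows "frechet_derivative (\<lambda>y. frechet_derivative f (at y) v) (at x) w =
         frechet_derivative (\<lambda>y. frechet_derivative f (at y) w) (at x) v"
proof -
  define D where "D f v x = frechet_derivative f (at x) v" for f :: "'a \<Rightarrow> real" and v x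
  have sm: "smooth_on S (D f v)" if "smooth_on S f" for f v
    using smooth_on_deriv[OF that] by (simp add: D_def[abs_def])
  have cont: "continuous_on S (D (D f v) w)" for v w
    using sm[OF sm[OF f]] unfolding smooth_on_def by (metis C_k.simps(1))
  define \<Delta> where "\<Delta> h v w = f (x + h *\<^sub>R v + h *\<^sub>R w) - f (x + h *\<^sub>R v) - f (x + h *\<^sub>R w) + f x" for h v w
  obtain r where r: "r > 0" "ball x r \<subseteq> S" using S x open_contains_ball by blast
  have key: "\<exists>s t. 0 < s \<and> s < h \<and> 0 < t \<and> t < h \<and>
      \<Delta> h v w = h * (h * D (D f v) w (x + s *\<^sub>R v + t *\<^sub>R w))"
    if h: "h > 0" "h * (norm v + norm w) < r" for h v w
  proof -
    have inS: "x + s *\<^sub>R v + t *\<^sub>R w \<in> S" if "0 \<le> s" "s \<le> h" "0 \<le> t" "t \<le> h" for s t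
    proof -
      have "norm (s *\<^sub>R v + t *\<^sub>R w) \<le> s * norm v + t * norm w"
        using that norm_triangle_ineq[of "s *\<^sub>R v" "t *\<^sub>R w"] by simp
      also have "\<dots> \<le> h * norm v + h * norm w"
        using that by (intro add_mono mult_right_mono) auto
      also have "\<dots> < r" using h(2) by (simp add: distrib_left)
      finally have "dist x (x + s *\<^sub>R v + t *\<^sub>R w) < r"
        by (simp add: dist_norm norm_minus_commute add.assoc)
          (metis norm_minus_cancel minus_add_distrib uminus_add_conv_diff add.commute)
      then show ?thesis using r(2) by auto
    qed
    have "\<exists>s. 0 < s \<and> s < h \<and> (f ((x + h *\<^sub>R w) + h *\<^sub>R v) - f (x + h *\<^sub>R v)) - (f (x + h *\<^sub>R w) - f x) =
        h * (frechet_derivative f (at ((x + h *\<^sub>R w) + s *\<^sub>R v)) v - frechet_derivative f (at (x + s *\<^sub>R v)) v)"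
      using h(1) inS[of _ h] inS[of _ 0]
      by (intro mvt_line smooth_on_differentiable[OF f]) (auto simp: add_ac)
    then obtain s where s: "0 < s" "s < h"
      "\<Delta> h v w = h * (D f v (x + s *\<^sub>R v + h *\<^sub>R w) - D f v (x + s *\<^sub>R v))"
      by (auto simp: \<Delta>_def D_def algebra_simps)
    have "\<exists>t. 0 < t \<and> t < h \<and> (D f v ((x + s *\<^sub>R v) + h *\<^sub>R w) - (\<lambda>_. 0) (x + h *\<^sub>R w)) - (D f v (x + s *\<^sub>R v) - (\<lambda>_. 0) x) =
        h * (frechet_derivative (D f v) (at ((x + s *\<^sub>R v) + t *\<^sub>R w)) w - frechet_derivative (\<lambda>_. 0) (at (x + t *\<^sub>R w)) w)"
      using h(1) s inS[of s]
      by (intro mvt_line smooth_on_differentiable[OF sm[OF f]]) auto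
    then obtain t where t: "0 < t" "t < h"
      "D f v (x + s *\<^sub>R v + h *\<^sub>R w) - D f v (x + s *\<^sub>R v) = h * D (D f v) w (x + s *\<^sub>R v + t *\<^sub>R w)"
      by (auto simp: D_def)
    then show ?thesis using s by metis
  qed
  have "dist (D (D f v) w x) (D (D f w) v x) < e + e" if e: "e > 0" for e
  proof -
    obtain d1 where d1: "d1 > 0" "\<And>y. y \<in> S \<Longrightarrow> dist y x < d1 \<Longrightarrow> dist (D (D f v) w y) (D (D f v) w x) < e"
      using cont[of v w] x e unfolding continuous_on_iff by metis
    obtain d2 where d2: "d2 > 0" "\<And>y. y \<in> S \<Longrightarrow> dist y x < d2 \<Longrightarrow> dist (D (D f w) v y) (D (D f w) v x) < e"
      using cont[of w v] x e unfolding continuous_on_iff by metis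
    define m where "m = min r (min d1 d2)"
    have m: "m > 0" using r d1 d2 by (simp add: m_def)
    define h where "h = m / (norm v + norm w + 1)"
    have pos: "norm v + norm w + 1 > 0" by (smt (verit) norm_ge_zero)
    have h: "h > 0" "h * (norm v + norm w) < m"
      using m pos by (auto simp: h_def field_simps)
    have near: "dist (x + s *\<^sub>R v + t *\<^sub>R w) x < m" if "0 < s" "s < h" "0 < t" "t < h" for s t
    proof -
      have "norm (s *\<^sub>R v + t *\<^sub>R w) \<le> s * norm v + t * norm w"
        using that norm_triangle_ineq[of "s *\<^sub>R v" "t *\<^sub>R w"] by simp
      also have "\<dots> \<le> h * norm v + h * norm w"
        using that by (intro add_mono mult_right_mono) auto
      also have "\<dots> < m" using h(2) by (simp add: distrib_left)
      finally show ?thesis by (simp add: dist_norm add.assoc)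
    qed
    obtain s t where st: "0 < s" "s < h" "0 < t" "t < h"
        "\<Delta> h v w = h * (h * D (D f v) w (x + s *\<^sub>R v + t *\<^sub>R w))"
      using key[of h v w] h by (auto simp: m_def)
    obtain s' t' where st': "0 < s'" "s' < h" "0 < t'" "t' < h"
        "\<Delta> h w v = h * (h * D (D f w) v (x + s' *\<^sub>R w + t' *\<^sub>R v))"
      using key[of h w v] h by (auto simp: m_def add.commute)
    have "\<Delta> h v w = \<Delta> h w v" by (simp add: \<Delta>_def algebra_simps)
    then have eq: "D (D f v) w (x + s *\<^sub>R v + t *\<^sub>R w) = D (D f w) v (x + t' *\<^sub>R v + s' *\<^sub>R w)"
      using st(5) st'(5) h(1) by (simp add: add_ac)
    have n1: "dist (x + s *\<^sub>R v + t *\<^sub>R w) x < m" using near st by blast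
    have n2: "dist (x + t' *\<^sub>R v + s' *\<^sub>R w) x < m" using near st' by blast
    have "dist (D (D f v) w (x + s *\<^sub>R v + t *\<^sub>R w)) (D (D f v) w x) < e"
      using n1 r(2) by (intro d1(2)) (auto simp: m_def dist_commute subset_iff)
    moreover have "dist (D (D f w) v (x + t' *\<^sub>R v + s' *\<^sub>R w)) (D (D f w) v x) < e"
      using n2 r(2) by (intro d2(2)) (auto simp: m_def dist_commute subset_iff)
    ultimately show ?thesis unfolding eq dist_real_def by linarith
  qed
  from this[of "dist (D (D f v) w x) (D (D f w) v x) / 2"]
  have "D (D f v) w x = D (D f w) v x"
    by (metis field_sum_of_halves half_gt_zero_iff less_irrefl zero_less_dist_iff)
  then show ?thesis by (simp add: D_def[abs_def])
qed

lemma frechet_derivative_linear: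
  assumes "bounded_linear h" "f differentiable (at x)"
  shows "frechet_derivative (\<lambda>x. h (f x)) (at x) v = h (frechet_derivative f (at x) v)"
  using frechet_derivative_at[OF bounded_linear.has_derivative[OF assms(1)
     assms(2)[unfolded frechet_derivative_works]]] by metis

lemma second_derivative_symmetric:
  fixes f :: "'a::real_normed_vector \<Rightarrow> complex"
  assumes S: "open S" and f: "smooth_on S f" and x: "x \<in> S"
  shows "frechet_derivative (\<lambda>y. frechet_derivative f (at y) v) (at x) w =
         frechet_derivative (\<lambda>y. frechet_derivative f (at y) w) (at x) v"
proof -
  have *: "h (frechet_derivative (\<lambda>y. frechet_derivative f (at y) v) (at x) w) =
        frechet_derivative (\<lambda>y. frechet_derivative (\<lambda>x. h (f x)) (at y) v) (at x) w"
    if h: "bounded_linear h" for v w and h :: "complex \<Rightarrow> real"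
  proof -
    have fv: "(\<lambda>y. frechet_derivative f (at y) v) differentiable (at x)"
      using smooth_on_deriv[OF f] x by (rule smooth_on_differentiable)
    have "((\<lambda>y. frechet_derivative (\<lambda>x. h (f x)) (at y) v) has_derivative
           frechet_derivative (\<lambda>y. h (frechet_derivative f (at y) v)) (at x)) (at x)"
    proof (rule has_derivative_transform_within_open[OF _ S x])
      show "((\<lambda>y. h (frechet_derivative f (at y) v)) has_derivative
           frechet_derivative (\<lambda>y. h (frechet_derivative f (at y) v)) (at x)) (at x)"
        using smooth_on_differentiable[OF smooth_on_linear[OF S h smooth_on_deriv[OF f]] x]
        by (simp add: frechet_derivative_works)
    qed (simp add: frechet_derivative_linear[OF h smooth_on_differentiable[OF f]])
    then show ?thesis
      using frechet_derivative_at frechet_derivative_linear[OF h fv] by metis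
  qed
  show ?thesis
    using second_derivative_symmetric_real[OF S smooth_on_linear[OF S bounded_linear_Re f] x, of v w]
      second_derivative_symmetric_real[OF S smooth_on_linear[OF S bounded_linear_Im f] x, of v w]
    by (simp add: complex_eq_iff *[OF bounded_linear_Re] *[OF bounded_linear_Im])
qed

abbreviation matpow :: "mat4 \<Rightarrow> nat \<Rightarrow> mat4" where
  "matpow X n \<equiv> ((**) X ^^ n) (mat 1)"

lemma matrix_entry_le: "\<bar>(A::mat4) $ i $ j\<bar> \<le> norm A"
  by (rule order_trans[OF component_le_norm_cart Finite_Cartesian_Product.norm_nth_le])

lemma matpow_entry_le: "\<bar>matpow X n $ i $ j\<bar> \<le> (4 * norm X) ^ n"
proof (induction n arbitrary: i j)
  case 0
  then show ?case by (simp add: mat_def)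
next
  case (Suc n)
  have "\<bar>matpow X (Suc n) $ i $ j\<bar> \<le> (\<Sum>k\<in>UNIV. \<bar>X $ i $ k\<bar> * \<bar>matpow X n $ k $ j\<bar>)"
    by (simp add: matrix_matrix_mult_def abs_mult[symmetric])
  also have "\<dots> \<le> (\<Sum>k\<in>(UNIV::4 set). norm X * (4 * norm X) ^ n)"
    by (intro sum_mono mult_mono matrix_entry_le Suc.IH) auto
  also have "\<dots> = (4 * norm X) ^ Suc n" by simp
  finally show ?case .
qed

lemma matpow_scaleR: "matpow (t *\<^sub>R X) n = t ^ n *\<^sub>R matpow X n"
proof (induction n)
  case (Suc n)
  have "matpow (t *\<^sub>R X) (Suc n) = (t *\<^sub>R X) ** (t ^ n *\<^sub>R matpow X n)"
    by (simp only: funpow.simps o_apply Suc.IH)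
  also have "\<dots> = t ^ Suc n *\<^sub>R matpow X (Suc n)"
    by (simp add: vec_eq_iff matrix_matrix_mult_def sum_distrib_left mult_ac)
  finally show ?case .
qed simp

lemma summable_mexp_entry: "summable (\<lambda>n. matpow X n $ i $ j / fact n)"
proof (rule summable_comparison_test')
  show "summable (\<lambda>n. inverse (fact n) * (4 * norm X) ^ n)" by (rule summable_exp)
  show "norm (matpow X n $ i $ j / fact n) \<le> inverse (fact n) * (4 * norm X) ^ n" for n
    using matpow_entry_le[where X=X and n=n and i=i and j=j] by (simp add: field_simps)
qed

lemma summable_mexp: "summable (\<lambda>n. (1 / fact n) *\<^sub>R matpow X n)"
proof (rule summable_comparison_test')
  show "summable (\<lambda>n. 16 * (inverse (fact n) * (4 * norm X) ^ n))"
    by (intro summable_mult summable_exp)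
  show "norm ((1 / fact n) *\<^sub>R matpow X n) \<le> 16 * (inverse (fact n) * (4 * norm X) ^ n)" for n
  proof -
    have "norm (matpow X n) \<le> (\<Sum>i\<in>UNIV. norm (matpow X n $ i))"
      unfolding norm_vec_def[of "matpow X n"] by (rule L2_set_le_sum) simp
    also have "\<dots> \<le> (\<Sum>i\<in>(UNIV::4 set). \<Sum>j\<in>(UNIV::4 set). (4 * norm X) ^ n)"
      by (intro sum_mono order_trans[OF norm_le_l1_cart] matpow_entry_le)
    also have "\<dots> = 16 * (4 * norm X) ^ n" by simp
    finally show ?thesis by (simp add: field_simps)
  qed
qed

lemma mexp_entry: "mexp X $ i $ j = suminf (\<lambda>n. matpow X n $ i $ j / fact n)"
proof -
  have bl: "bounded_linear (\<lambda>A::mat4. A $ i $ j)"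
    by (rule bounded_linear_compose[OF bounded_linear_vec_nth bounded_linear_vec_nth])
  show ?thesis
    using bounded_linear.suminf[OF bl summable_mexp, of X] by (simp add: mexp_def)
qed

lemma mexp_0 [simp]: "mexp 0 = mat 1"
proof -
  have "matpow 0 n $ i $ j / fact n = (mat 1 :: mat4) $ i $ j * 0 ^ n" for n i j
    by (cases n) (simp_all add: matrix_matrix_mult_def)
  then have "mexp 0 $ i $ j = suminf (\<lambda>n. (\<lambda>_. (mat 1 :: mat4) $ i $ j) n * 0 ^ n)" for i j
    by (simp add: mexp_entry)
  then have "mexp 0 $ i $ j = (mat 1 :: mat4) $ i $ j" for i j
    by (simp only: powser_zero)
  then show ?thesis by (simp add: vec_eq_iff)
qed

lemma mexp_has_derivative_0:
  "((\<lambda>t. mexp (t *\<^sub>R X)) has_vector_derivative X) (at 0)"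
proof -
  have entry: "((\<lambda>t. mexp (t *\<^sub>R X) $ i $ j) has_real_derivative X $ i $ j) (at 0)" for i j
  proof -
    define c where "c n = matpow X n $ i $ j / fact n" for n
    have eq: "matpow (t *\<^sub>R X) n $ i $ j / fact n = c n * t ^ n" for t n
      by (simp add: matpow_scaleR c_def)
    have "summable (\<lambda>n. c n * t ^ n)" for t
      using summable_mexp_entry[of "t *\<^sub>R X" i j] by (simp add: eq)
    then have "((\<lambda>t. suminf (\<lambda>n. c n * t ^ n)) has_field_derivative suminf (\<lambda>n. diffs c n * 0 ^ n)) (at 0)"
      by (rule termdiffs_strong_converges_everywhere)
    moreover have "suminf (\<lambda>n. diffs c n * 0 ^ n) = X $ i $ j"
      by (simp only: powser_zero) (simp add: diffs_def c_def)
    ultimately show ?thesis by (simp add: mexp_entry eq)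
  qed
  have "((\<lambda>t. mexp (t *\<^sub>R X)) has_derivative (\<lambda>s. s *\<^sub>R X)) (at 0)"
  proof (subst has_derivative_componentwise_within, intro ballI)
    fix b :: mat4 assume "b \<in> Basis"
    then obtain i j where b: "b = axis i (axis j 1)" by (auto simp: Basis_vec_def)
    have "((\<lambda>t. mexp (t *\<^sub>R X) $ i $ j) has_derivative (\<lambda>s. s * X $ i $ j)) (at 0)"
      using entry[of i j] unfolding has_field_derivative_def
      by (rule has_derivative_eq_rhs) (simp add: fun_eq_iff)
    then show "((\<lambda>t. mexp (t *\<^sub>R X) \<bullet> b) has_derivative (\<lambda>s. s *\<^sub>R X \<bullet> b)) (at 0)"
      by (simp add: b inner_axis)
  qed
  then show ?thesis by (simp add: has_vector_derivative_def)
qed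

lemma open_GL4: "open GL4"
proof -
  have "GL4 = {g. det g \<noteq> 0}" by (simp add: GL4_def invertible_det_nz)
  moreover have "continuous_on UNIV (\<lambda>g::mat4. det g)"
    unfolding det_def by (intro continuous_intros)
  ultimately show ?thesis
    using open_Collect_neq[of "\<lambda>g::mat4. det g" "\<lambda>_. 0"] by simp
qed

lemma bl_mult_right: "bounded_linear (\<lambda>A. (g::mat4) ** A)"
  by (intro linear_conv_bounded_linear[THEN iffD1] linearI)
    (simp_all add: matrix_add_ldistrib matrix_scalar_ac scalar_matrix_assoc)

lemma bl_mult_left: "bounded_linear (\<lambda>A. A ** (g::mat4))"
  by (intro linear_conv_bounded_linear[THEN iffD1] linearI)
    (simp_all add: matrix_matrix_mult_def vec_eq_iff sum.distrib distrib_right sum_distrib_left mult.assoc)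

lemma Cinf_has_derivative:
  "f \<in> Cinf_GL4 \<Longrightarrow> g \<in> GL4 \<Longrightarrow> (f has_derivative frechet_derivative f (at g)) (at g)"
  by (auto simp: Cinf_GL4_def frechet_derivative_works[symmetric] intro: smooth_on_differentiable)

lemma R_real_eq:
  assumes "f \<in> Cinf_GL4" "g \<in> GL4"
  shows "R_real X f g = frechet_derivative f (at g) (g ** X)"
proof -
  have "((\<lambda>t. g ** mexp (t *\<^sub>R X)) has_derivative (\<lambda>s. g ** (s *\<^sub>R X))) (at 0)"
    using bounded_linear.has_derivative[OF bl_mult_right
        mexp_has_derivative_0[unfolded has_vector_derivative_def]] .
  moreover have "(f has_derivative frechet_derivative f (at g)) (at (g ** mexp (0 *\<^sub>R X)))"
    using Cinf_has_derivative[OF assms] by simp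
  ultimately have "((\<lambda>t. f (g ** mexp (t *\<^sub>R X))) has_derivative
      (\<lambda>s. frechet_derivative f (at g) (g ** (s *\<^sub>R X)))) (at 0)"
    by (rule has_derivative_compose)
  moreover have "frechet_derivative f (at g) (g ** (s *\<^sub>R X)) = s *\<^sub>R frechet_derivative f (at g) (g ** X)" for s
    using has_derivative_linear[OF Cinf_has_derivative[OF assms]]
    by (simp add: matrix_scalar_ac scalar_matrix_assoc[symmetric] linear_cmul)
  ultimately have "((\<lambda>t. f (g ** mexp (t *\<^sub>R X))) has_vector_derivative
      frechet_derivative f (at g) (g ** X)) (at 0)"
    by (simp add: has_vector_derivative_def)
  then show ?thesis using assms by (simp add: R_real_def vector_derivative_at)
qed

lemma frechet_derivative_expand:
  fixes v :: mat4
  assumes "f \<in> Cinf_GL4" "g \<in> GL4"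
  shows "frechet_derivative f (at g) v = (\<Sum>b\<in>Basis. (v \<bullet> b) *\<^sub>R frechet_derivative f (at g) b)"
proof -
  have l: "linear (frechet_derivative f (at g))"
    using has_derivative_linear[OF Cinf_has_derivative[OF assms]] .
  have "frechet_derivative f (at g) (\<Sum>b\<in>Basis. (v \<bullet> b) *\<^sub>R b) = (\<Sum>b\<in>Basis. (v \<bullet> b) *\<^sub>R frechet_derivative f (at g) b)"
    by (simp add: linear_sum[OF l] linear_cmul[OF l])
  then show ?thesis by (simp add: euclidean_representation)
qed

lemma R_real_Cinf:
  assumes "f \<in> Cinf_GL4"
  shows "R_real X f \<in> Cinf_GL4"
proof -
  have sm: "smooth_on GL4 f" using assms by (simp add: Cinf_GL4_def)
  have "smooth_on GL4 (\<lambda>g. \<Sum>b\<in>Basis. ((g ** X) \<bullet> b) *\<^sub>R frechet_derivative f (at g) b)"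
    by (intro smooth_on_sum open_GL4 smooth_on_scaleR_linear smooth_on_deriv sm
        bounded_linear_compose[OF bounded_linear_inner_left bl_mult_left])
  then have "smooth_on GL4 (R_real X f)"
    by (rule smooth_on_cong[OF open_GL4, rotated])
      (simp add: R_real_eq[OF assms] frechet_derivative_expand[OF assms, symmetric])
  then show ?thesis by (simp add: Cinf_GL4_def R_real_def)
qed

lemma Cinf_add: "f \<in> Cinf_GL4 \<Longrightarrow> h \<in> Cinf_GL4 \<Longrightarrow> (\<lambda>g. f g + h g) \<in> Cinf_GL4"
  by (simp add: Cinf_GL4_def smooth_on_add open_GL4)

lemma Cinf_cmult: "f \<in> Cinf_GL4 \<Longrightarrow> (\<lambda>g. c * f g) \<in> Cinf_GL4"
  by (simp add: Cinf_GL4_def smooth_on_linear[OF open_GL4 bounded_linear_mult_right])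

lemma Cinf_zero: "(\<lambda>g. 0) \<in> Cinf_GL4"
  by (simp add: Cinf_GL4_def smooth_on_def C_k_zero)

lemma Cinf_sum:
  "(\<And>i. i \<in> A \<Longrightarrow> F i \<in> Cinf_GL4) \<Longrightarrow> (\<lambda>g. \<Sum>i\<in>A. F i g) \<in> Cinf_GL4"
  by (induction A rule: infinite_finite_induct) (auto simp: Cinf_zero Cinf_add)

lemma R_real_outside: "g \<notin> GL4 \<Longrightarrow> R_real X f g = 0"
  by (simp add: R_real_def)

lemma R_real_add:
  assumes "f \<in> Cinf_GL4" "h \<in> Cinf_GL4"
  shows "R_real X (\<lambda>g. f g + h g) = (\<lambda>g. R_real X f g + R_real X h g)"
proof
  fix g show "R_real X (\<lambda>g. f g + h g) g = R_real X f g + R_real X h g"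
  proof (cases "g \<in> GL4")
    case True
    have "frechet_derivative (\<lambda>g. f g + h g) (at g) =
        (\<lambda>v. frechet_derivative f (at g) v + frechet_derivative h (at g) v)"
      using frechet_derivative_at[OF has_derivative_add[OF Cinf_has_derivative[OF assms(1) True]
          Cinf_has_derivative[OF assms(2) True]]] by simp
    then show ?thesis using True by (simp add: R_real_eq assms Cinf_add)
  qed (simp add: R_real_outside)
qed

lemma R_real_cmult:
  assumes "f \<in> Cinf_GL4"
  shows "R_real X (\<lambda>g. c * f g) = (\<lambda>g. c * R_real X f g)"
proof
  fix g show "R_real X (\<lambda>g. c * f g) g = c * R_real X f g"
  proof (cases "g \<in> GL4")
    case True
    have "frechet_derivative (\<lambda>g. c * f g) (at g) v = c * frechet_derivative f (at g) v" for v
      using frechet_derivative_linear[OF bounded_linear_mult_right differentiableI[OF Cinf_has_derivative[OF assms True]]] .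
    then show ?thesis using True by (simp add: R_real_eq assms Cinf_cmult)
  qed (simp add: R_real_outside)
qed

lemma R_real_lin1:
  assumes "f \<in> Cinf_GL4"
  shows "R_real (a *\<^sub>R X + b *\<^sub>R Y) f g = of_real a * R_real X f g + of_real b * R_real Y f g"
proof (cases "g \<in> GL4")
  case True
  have l: "linear (frechet_derivative f (at g))"
    using has_derivative_linear[OF Cinf_has_derivative[OF assms True]] .
  have lg: "linear (\<lambda>A. g ** A)" using bounded_linear.linear[OF bl_mult_right] .
  have "g ** (a *\<^sub>R X + b *\<^sub>R Y) = a *\<^sub>R (g ** X) + b *\<^sub>R (g ** Y)"
    by (simp only: linear_add[OF lg] linear_cmul[OF lg])
  then show ?thesis
    using True by (simp add: R_real_eq[OF assms] linear_add[OF l] linear_cmul[OF l] scaleR_conv_of_real[where 'a=complex])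
qed (simp add: R_real_outside)

lemma R_real_bracket:
  assumes f: "f \<in> Cinf_GL4"
  shows "R_real X (R_real Y f) g - R_real Y (R_real X f) g = R_real (X ** Y - Y ** X) f g"
proof (cases "g \<in> GL4")
  case True
  have sm: "smooth_on GL4 f" using f by (simp add: Cinf_GL4_def)
  define S where "S v w = frechet_derivative (\<lambda>y. frechet_derivative f (at y) v) (at g) w" for v w
  have sym: "S v w = S w v" for v w
    unfolding S_def by (rule second_derivative_symmetric[OF open_GL4 sm True])
  have d: "((\<lambda>y. frechet_derivative f (at y) v) has_derivative S v) (at g)" for v
    using smooth_on_differentiable[OF smooth_on_deriv[OF sm] True]
    unfolding S_def[abs_def] frechet_derivative_works .
  have lS: "linear (S v)" for v using has_derivative_linear[OF d] .
  have l: "linear (frechet_derivative f (at g))"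
    using has_derivative_linear[OF Cinf_has_derivative[OF f True]] .
  have RR: "R_real X (R_real Y f) g = S (g ** X) (g ** Y) + frechet_derivative f (at g) (g ** X ** Y)" for X Y
  proof -
    have "((\<lambda>y. \<Sum>b\<in>Basis. ((y ** Y) \<bullet> b) *\<^sub>R frechet_derivative f (at y) b) has_derivative
        (\<lambda>v. \<Sum>b\<in>Basis. ((g ** Y) \<bullet> b) *\<^sub>R S b v + ((v ** Y) \<bullet> b) *\<^sub>R frechet_derivative f (at g) b)) (at g)"
      by (intro has_derivative_sum has_derivative_scaleR d bounded_linear_imp_has_derivative
          bounded_linear_compose[OF bounded_linear_inner_left bl_mult_left])
    then have "(R_real Y f has_derivative
        (\<lambda>v. \<Sum>b\<in>Basis. ((g ** Y) \<bullet> b) *\<^sub>R S b v + ((v ** Y) \<bullet> b) *\<^sub>R frechet_derivative f (at g) b)) (at g)"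
      by (rule has_derivative_transform_within_open[OF _ open_GL4 True])
        (simp add: R_real_eq[OF f] frechet_derivative_expand[OF f, symmetric])
    from frechet_derivative_at[OF this]
    have "frechet_derivative (R_real Y f) (at g) v =
        (\<Sum>b\<in>Basis. ((g ** Y) \<bullet> b) *\<^sub>R S b v) + frechet_derivative f (at g) (v ** Y)" for v
      by (simp add: sum.distrib frechet_derivative_expand[OF f True, symmetric] fun_eq_iff)
    moreover have "(\<Sum>b\<in>Basis. ((g ** Y) \<bullet> b) *\<^sub>R S b v) = S v (g ** Y)" for v
    proof -
      have "S v (\<Sum>b\<in>Basis. ((g ** Y) \<bullet> b) *\<^sub>R b) = (\<Sum>b\<in>Basis. ((g ** Y) \<bullet> b) *\<^sub>R S b v)"
        by (simp add: linear_sum[OF lS] linear_cmul[OF lS] sym[of v])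
      then show ?thesis by (simp add: euclidean_representation)
    qed
    ultimately show ?thesis using R_real_eq[OF R_real_Cinf[OF f] True] by simp
  qed
  have lg: "linear (\<lambda>A. g ** A)" using bounded_linear.linear[OF bl_mult_right] .
  have "g ** (X ** Y - Y ** X) = g ** X ** Y - g ** Y ** X"
    by (simp only: linear_diff[OF lg] matrix_mul_assoc)
  then show ?thesis
    using sym[of "g ** X" "g ** Y"] by (simp add: RR R_real_eq[OF f True] linear_diff[OF l])
qed (simp add: R_real_outside)

lemma R_gl4_Cinf: "f \<in> Cinf_GL4 \<Longrightarrow> R_gl4 X f \<in> Cinf_GL4"
  by (simp add: R_gl4_def[abs_def] Cinf_add Cinf_cmult R_real_Cinf)

lemma R_gl4_add:
  "f \<in> Cinf_GL4 \<Longrightarrow> h \<in> Cinf_GL4 \<Longrightarrow> R_gl4 X (\<lambda>g. f g + h g) = (\<lambda>g. R_gl4 X f g + R_gl4 X h g)"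
  by (simp add: R_gl4_def fun_eq_iff R_real_add algebra_simps)

lemma R_gl4_cmult: "f \<in> Cinf_GL4 \<Longrightarrow> R_gl4 X (\<lambda>g. c * f g) = (\<lambda>g. c * R_gl4 X f g)"
  by (simp add: R_gl4_def fun_eq_iff R_real_cmult algebra_simps)

lemma R_gl4_plus: "f \<in> Cinf_GL4 \<Longrightarrow> R_gl4 (X + Y) f g = R_gl4 X f g + R_gl4 Y f g"
proof -
  assume f: "f \<in> Cinf_GL4"
  have "map_matrix Re (X + Y) = 1 *\<^sub>R map_matrix Re X + 1 *\<^sub>R map_matrix Re Y"
       "map_matrix Im (X + Y) = 1 *\<^sub>R map_matrix Im X + 1 *\<^sub>R map_matrix Im Y"
    by (simp_all add: vec_eq_iff)
  then show ?thesis unfolding R_gl4_def by (simp only: R_real_lin1[OF f]) (simp add: algebra_simps)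
qed

lemma R_gl4_cscale: "f \<in> Cinf_GL4 \<Longrightarrow> R_gl4 (cscale c X) f g = c * R_gl4 X f g"
proof -
  assume f: "f \<in> Cinf_GL4"
  have "map_matrix Re (cscale c X) = Re c *\<^sub>R map_matrix Re X + (- Im c) *\<^sub>R map_matrix Im X"
       "map_matrix Im (cscale c X) = Im c *\<^sub>R map_matrix Re X + Re c *\<^sub>R map_matrix Im X"
    by (simp_all add: vec_eq_iff cscale_def)
  moreover have "c = of_real (Re c) + \<i> * of_real (Im c)" by (rule complex_eq)
  ultimately show ?thesis unfolding R_gl4_def
    by (simp only: R_real_lin1[OF f]) (simp add: algebra_simps complex_eq_iff)
qed

lemma R_gl4_bracket:
  assumes f: "f \<in> Cinf_GL4"
  shows "R_gl4 X (R_gl4 Y f) g - R_gl4 Y (R_gl4 X f) g = R_gl4 (X ** Y - Y ** X) f g"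
proof -
  let ?A = "map_matrix Re X" and ?B = "map_matrix Im X" and ?C = "map_matrix Re Y" and ?D = "map_matrix Im Y"
  have exp: "R_real A (R_gl4 Y f) g = R_real A (R_real (map_matrix Re Y) f) g + \<i> * R_real A (R_real (map_matrix Im Y) f) g"
    for A Y
    unfolding R_gl4_def[abs_def]
    by (simp add: R_real_add R_real_cmult R_real_Cinf f Cinf_cmult)
  have re: "map_matrix Re (X ** Y - Y ** X) = 1 *\<^sub>R (?A ** ?C - ?C ** ?A) + (-1) *\<^sub>R (?B ** ?D - ?D ** ?B)"
    by (simp add: vec_eq_iff matrix_matrix_mult_def sum_subtractf)
  have im: "map_matrix Im (X ** Y - Y ** X) = 1 *\<^sub>R (?A ** ?D - ?D ** ?A) + 1 *\<^sub>R (?B ** ?C - ?C ** ?B)"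
    by (simp add: vec_eq_iff matrix_matrix_mult_def sum_subtractf sum.distrib)
  show ?thesis
    unfolding R_gl4_def[of _ "R_gl4 _ _"] R_gl4_def[of "X ** Y - Y ** X"] exp re im
    by (simp only: R_real_lin1[OF f] R_real_bracket[OF f, symmetric]) (simp add: algebra_simps)
qed

lemma foldr_Cinf: "f \<in> Cinf_GL4 \<Longrightarrow> foldr R_gl4 ws f \<in> Cinf_GL4"
  by (induction ws) (auto simp: R_gl4_Cinf)

lemma foldr_add:
  assumes "f \<in> Cinf_GL4" "h \<in> Cinf_GL4"
  shows "foldr R_gl4 ws (\<lambda>g. f g + h g) = (\<lambda>g. foldr R_gl4 ws f g + foldr R_gl4 ws h g)"
  by (induction ws) (auto simp: R_gl4_add foldr_Cinf assms)

lemma foldr_cmult: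
  assumes "f \<in> Cinf_GL4"
  shows "foldr R_gl4 ws (\<lambda>g. c * f g) = (\<lambda>g. c * foldr R_gl4 ws f g)"
  by (induction ws) (auto simp: R_gl4_cmult foldr_Cinf assms)

lemma R_free_superset:
  assumes "finite A" "Poly_Mapping.keys t \<subseteq> A"
  shows "R_free t f g = (\<Sum>w\<in>A. Poly_Mapping.lookup t w * foldr R_gl4 (letters w) f g)"
  unfolding R_free_def using assms
  by (intro sum.mono_neutral_left) (auto simp: in_keys_iff)

lemma R_free_add: "R_free (s + t) f = (\<lambda>g. R_free s f g + R_free t f g)"
proof
  fix g
  let ?A = "Poly_Mapping.keys s \<union> Poly_Mapping.keys t"
  show "R_free (s + t) f g = R_free s f g + R_free t f g"
    using R_free_superset[of ?A "s + t"] R_free_superset[of ?A s] R_free_superset[of ?A t] keys_add[of s t]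
    by (simp add: lookup_add sum.distrib algebra_simps)
qed

lemma R_free_single: "R_free (Poly_Mapping.single w c) f = (\<lambda>g. c * foldr R_gl4 (letters w) f g)"
  using R_free_superset[of "{w}" "Poly_Mapping.single w c"] by (auto simp: fun_eq_iff)

lemma R_free_gen: "R_free (gen X) f = R_gl4 X f"
  by (simp add: gen_def R_free_single)

lemma R_free_zero: "R_free 0 f = (\<lambda>g. 0)"
  by (simp add: R_free_def fun_eq_iff)

lemma R_free_uminus: "R_free (- t) f = (\<lambda>g. - R_free t f g)"
  using R_free_add[of "- t" t f] by (auto simp: R_free_zero fun_eq_iff eq_neg_iff_add_eq_0 dest: fun_cong)

lemma R_free_diff: "R_free (s - t) f = (\<lambda>g. R_free s f g - R_free t f g)"
  using R_free_add[of s "- t" f] by (simp add: R_free_uminus)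

lemma R_free_Cinf: "f \<in> Cinf_GL4 \<Longrightarrow> R_free t f \<in> Cinf_GL4"
  by (simp add: R_free_def[abs_def] Cinf_sum Cinf_cmult foldr_Cinf)

lemma free_alg_induct:
  fixes t :: free_alg
  assumes single: "\<And>w c. P (Poly_Mapping.single w c)" and add: "\<And>s t. P s \<Longrightarrow> P t \<Longrightarrow> P (s + t)"
  shows "P t"
proof (induction t rule: update_induct)
  case const
  then show ?case using single[of 0 0] by simp
next
  case (update t w c)
  have "Poly_Mapping.update w c t = t + Poly_Mapping.single w c"
    using update by (intro poly_mapping_eqI) (auto simp: lookup_update lookup_add lookup_single in_keys_iff)
  then show ?case using add[OF update(3) single] by simp
qed

lemma R_free_arg_add:
  "f \<in> Cinf_GL4 \<Longrightarrow> h \<in> Cinf_GL4 \<Longrightarrow> R_free t (\<lambda>g. f g + h g) = (\<lambda>g. R_free t f g + R_free t h g)"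
  by (simp add: R_free_def fun_eq_iff foldr_add algebra_simps sum.distrib)

lemma R_free_arg_cmult:
  "f \<in> Cinf_GL4 \<Longrightarrow> R_free t (\<lambda>g. c * f g) = (\<lambda>g. c * R_free t f g)"
  by (simp add: R_free_def fun_eq_iff foldr_cmult algebra_simps sum_distrib_left)

lemma R_free_mult:
  assumes f: "f \<in> Cinf_GL4"
  shows "R_free (s * t) f = R_free s (R_free t f)"
proof (induction t rule: free_alg_induct)
  case (1 w c)
  show ?case
  proof (induction s rule: free_alg_induct)
    case (1 v d)
    have "foldr R_gl4 (letters v) (\<lambda>g. c * foldr R_gl4 (letters w) f g) =
        (\<lambda>g. c * foldr R_gl4 (letters v) (foldr R_gl4 (letters w) f) g)"
      by (rule foldr_cmult[OF foldr_Cinf[OF f]])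
    then show ?case
      by (simp add: mult_single R_free_single plus_free_monoid_def fun_eq_iff)
  next
    case (2 s t)
    then show ?case by (simp add: distrib_right R_free_add)
  qed
next
  case (2 t u)
  then show ?case by (simp add: distrib_left R_free_add R_free_arg_add R_free_Cinf f)
qed

lemma R_free_env_rel: "t \<in> env_rel \<Longrightarrow> f \<in> Cinf_GL4 \<Longrightarrow> R_free t f = (\<lambda>g. 0)"
proof (induction t arbitrary: f rule: env_rel.induct)
  case (left t s)
  have "R_free s (\<lambda>g. 0) = (\<lambda>g. 0)"
    using R_free_arg_cmult[OF Cinf_zero, of s 0] by simp
  then show ?case using left by (simp add: R_free_mult)
next
  case (scale c X)
  then show ?case
    by (simp add: R_free_diff R_free_mult R_free_gen R_gl4_cscale const_def R_free_single zero_free_monoid_def)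
qed (simp_all add: R_free_zero R_free_add R_free_diff R_free_mult R_free_Cinf R_free_gen R_gl4_plus
      R_gl4_bracket)

lemma R_U_abs: "f \<in> Cinf_GL4 \<Longrightarrow> R_U (abs_Ugl4 t) f = R_free t f"
proof -
  assume f: "f \<in> Cinf_GL4"
  have "abs_Ugl4 (rep_Ugl4 (abs_Ugl4 t)) = abs_Ugl4 t"
    by (rule Quotient3_abs_rep[OF Quotient3_Ugl4])
  then have "rep_Ugl4 (abs_Ugl4 t) - t \<in> env_rel"
    by (simp add: Ugl4.abs_eq_iff)
  from R_free_env_rel[OF this f] show ?thesis
    by (simp add: R_U_def R_free_diff fun_eq_iff)
qed

lemma R_U_of_gl4: "f \<in> Cinf_GL4 \<Longrightarrow> R_U (of_gl4 X) f = R_gl4 X f"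
  by (simp add: of_gl4_def R_U_abs R_free_gen)

lemma R_U_mult: "f \<in> Cinf_GL4 \<Longrightarrow> R_U (u * v) f = R_U u (R_U v f)"
proof -
  assume f: "f \<in> Cinf_GL4"
  obtain s t where "u = abs_Ugl4 s" "v = abs_Ugl4 t"
    by (metis Quotient3_abs_rep[OF Quotient3_Ugl4])
  then show ?thesis using f
    by (simp add: times_Ugl4.abs_eq R_U_abs R_free_mult R_free_Cinf)
qed

section \<open>The character and the function spaces\<close>

definition nilp :: "mat4 set" where
  "nilp = span {munit 2 1, munit 3 2, munit 4 3, munit 3 1, munit 4 2, munit 4 1}"

definition S_II :: "mat4 set" where
  "S_II = mexp ` span {munit 2 1, munit 4 3, munit 3 1, munit 4 2, munit 4 1}"

definition lform :: "real \<Rightarrow> real \<Rightarrow> real \<Rightarrow> real \<Rightarrow> real \<Rightarrow> real \<Rightarrow> mat4 \<Rightarrow> real" where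
  "lform \<alpha> \<beta>\<^sub>1 \<beta>\<^sub>2 \<gamma>\<^sub>1 \<gamma>\<^sub>2 \<gamma>\<^sub>3 X =
    \<alpha> * X $ 4 $ 1 + \<beta>\<^sub>1 * X $ 3 $ 1 + \<beta>\<^sub>2 * X $ 4 $ 2
      + \<gamma>\<^sub>1 * X $ 2 $ 1 + \<gamma>\<^sub>2 * X $ 3 $ 2 + \<gamma>\<^sub>3 * X $ 4 $ 3"

text \<open>\<open>\<chi>\<^sub>l(exp X) = exp (2\<pi>i l(X))\<close>, see \<open>character_mexp\<close> below.\<close>

definition character :: "(mat4 \<Rightarrow> real) \<Rightarrow> mat4 \<Rightarrow> complex" where
  "character l s = exp (2 * of_real pi * \<i> * of_real (l (inv_into nilp mexp s)))"

lemma nilp_entries: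
  assumes "X \<in> nilp"
  shows "X $ 1 $ 1 = 0" "X $ 1 $ 2 = 0" "X $ 1 $ 3 = 0" "X $ 1 $ 4 = 0" "X $ 2 $ 2 = 0"
    "X $ 2 $ 3 = 0" "X $ 2 $ 4 = 0" "X $ 3 $ 3 = 0" "X $ 3 $ 4 = 0" "X $ 4 $ 4 = 0"
proof -
  let ?L = "{X::mat4. X $ 1 $ 1 = 0 \<and> X $ 1 $ 2 = 0 \<and> X $ 1 $ 3 = 0 \<and> X $ 1 $ 4 = 0 \<and> X $ 2 $ 2 = 0 \<and>
    X $ 2 $ 3 = 0 \<and> X $ 2 $ 4 = 0 \<and> X $ 3 $ 3 = 0 \<and> X $ 3 $ 4 = 0 \<and> X $ 4 $ 4 = 0}"
  have "nilp \<subseteq> ?L"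
    unfolding nilp_def by (rule span_minimal) (auto simp: munit_def subspace_def)
  then show "X $ 1 $ 1 = 0" "X $ 1 $ 2 = 0" "X $ 1 $ 3 = 0" "X $ 1 $ 4 = 0" "X $ 2 $ 2 = 0"
    "X $ 2 $ 3 = 0" "X $ 2 $ 4 = 0" "X $ 3 $ 3 = 0" "X $ 3 $ 4 = 0" "X $ 4 $ 4 = 0"
    using assms by auto
qed

lemma mexp_nilp:
  assumes "X \<in> nilp"
  shows "mexp X $ i $ j = (mat 1 + X + (1 / 2) *\<^sub>R (X ** X) + (1 / 6) *\<^sub>R (X ** X ** X)) $ i $ j"
proof -
  have "X ** X ** X ** X = 0"
    by (simp add: vec_eq_iff forall_4 matrix_matrix_mult_def sum_4 nilp_entries[OF assms])
  then have 4: "matpow X 4 = 0"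
    by (simp add: numeral_eq_Suc matrix_mul_assoc)
  have "matpow X (n + 4) = 0" for n
  proof (induction n)
    case (Suc n)
    have "X ** (0::mat4) = 0" by (simp add: matrix_matrix_mult_def vec_eq_iff)
    then show ?case using Suc by (simp only: add_Suc funpow.simps o_apply)
  qed (use 4 in simp)
  then have z: "matpow X n = 0" if "n \<notin> {..<4}" for n
    using that by (metis add.commute le_add_diff_inverse lessThan_iff not_less)
  have "mexp X $ i $ j = (\<Sum>n<4. matpow X n $ i $ j / fact n)"
    unfolding mexp_entry by (rule suminf_finite) (auto simp: z)
  then show ?thesis
    by (simp add: eval_nat_numeral matrix_mul_assoc)
qed

lemma inj_on_mexp_nilp: "inj_on mexp nilp"
proof (rule inj_onI)
  fix X Y assume X: "X \<in> nilp" and Y: "Y \<in> nilp" and eq: "mexp X = mexp Y"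
  note e = mexp_nilp[OF X] mexp_nilp[OF Y] nilp_entries[OF X] nilp_entries[OF Y]
  have E: "mexp X $ i $ j = mexp Y $ i $ j" for i j using eq by simp
  have 1: "X $ 2 $ 1 = Y $ 2 $ 1" "X $ 3 $ 2 = Y $ 3 $ 2" "X $ 4 $ 3 = Y $ 4 $ 3"
    using E[of 2 1] E[of 3 2] E[of 4 3] by (simp_all add: e matrix_matrix_mult_def sum_4 mat_def)
  have 2: "X $ 3 $ 1 = Y $ 3 $ 1" "X $ 4 $ 2 = Y $ 4 $ 2"
    using E[of 3 1] E[of 4 2] by (simp_all add: e matrix_matrix_mult_def sum_4 mat_def 1)
  have "X $ 4 $ 1 = Y $ 4 $ 1"
    using E[of 4 1] by (simp add: e matrix_matrix_mult_def sum_4 mat_def 1 2)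
  then show "X = Y"
    by (simp add: vec_eq_iff forall_4 e 1 2)
qed

lemma character_mexp: "X \<in> nilp \<Longrightarrow> character l (mexp X) = exp (2 * of_real pi * \<i> * of_real (l X))"
  by (simp add: character_def inv_into_f_f[OF inj_on_mexp_nilp])

definition Cinf_chi :: "(mat4 \<Rightarrow> complex) \<Rightarrow> Ugl4 set \<Rightarrow> (mat4 \<Rightarrow> complex) set" where
  "Cinf_chi ch I = {f \<in> Cinf_GL4.
     (\<forall>s\<in>S_II. \<forall>g\<in>GL4. \<forall>k\<in>O4. f (s ** g ** k) = ch s * f g) \<and>
     (\<forall>X\<in>I. \<forall>g\<in>GL4. R_U X f g = 0)}"

definition diag :: "real ^ 4 \<Rightarrow> mat4" where
  "diag a = (\<chi> i j. if i = j then a $ i else 0)"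

text \<open>Functions of \<open>(u; a)\<close> are likewise extended by zero off the domain \<open>a\<^sub>i > 0\<close>.\<close>

definition Xi_II :: "(mat4 \<Rightarrow> complex) \<Rightarrow> real \<times> (real ^ 4) \<Rightarrow> complex" where
  "Xi_II f = (\<lambda>(u, a). if \<forall>i. 0 < a $ i then f (mexp (u *\<^sub>R munit 3 2) ** diag a) else 0)"

definition Cinf_chi_NA :: "(mat4 \<Rightarrow> complex) \<Rightarrow> Ugl4 set \<Rightarrow> (real \<times> (real ^ 4) \<Rightarrow> complex) set" where
  "Cinf_chi_NA ch I = Xi_II ` Cinf_chi ch I"

global_interpretation cfun: vector_space "\<lambda>(c::complex) (f::'a \<Rightarrow> complex) x. c * f x"
  defines cspan = cfun.span and cdim = cfun.dim
  by unfold_locales (auto simp: fun_eq_iff algebra_simps)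

section \<open>Bessel functions and growth\<close>

text \<open>Functions on \<open>x > 0\<close>, extended by zero.\<close>

definition MB :: "complex \<Rightarrow> (real \<Rightarrow> complex) set" where
  "MB \<nu> = {f. (\<forall>x\<le>0. f x = 0) \<and>
     (\<exists>f' f''. \<forall>x>0. (f has_vector_derivative f' x) (at x) \<and>
        (f' has_vector_derivative f'' x) (at x) \<and>
        f'' x + f' x / of_real x - (1 + \<nu>\<^sup>2 / of_real (x\<^sup>2)) * f x = 0)}"

definition x_of_a :: "real ^ 4 \<Rightarrow> real ^ 4" where
  "x_of_a a = vector [a $ 1 * a $ 2, a $ 2 / a $ 1, a $ 3 * a $ 4, a $ 4 / a $ 3]"

definition a_of_x :: "real ^ 4 \<Rightarrow> real ^ 4" where
  "a_of_x x = vector [sqrt (x $ 1 / x $ 2), sqrt (x $ 1 * x $ 2),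
                      sqrt (x $ 3 / x $ 4), sqrt (x $ 3 * x $ 4)]"

lemma a_of_x_of_a: "\<forall>i. 0 < a $ i \<Longrightarrow> a_of_x (x_of_a a) = a"
  by (simp add: forall_4 vec_eq_iff a_of_x_def x_of_a_def vector_def real_sqrt_mult)

lemma x_of_a_of_x: "\<forall>i. 0 < x $ i \<Longrightarrow> x_of_a (a_of_x x) = x"
  by (simp add: forall_4 vec_eq_iff a_of_x_def x_of_a_def vector_def real_sqrt_mult real_sqrt_divide)

definition whittaker ::
  "complex \<Rightarrow> complex \<Rightarrow> (real \<Rightarrow> complex) \<Rightarrow> (real \<Rightarrow> complex) \<Rightarrow> real \<times> (real ^ 4) \<Rightarrow> complex" where
  "whittaker l\<^sub>1 l\<^sub>2 f g = (\<lambda>(u, a). if \<forall>i. 0 < a $ i then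
     let x = x_of_a a in
       of_real (x $ 1) powr ((l\<^sub>1 + l\<^sub>2 - 1) / 2) * of_real (x $ 2) powr (1 / 2) *
       of_real (x $ 3) powr ((l\<^sub>1 + l\<^sub>2 + 1) / 2) * of_real (x $ 4) powr (1 / 2) *
       f (2 * pi * x $ 2) * g (2 * pi * x $ 4)
     else 0)"

definition slowly_increasing_on :: "'a::real_normed_vector set \<Rightarrow> ('a \<Rightarrow> complex) \<Rightarrow> bool" where
  "slowly_increasing_on D f \<longleftrightarrow>
     (\<exists>M::nat. bdd_above ((\<lambda>x. norm (f x) / (1 + norm x) ^ M) ` D))"

text \<open>A function of \<open>(u; a)\<close> as a function of \<open>(x, u)\<close>; the norm on the product is the Euclidean
  norm of \<open>\<real>\<^sup>5\<close>.\<close>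

definition in_x :: "(real \<times> (real ^ 4) \<Rightarrow> complex) \<Rightarrow> (real ^ 4) \<times> real \<Rightarrow> complex" where
  "in_x F = (\<lambda>(x, u). F (u, a_of_x x))"

text \<open>The domain \<open>x\<^sub>i > 0\<close> is \<open>xu_domain 0\<close>. The domains with \<open>\<epsilon> > 0\<close> keep away from the walls \<open>x\<^sub>i = 0\<close>,
  where already a power of \<open>x\<^sub>i\<close> with exponent of negative real part is unbounded, so on them only the
  behaviour at infinity counts.\<close>

definition xu_domain :: "real \<Rightarrow> ((real ^ 4) \<times> real) set" where
  "xu_domain \<epsilon> = {(x, u). \<forall>i. \<epsilon> < x $ i}"

end

theory Submission
  imports Defs
begin

text \<open>
  Since \<open>G = N A K\<close> and \<open>N = S exp(\<real> E\<^sub>3\<^sub>2)\<close>, a function \<open>f\<close> of the space is determined by its values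
  at the points \<open>exp(u E\<^sub>3\<^sub>2) a\<close>. At such a point a function that is left equivariant under \<open>S\<close> is
  multiplied by \<open>p = 2 \<pi> i a\<^sub>2/a\<^sub>1\<close> under \<open>E\<^sub>2\<^sub>1\<close>, by \<open>q = 2 \<pi> i a\<^sub>4/a\<^sub>3\<close> under \<open>E\<^sub>4\<^sub>3\<close>, and killed by \<open>E\<^sub>3\<^sub>1\<close>,
  \<open>E\<^sub>4\<^sub>2\<close> and \<open>E\<^sub>4\<^sub>1\<close> (\<open>E_nilpotent\<close>); \<open>E\<^sub>3\<^sub>2\<close> is a multiple of \<open>d/du\<close>, and \<open>E\<^sub>i\<^sub>i\<close> is \<open>a\<^sub>i d/da\<^sub>i\<close>. Invariance
  under \<open>K\<close> means \<open>E\<^sub>i\<^sub>j f = E\<^sub>j\<^sub>i f\<close>. Moving the strictly lower triangular \<open>E\<^sub>i\<^sub>j\<close> to the left turns the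
  entries of \<open>(\<bbbE> - \<lambda>\<^sub>1)(\<bbbE> - \<lambda>\<^sub>2 - k)\<close> into explicit operators in \<open>(u; a)\<close> (\<open>radial_parts\<close>).

  The entry \<open>(3,1)\<close> is \<open>p E\<^sub>3\<^sub>2\<close>, so \<open>f\<close> does not depend on \<open>u\<close>. The entries \<open>(2,1)\<close> and \<open>(4,3)\<close> say
  that \<open>f\<close> is homogeneous of degree \<open>\<lambda>\<^sub>1 + \<lambda>\<^sub>2 + k - 3\<close> in \<open>(a\<^sub>1, a\<^sub>2)\<close> and of degree \<open>\<lambda>\<^sub>1 + \<lambda>\<^sub>2 + k - 1\<close>
  in \<open>(a\<^sub>3, a\<^sub>4)\<close>. Their sum has to be \<open>k \<lambda>\<^sub>1 + (4 - k) \<lambda>\<^sub>2\<close>, that is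
  \<open>(k - 2)(\<lambda>\<^sub>2 - \<lambda>\<^sub>1 + 2) = 0\<close>. For \<open>k = 1\<close> this forces \<open>f = 0\<close>. For \<open>k = 2\<close> homogeneity gives the powers of
  \<open>x\<^sub>1\<close> and \<open>x\<^sub>3\<close>, and the entries \<open>(1,1)\<close> and \<open>(4,4)\<close> become the modified Bessel equation in
  \<open>2 \<pi> x\<^sub>2\<close> and in \<open>2 \<pi> x\<^sub>4\<close> (\<open>profile_bessel\<close>). A function of two variables that solves the
  equation in each of them is a combination of products (\<open>bessel_tensor_decomposition\<close>).

  Conversely, Gram--Schmidt orthogonalisation of the rows of \<open>g\<close> makes the Iwasawa decomposition a
  smooth function of \<open>g\<close>, so that a product of Bessel functions extends from \<open>A\<close> to a smooth
  function on \<open>G\<close> (\<open>lift_NA\<close>). The system is equivariant under \<open>S\<close> and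
  covariant under \<open>K\<close>, hence it suffices to check it at \<open>exp(u E\<^sub>3\<^sub>2) a\<close>, where it is the computation above.

  The Bessel equation itself is treated through the Frobenius solutions for \<open>\<nu>\<close> and \<open>- \<nu>\<close>, which are
  independent as \<open>\<nu>\<close> is not an integer, and through the constancy of the Wronskian. Some solution \<open>I\<close>
  grows exponentially (\<open>bessel_solution_grows\<close>), and subtracting the right multiple of it from
  another solution leaves a solution \<open>K\<close> with \<open>sqrt x K(x)\<close> bounded at infinity
  (\<open>bessel_fundamental_system\<close>). Among the combinations of
  the four products only the multiples of \<open>K \<otimes> K\<close> increase slowly.
\<close>

section \<open>The modified Bessel equation\<close>

text \<open>The equation as a first order system for \<open>f\<close> and \<open>f1 = x f'\<close>. With respect to \<open>log x\<close> it has
  trace zero, which is why the Wronskian \<open>f g1 - f1 g\<close> of two solutions is constant.\<close>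
definition bessel_pair :: "complex \<Rightarrow> (real \<Rightarrow> complex) \<Rightarrow> (real \<Rightarrow> complex) \<Rightarrow> bool" where
  "bessel_pair \<nu> f f1 \<longleftrightarrow> (\<forall>x>0. (f has_vector_derivative f1 x / x) (at x) \<and>
     (f1 has_vector_derivative (x\<^sup>2 + \<nu>\<^sup>2) * f x / x) (at x))"

lemma bessel_pairD:
  assumes "bessel_pair \<nu> f f1" "x > 0"
  shows "(f has_vector_derivative f1 x / x) (at x)"
    and "(f1 has_vector_derivative (x\<^sup>2 + \<nu>\<^sup>2) * f x / x) (at x)"
  using assms by (auto simp: bessel_pair_def)

lemma MB_iff_bessel_pair:
  "f \<in> MB \<nu> \<longleftrightarrow> (\<forall>x\<le>0. f x = 0) \<and> (\<exists>f1. bessel_pair \<nu> f f1)"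
proof (intro iffI conjI)
  assume "f \<in> MB \<nu>"
  then obtain f' f'' where f: "\<And>x. x > 0 \<Longrightarrow> (f has_vector_derivative f' x) (at x)"
      "\<And>x. x > 0 \<Longrightarrow> (f' has_vector_derivative f'' x) (at x)"
      "\<And>x. x > 0 \<Longrightarrow> f'' x + f' x / of_real x - (1 + \<nu>\<^sup>2 / of_real (x\<^sup>2)) * f x = 0"
    by (auto simp: MB_def)
  have "bessel_pair \<nu> f (\<lambda>x. of_real x * f' x)"
    unfolding bessel_pair_def
  proof (intro allI impI conjI)
    fix x :: real assume x: "x > 0"
    show "(f has_vector_derivative of_real x * f' x / of_real x) (at x)"
      using f(1)[OF x] x by simp
    have "((\<lambda>x. of_real x * f' x) has_vector_derivative (of_real x * f'' x + 1 * f' x)) (at x)"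
      by (intro has_vector_derivative_mult f(2)[OF x])
        (use has_vector_derivative_of_real[OF DERIV_ident] in simp)
    moreover have "of_real x * f'' x + 1 * f' x = (of_real (x\<^sup>2) + \<nu>\<^sup>2) * f x / of_real x"
    proof -
      have "f'' x = (1 + \<nu>\<^sup>2 / of_real (x\<^sup>2)) * f x - f' x / of_real x"
        using f(3)[OF x] by (simp add: algebra_simps)
      then show ?thesis
        by (simp only:) (use x in \<open>simp add: field_simps power2_eq_square\<close>)
    qed
    ultimately show "((\<lambda>x. of_real x * f' x) has_vector_derivative (of_real (x\<^sup>2) + \<nu>\<^sup>2) * f x / of_real x) (at x)"
      by simp
  qed
  then show "\<exists>f1. bessel_pair \<nu> f f1" by blast
next
  assume "f \<in> MB \<nu>" then show "\<forall>x\<le>0. f x = 0" by (simp add: MB_def)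
next
  assume "(\<forall>x\<le>0. f x = 0) \<and> (\<exists>f1. bessel_pair \<nu> f f1)"
  then obtain f1 where 0: "\<forall>x\<le>0. f x = 0" and p: "bessel_pair \<nu> f f1" by blast
  define f' where "f' x = f1 x * of_real (1 / x)" for x
  define f'' where "f'' x = f1 x * of_real (- 1 / x\<^sup>2) + (x\<^sup>2 + \<nu>\<^sup>2) * f x / x * of_real (1 / x)" for x
  have "(f has_vector_derivative f' x) (at x)" if "x > 0" for x
    using bessel_pairD(1)[OF p that] by (simp add: f'_def)
  moreover have "(f' has_vector_derivative f'' x) (at x)" if "x > 0" for x
  proof -
    have d: "((\<lambda>x. of_real (1 / x) :: complex) has_vector_derivative of_real (- 1 / x\<^sup>2)) (at x)"
      by (intro has_vector_derivative_of_real) 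
        (use that in \<open>auto intro!: derivative_eq_intros simp: power2_eq_square\<close>)
    show ?thesis
      unfolding f'_def[abs_def] f''_def
      by (rule has_vector_derivative_eq_rhs[OF has_vector_derivative_mult[OF bessel_pairD(2)[OF p that] d]]) simp
  qed
  moreover have "f'' x + f' x / of_real x - (1 + \<nu>\<^sup>2 / of_real (x\<^sup>2)) * f x = 0" if "x > 0" for x
    using that by (simp add: f'_def f''_def field_simps power2_eq_square)
  ultimately show "f \<in> MB \<nu>" using 0 unfolding MB_def by blast
qed

lemma bessel_pair_lincomb:
  assumes "bessel_pair \<nu> f f1" "bessel_pair \<nu> g g1"
  shows "bessel_pair \<nu> (\<lambda>x. a * f x + b * g x) (\<lambda>x. a * f1 x + b * g1 x)"
  unfolding bessel_pair_def
proof (intro allI impI conjI)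
  fix x :: real assume x: "x > 0"
  note d = bessel_pairD[OF assms(1) x] bessel_pairD[OF assms(2) x]
  show "((\<lambda>x. a * f x + b * g x) has_vector_derivative (a * f1 x + b * g1 x) / x) (at x)"
    by (rule has_vector_derivative_eq_rhs[OF has_vector_derivative_add[OF
          has_vector_derivative_mult_right[OF d(1)] has_vector_derivative_mult_right[OF d(3)]]])
      (simp add: add_divide_distrib)
  show "((\<lambda>x. a * f1 x + b * g1 x) has_vector_derivative (x\<^sup>2 + \<nu>\<^sup>2) * (a * f x + b * g x) / x) (at x)"
    by (rule has_vector_derivative_eq_rhs[OF has_vector_derivative_add[OF
          has_vector_derivative_mult_right[OF d(2)] has_vector_derivative_mult_right[OF d(4)]]])
      (use x in \<open>simp add: field_simps\<close>)
qed

lemma bessel_pair_minus: "bessel_pair (- \<nu>) = bessel_pair \<nu>"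
  by (simp add: bessel_pair_def fun_eq_iff)

text \<open>Abel's identity: in the variable \<open>log x\<close> the equation has no first order term.\<close>

lemma bessel_wronskian_const:
  assumes "bessel_pair \<nu> f f1" "bessel_pair \<nu> g g1"
  obtains W where "\<And>x. x > 0 \<Longrightarrow> f x * g1 x - f1 x * g x = W"
proof -
  have d0: "((\<lambda>x. f x * g1 x - f1 x * g x) has_vector_derivative 0) (at x within {0<..})"
    if "x \<in> {0<..}" for x
  proof -
    have x: "x > 0" using that by simp
    note d = bessel_pairD[OF assms(1) x] bessel_pairD[OF assms(2) x]
    show ?thesis
      by (rule has_vector_derivative_at_within,
          rule has_vector_derivative_eq_rhs[OF has_vector_derivative_diff[OF
            has_vector_derivative_mult[OF d(1) d(4)] has_vector_derivative_mult[OF d(2) d(3)]]])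
        (use x in \<open>simp add: field_simps\<close>)
  qed
  show ?thesis
    by (rule has_vector_derivative_zero_constant[OF _ d0]) (use that in auto)
qed

text \<open>The modified Bessel function \<open>I\<^sub>\<nu>\<close> is, up to a constant factor, \<open>x powr \<nu>\<close> times a power
  series in \<open>x\<^sup>2\<close> with these coefficients.\<close>
definition bessel_coeff :: "complex \<Rightarrow> nat \<Rightarrow> complex" where
  "bessel_coeff \<nu> n = 1 / (4 ^ n * fact n * pochhammer (\<nu> + 1) n)"

definition bessel_series :: "complex \<Rightarrow> complex \<Rightarrow> complex" where
  "bessel_series \<nu> z = suminf (\<lambda>n. bessel_coeff \<nu> n * z ^ n)"

definition bessel_series' :: "complex \<Rightarrow> complex \<Rightarrow> complex" where
  "bessel_series' \<nu> z = suminf (\<lambda>n. diffs (bessel_coeff \<nu>) n * z ^ n)"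

lemma bessel_coeff_Suc:
  assumes "\<nu> \<notin> \<int>"
  shows "4 * of_nat (Suc n) * (\<nu> + 1 + of_nat n) * bessel_coeff \<nu> (Suc n) = bessel_coeff \<nu> n"
proof -
  have ne: "\<nu> + 1 + of_nat n \<noteq> 0" for n
  proof
    assume "\<nu> + 1 + of_nat n = 0"
    then have "\<nu> = of_int (- 1 - int n)"
      by (simp add: eq_neg_iff_add_eq_0 add_ac eq_diff_eq)
    then show False using assms by (metis Ints_of_int)
  qed
  have *: "4 * N * c * (1 / (4 * p * (N * F) * (P * c))) = 1 / (p * F * P)"
    if "N \<noteq> 0" "c \<noteq> 0" "P \<noteq> 0" "F \<noteq> 0" for N c P F p :: complex
    using that by (simp add: field_simps)
  have "pochhammer (\<nu> + 1) n \<noteq> 0"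
    unfolding pochhammer_eq_0_iff using ne by (metis left_minus)
  then show ?thesis
    unfolding bessel_coeff_def pochhammer_Suc fact_Suc power_Suc
    by (intro *) (use ne[of n] in \<open>simp_all del: of_nat_Suc\<close>)
qed

lemma summable_bessel_series:
  assumes "\<nu> \<notin> \<int>"
  shows "summable (\<lambda>n. bessel_coeff \<nu> n * z ^ n)"
proof (rule summable_ratio_test[where c="1/2" and N="nat \<lceil>norm z + norm \<nu> + 2\<rceil>"])
  fix n assume n: "n \<ge> nat \<lceil>norm z + norm \<nu> + 2\<rceil>"
  then have n': "real n \<ge> norm z + norm \<nu> + 2" by linarith
  have "norm (of_nat n :: complex) \<le> norm (\<nu> + 1 + of_nat n) + norm (\<nu> + 1)"
    using norm_triangle_ineq4[of "\<nu> + 1 + of_nat n" "\<nu> + 1"] by simp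
  moreover have "norm (\<nu> + 1) \<le> norm \<nu> + 1" using norm_triangle_ineq[of \<nu> 1] by simp
  ultimately have 1: "norm (\<nu> + 1 + of_nat n) \<ge> 1"
    using n' norm_ge_zero[of z] unfolding norm_of_nat by linarith
  have "norm z * 1 \<le> (4 * real (Suc n) * norm (\<nu> + 1 + of_nat n)) * (1 / 2)"
  proof -
    have "norm z \<le> 2 * real (Suc n) * 1" using n' norm_ge_zero[of \<nu>] norm_ge_zero[of z] unfolding of_nat_Suc mult_1_right distrib_left by linarith
    also have "\<dots> \<le> 2 * real (Suc n) * norm (\<nu> + 1 + of_nat n)" using 1 by (intro mult_left_mono) auto
    finally show ?thesis by (simp add: algebra_simps)
  qed
  then have "norm (bessel_coeff \<nu> (Suc n)) * norm z ^ n * norm z \<le>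
      norm (bessel_coeff \<nu> (Suc n)) * norm z ^ n * ((4 * real (Suc n) * norm (\<nu> + 1 + of_nat n)) * (1 / 2))"
    by (intro mult_left_mono) auto
  also have "\<dots> = 1 / 2 * norm (4 * of_nat (Suc n) * (\<nu> + 1 + of_nat n) * bessel_coeff \<nu> (Suc n)) * norm z ^ n"
    by (simp add: norm_mult del: of_nat_Suc)
  finally show "norm (bessel_coeff \<nu> (Suc n) * z ^ Suc n) \<le> 1 / 2 * norm (bessel_coeff \<nu> n * z ^ n)"
    unfolding bessel_coeff_Suc[OF assms] by (simp add: norm_mult norm_power mult_ac)
qed simp

lemma bessel_series_deriv:
  assumes "\<nu> \<notin> \<int>"
  shows "(bessel_series \<nu> has_field_derivative bessel_series' \<nu> z) (at z)"
  using termdiffs_strong_converges_everywhere[OF summable_bessel_series[OF assms]]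
  unfolding bessel_series_def[abs_def] bessel_series'_def .

text \<open>Comparing coefficients of \<open>z ^ n\<close>, the differential equation for the series is the recursion
  \<open>bessel_coeff_Suc\<close>.\<close>
lemma bessel_series'_deriv:
  assumes "\<nu> \<notin> \<int>"
  obtains D where "(bessel_series' \<nu> has_field_derivative D) (at z)"
    and "4 * z * D + 4 * (\<nu> + 1) * bessel_series' \<nu> z = bessel_series \<nu> z"
proof
  let ?c = "bessel_coeff \<nu>"
  have s: "summable (\<lambda>n. diffs ?c n * z ^ n)" for z
    by (rule termdiff_converges_all[OF summable_bessel_series[OF assms]])
  have s': "summable (\<lambda>n. diffs (diffs ?c) n * z ^ n)" for z
    by (rule termdiff_converges_all[OF s])
  show "(bessel_series' \<nu> has_field_derivative suminf (\<lambda>n. diffs (diffs ?c) n * z ^ n)) (at z)"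
    using termdiffs_strong_converges_everywhere[OF s] unfolding bessel_series'_def[abs_def] .
  have "(\<lambda>n. 4 * z * (of_nat n * diffs ?c n * z ^ (n - Suc 0)) + 4 * (\<nu> + 1) * (diffs ?c n * z ^ n)) sums
      (4 * z * suminf (\<lambda>n. diffs (diffs ?c) n * z ^ n) + 4 * (\<nu> + 1) * bessel_series' \<nu> z)"
    unfolding bessel_series'_def
    by (intro sums_add sums_mult diffs_equiv[OF s'] summable_sums s)
  moreover have "4 * z * (of_nat n * diffs ?c n * z ^ (n - Suc 0)) + 4 * (\<nu> + 1) * (diffs ?c n * z ^ n)
      = ?c n * z ^ n" for n
  proof -
    have "4 * z * (of_nat n * diffs ?c n * z ^ (n - Suc 0)) = 4 * of_nat n * diffs ?c n * z ^ n"
      by (cases n) simp_all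
    then have "4 * z * (of_nat n * diffs ?c n * z ^ (n - Suc 0)) + 4 * (\<nu> + 1) * (diffs ?c n * z ^ n)
        = (4 * of_nat (Suc n) * (\<nu> + 1 + of_nat n) * ?c (Suc n)) * z ^ n"
      by (simp add: diffs_def algebra_simps)
    then show ?thesis unfolding bessel_coeff_Suc[OF assms] .
  qed
  ultimately show "4 * z * suminf (\<lambda>n. diffs (diffs ?c) n * z ^ n) + 4 * (\<nu> + 1) * bessel_series' \<nu> z = bessel_series \<nu> z"
    by (simp add: sums_iff bessel_series_def)
qed

definition besselI :: "complex \<Rightarrow> real \<Rightarrow> complex" where
  "besselI \<nu> x = of_real x powr \<nu> * bessel_series \<nu> (of_real (x\<^sup>2))"

definition besselI1 :: "complex \<Rightarrow> real \<Rightarrow> complex" where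
  "besselI1 \<nu> x = of_real x powr \<nu> *
     (\<nu> * bessel_series \<nu> (of_real (x\<^sup>2)) + 2 * of_real (x\<^sup>2) * bessel_series' \<nu> (of_real (x\<^sup>2)))"

lemma bessel_pair_besselI:
  assumes "\<nu> \<notin> \<int>"
  shows "bessel_pair \<nu> (besselI \<nu>) (besselI1 \<nu>)"
  unfolding bessel_pair_def
proof (intro allI impI conjI)
  fix x :: real assume x: "x > 0"
  define z where "z = complex_of_real x"
  have z: "z \<notin> \<real>\<^sub>\<le>\<^sub>0" "z \<noteq> 0" using x by (auto simp: z_def complex_nonpos_Reals_iff)
  have pw: "((\<lambda>z. z powr \<nu>) has_field_derivative \<nu> * z powr \<nu> / z) (at z)"
    using has_field_derivative_powr[OF z(1), of \<nu>] z(2) by (simp add: powr_diff)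
  have sq: "((\<lambda>z. z\<^sup>2) has_field_derivative 2 * z) (at z)" by (auto intro!: derivative_eq_intros)
  have P: "((\<lambda>z. bessel_series \<nu> (z\<^sup>2)) has_field_derivative bessel_series' \<nu> (z\<^sup>2) * (2 * z)) (at z)"
    using DERIV_chain'[OF sq bessel_series_deriv[OF assms]] by (simp add: mult_ac)
  obtain D where D: "(bessel_series' \<nu> has_field_derivative D) (at (z\<^sup>2))"
    "4 * z\<^sup>2 * D + 4 * (\<nu> + 1) * bessel_series' \<nu> (z\<^sup>2) = bessel_series \<nu> (z\<^sup>2)"
    using bessel_series'_deriv[OF assms] by metis
  have P': "((\<lambda>z. bessel_series' \<nu> (z\<^sup>2)) has_field_derivative D * (2 * z)) (at z)"
    using DERIV_chain'[OF sq D(1)] by (simp add: mult_ac)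
  have "((\<lambda>z. z powr \<nu> * bessel_series \<nu> (z\<^sup>2)) has_field_derivative besselI1 \<nu> x / of_real x) (at z)"
    by (rule DERIV_cong[OF DERIV_mult[OF pw P]])
      (use z in \<open>simp add: besselI1_def z_def[symmetric] field_simps power2_eq_square\<close>)
  from has_vector_derivative_real_field[OF this[unfolded z_def]]
  show "(besselI \<nu> has_vector_derivative besselI1 \<nu> x / of_real x) (at x)"
    by (simp add: besselI_def[abs_def])
  have eq: "(\<nu>\<^sup>2 + z\<^sup>2) * bessel_series \<nu> (z\<^sup>2) = \<nu> * (\<nu> * bessel_series \<nu> (z\<^sup>2) + 2 * z\<^sup>2 * bessel_series' \<nu> (z\<^sup>2))
      + z * (\<nu> * (bessel_series' \<nu> (z\<^sup>2) * (2 * z)) + (2 * z\<^sup>2 * (D * (2 * z)) + 2 * (2 * z) * bessel_series' \<nu> (z\<^sup>2)))"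
    unfolding D(2)[symmetric] by algebra
  have 2: "((\<lambda>z. \<nu> * bessel_series \<nu> (z\<^sup>2) + 2 * z\<^sup>2 * bessel_series' \<nu> (z\<^sup>2)) has_field_derivative
      \<nu> * (bessel_series' \<nu> (z\<^sup>2) * (2 * z)) + (2 * z\<^sup>2 * (D * (2 * z)) + 2 * (2 * z) * bessel_series' \<nu> (z\<^sup>2))) (at z)"
    by (rule DERIV_add[OF DERIV_cmult[OF P] DERIV_mult'[OF DERIV_cmult[OF sq] P']])
  have "((\<lambda>z. z powr \<nu> * (\<nu> * bessel_series \<nu> (z\<^sup>2) + 2 * z\<^sup>2 * bessel_series' \<nu> (z\<^sup>2))) has_field_derivative
      (of_real (x\<^sup>2) + \<nu>\<^sup>2) * besselI \<nu> x / of_real x) (at z)"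
  proof (rule DERIV_cong[OF DERIV_mult[OF pw 2]])
    have "(of_real (x\<^sup>2) + \<nu>\<^sup>2) * besselI \<nu> x / of_real x = z powr \<nu> / z * ((\<nu>\<^sup>2 + z\<^sup>2) * bessel_series \<nu> (z\<^sup>2))"
      by (simp add: besselI_def z_def mult_ac add_ac)
    then show "\<nu> * z powr \<nu> / z * (\<nu> * bessel_series \<nu> (z\<^sup>2) + 2 * z\<^sup>2 * bessel_series' \<nu> (z\<^sup>2)) +
       (\<nu> * (bessel_series' \<nu> (z\<^sup>2) * (2 * z)) + (2 * z\<^sup>2 * (D * (2 * z)) + 2 * (2 * z) * bessel_series' \<nu> (z\<^sup>2))) * z powr \<nu> =
       (of_real (x\<^sup>2) + \<nu>\<^sup>2) * besselI \<nu> x / of_real x"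
      unfolding eq using z by (simp add: field_simps)
  qed
  from has_vector_derivative_real_field[OF this[unfolded z_def]]
  show "(besselI1 \<nu> has_vector_derivative (of_real (x\<^sup>2) + \<nu>\<^sup>2) * besselI \<nu> x / of_real x) (at x)"
    by (simp add: besselI1_def[abs_def])
qed

lemma isCont_bessel_series:
  assumes "\<nu> \<notin> \<int>"
  shows "isCont (\<lambda>x::real. bessel_series \<nu> (of_real (x\<^sup>2))) x" "isCont (\<lambda>x::real. bessel_series' \<nu> (of_real (x\<^sup>2))) x"
proof -
  have 1: "isCont (bessel_series \<nu>) z" for z
    using bessel_series_deriv[OF assms] DERIV_isCont by blast
  have 2: "isCont (bessel_series' \<nu>) z" for z
    using bessel_series'_deriv[OF assms] DERIV_isCont by metis
  show "isCont (\<lambda>x::real. bessel_series \<nu> (of_real (x\<^sup>2))) x" "isCont (\<lambda>x::real. bessel_series' \<nu> (of_real (x\<^sup>2))) x"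
    by (intro isCont_o2[OF _ 1] isCont_o2[OF _ 2] continuous_intros)+
qed

lemma bessel_series_0: "bessel_series \<nu> 0 = 1"
  using powser_zero[of "bessel_coeff \<nu>"] by (simp add: bessel_series_def bessel_coeff_def)

text \<open>The Wronskian can be read off as \<open>x\<close> tends to \<open>0\<close>: the powers \<open>x powr \<nu>\<close> and \<open>x powr (- \<nu>)\<close>
  cancel, and only the constant terms of the two series remain.\<close>
lemma besselI_wronskian:
  assumes "\<nu> \<notin> \<int>" "x > 0"
  shows "besselI \<nu> x * besselI1 (- \<nu>) x - besselI1 \<nu> x * besselI (- \<nu>) x = - 2 * \<nu>"
proof -
  have \<nu>': "- \<nu> \<notin> \<int>" using assms(1) by (metis Ints_minus minus_minus)
  obtain W where W: "\<And>x. x > 0 \<Longrightarrow> besselI \<nu> x * besselI1 (- \<nu>) x - besselI1 \<nu> x * besselI (- \<nu>) x = W"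
    using bessel_wronskian_const[OF bessel_pair_besselI[OF assms(1)]] bessel_pair_besselI[OF \<nu>']
    by (metis bessel_pair_minus)
  define h where "h x = - 2 * \<nu> * (bessel_series \<nu> (of_real (x\<^sup>2)) * bessel_series (- \<nu>) (of_real (x\<^sup>2))) +
    2 * of_real (x\<^sup>2) * (bessel_series \<nu> (of_real (x\<^sup>2)) * bessel_series' (- \<nu>) (of_real (x\<^sup>2))
      - bessel_series' \<nu> (of_real (x\<^sup>2)) * bessel_series (- \<nu>) (of_real (x\<^sup>2)))" for x :: real
  have h: "h x = W" if x: "x > 0" for x
  proof -
    have "complex_of_real x powr \<nu> * complex_of_real x powr (- \<nu>) = 1"
      using x by (simp add: powr_minus)
    then have "besselI \<nu> x * besselI1 (- \<nu>) x - besselI1 \<nu> x * besselI (- \<nu>) x = h x"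
      unfolding besselI_def besselI1_def h_def by algebra
    then show ?thesis using W[OF x] by simp
  qed
  have "isCont h 0"
    unfolding h_def[abs_def] by (intro continuous_intros isCont_bessel_series assms(1) \<nu>')
  then have "(h \<longlongrightarrow> h 0) (at_right 0)"
    using filterlim_at_split isCont_def by blast
  moreover have "(h \<longlongrightarrow> W) (at_right 0)"
    by (rule tendsto_eventually) (use h in \<open>auto simp: eventually_at_right_field intro: exI[of _ 1]\<close>)
  ultimately have "h 0 = W" using tendsto_unique[OF trivial_limit_at_right_real] by blast
  then show ?thesis using W[OF assms(2)] by (simp add: h_def bessel_series_0)
qed

lemma sqrt_besselI_bounded:
  assumes "\<nu> \<notin> \<int>" "Re \<nu> \<ge> - (1/2)"
  obtains C where "\<And>x. 0 < x \<Longrightarrow> x \<le> b \<Longrightarrow> sqrt x * norm (besselI \<nu> x) \<le> C"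
proof -
  have "bounded ((\<lambda>x::real. bessel_series \<nu> (of_real (x\<^sup>2))) ` {0..b})"
    by (intro compact_imp_bounded compact_continuous_image continuous_at_imp_continuous_on ballI
        isCont_bessel_series assms) simp
  then obtain B where "\<forall>y\<in>(\<lambda>x::real. bessel_series \<nu> (of_real (x\<^sup>2))) ` {0..b}. norm y \<le> B"
    unfolding bounded_iff by blast
  then have B: "norm (bessel_series \<nu> (of_real (x\<^sup>2))) \<le> B" if "0 \<le> x" "x \<le> b" for x
    using that by auto
  have "sqrt x * norm (besselI \<nu> x) \<le> b powr (Re \<nu> + 1/2) * B" if x: "0 < x" "x \<le> b" for x
  proof -
    have "sqrt x * norm (besselI \<nu> x) = x powr (Re \<nu> + 1/2) * norm (bessel_series \<nu> (of_real (x\<^sup>2)))"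
      using x by (simp add: besselI_def norm_mult norm_powr_real_powr powr_add powr_half_sqrt mult_ac)
    also have "\<dots> \<le> b powr (Re \<nu> + 1/2) * B"
      using x assms B[of x] by (intro mult_mono powr_mono2) auto
    finally show ?thesis .
  qed
  then show ?thesis using that by blast
qed

text \<open>Cramer's rule for the two Frobenius solutions. The factor \<open>sqrt x\<close> is the one that accompanies
  the Bessel functions in \<^const>\<open>whittaker\<close>; it absorbs both \<open>x powr \<nu>\<close> and \<open>x powr (- \<nu>)\<close> near \<open>0\<close>.\<close>
lemma bessel_initial_value:
  assumes \<nu>: "\<nu> \<notin> \<int>" and x0: "x0 > 0"
  obtains f f1 where "bessel_pair \<nu> f f1" "f x0 = A" "f1 x0 = B"
    "\<bar>Re \<nu>\<bar> \<le> 1/2 \<Longrightarrow> \<exists>C. \<forall>x. 0 < x \<longrightarrow> x \<le> x0 \<longrightarrow> sqrt x * norm (f x) \<le> C"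
proof -
  have \<nu>': "- \<nu> \<notin> \<int>" using \<nu> by (metis Ints_minus minus_minus)
  have \<nu>0: "\<nu> \<noteq> 0" using \<nu> by auto
  let ?I = "besselI \<nu>" and ?I1 = "besselI1 \<nu>" and ?J = "besselI (- \<nu>)" and ?J1 = "besselI1 (- \<nu>)"
  define a where "a = (A * ?J1 x0 - B * ?J x0) / (- 2 * \<nu>)"
  define b where "b = (B * ?I x0 - A * ?I1 x0) / (- 2 * \<nu>)"
  have W: "?I x0 * ?J1 x0 - ?I1 x0 * ?J x0 = - 2 * \<nu>" by (rule besselI_wronskian[OF \<nu> x0])
  have "bessel_pair \<nu> (\<lambda>x. a * ?I x + b * ?J x) (\<lambda>x. a * ?I1 x + b * ?J1 x)"
    using bessel_pair_besselI[OF \<nu>] bessel_pair_besselI[OF \<nu>']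
    by (simp add: bessel_pair_lincomb bessel_pair_minus)
  moreover have "a * ?I x0 + b * ?J x0 = A"
  proof -
    have "a * ?I x0 + b * ?J x0 = A * (?I x0 * ?J1 x0 - ?I1 x0 * ?J x0) / (- 2 * \<nu>)"
      unfolding a_def b_def times_divide_eq_left add_divide_distrib[symmetric] by (simp add: algebra_simps)
    then show ?thesis unfolding W using \<nu>0 by simp
  qed
  moreover have "a * ?I1 x0 + b * ?J1 x0 = B"
  proof -
    have "a * ?I1 x0 + b * ?J1 x0 = B * (?I x0 * ?J1 x0 - ?I1 x0 * ?J x0) / (- 2 * \<nu>)"
      unfolding a_def b_def times_divide_eq_left add_divide_distrib[symmetric] by (simp add: algebra_simps)
    then show ?thesis unfolding W using \<nu>0 by simp
  qed
  moreover have "\<exists>C. \<forall>x. 0 < x \<longrightarrow> x \<le> x0 \<longrightarrow> sqrt x * norm (a * ?I x + b * ?J x) \<le> C" if "\<bar>Re \<nu>\<bar> \<le> 1/2"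
  proof -
    obtain C where C: "\<And>x. 0 < x \<Longrightarrow> x \<le> x0 \<Longrightarrow> sqrt x * norm (?I x) \<le> C"
      by (rule sqrt_besselI_bounded[OF \<nu>, of x0]) (use \<open>\<bar>Re \<nu>\<bar> \<le> 1/2\<close> in auto)
    obtain C' where C': "\<And>x. 0 < x \<Longrightarrow> x \<le> x0 \<Longrightarrow> sqrt x * norm (?J x) \<le> C'"
      by (rule sqrt_besselI_bounded[OF \<nu>', of x0]) (use \<open>\<bar>Re \<nu>\<bar> \<le> 1/2\<close> in auto)
    have "sqrt x * norm (a * ?I x + b * ?J x) \<le> norm a * C + norm b * C'" if x: "0 < x" "x \<le> x0" for x
    proof -
      have "sqrt x * norm (a * ?I x + b * ?J x) \<le> sqrt x * (norm (a * ?I x) + norm (b * ?J x))"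
        using x by (intro mult_left_mono norm_triangle_ineq) auto
      also have "\<dots> = norm a * (sqrt x * norm (?I x)) + norm b * (sqrt x * norm (?J x))"
        by (simp add: norm_mult algebra_simps)
      also have "\<dots> \<le> norm a * C + norm b * C'"
        by (intro add_mono mult_left_mono C C' x norm_ge_zero)
      finally show ?thesis .
    qed
    then show ?thesis by blast
  qed
  ultimately show ?thesis using that by blast
qed

text \<open>The function \<open>y = x |f|\<^sup>2\<close> satisfies \<open>y'' \<ge> y\<close> beyond \<open>x0\<close>. The initial values are chosen such
  that \<open>y' \<ge> y\<close> at \<open>x0\<close>. As \<open>exp x (y' - y)\<close> is nondecreasing, this persists, and then so is
  \<open>exp (- x) y\<close>.\<close>
lemma bessel_solution_grows:
  assumes p: "bessel_pair \<nu> f f1" and x0: "x0 > 0" "x0\<^sup>2 \<ge> 1/2 - 2 * Re (\<nu>\<^sup>2)"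
    and init: "f x0 = 1" "f1 x0 = of_real x0"
    and xt: "x0 \<le> x" "x \<le> t"
  shows "x * (norm (f x))\<^sup>2 * exp (t - x) \<le> t * (norm (f t))\<^sup>2"
proof -
  define y where "y x = x * (norm (f x))\<^sup>2" for x
  define y1 where "y1 x = (norm (f x))\<^sup>2 + 2 * Re (f1 x * cnj (f x))" for x
  define y2 where "y2 x = (2 * Re (f1 x * cnj (f x)) + 2 * (x\<^sup>2 + Re (\<nu>\<^sup>2)) * (norm (f x))\<^sup>2
      + 2 * (norm (f1 x))\<^sup>2) / x" for x
  have dy: "(y has_real_derivative y1 x) (at x)" and dy1: "(y1 has_real_derivative y2 x) (at x)"
    if x: "x > 0" for x
  proof -
    have Re: "((\<lambda>x. Re (h x)) has_real_derivative Re h') (at x)" if "(h has_vector_derivative h') (at x)" for h h'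
      using bounded_linear.has_vector_derivative[OF bounded_linear_Re that]
      by (simp add: has_real_derivative_iff_has_vector_derivative)
    note d = bessel_pairD[OF p x] has_vector_derivative_cnj[OF bessel_pairD(1)[OF p x]]
      has_vector_derivative_cnj[OF bessel_pairD(2)[OF p x]]
    have n: "(norm z)\<^sup>2 = Re (z * cnj z)" for z by (simp add: complex_norm_square[symmetric] del: of_real_power)
    have n1: "Re (f1 x * cnj (f x)) = Re (f x * cnj (f1 x))" for x by simp
    have dF: "((\<lambda>x. (norm (f x))\<^sup>2) has_real_derivative 2 * Re (f1 x * cnj (f x)) / x) (at x)"
      unfolding n
      by (rule DERIV_cong[OF Re[OF has_vector_derivative_mult[OF d(1,3)]]])
        (use x in \<open>simp add: Re_divide_of_real add_divide_distrib mult.commute\<close>)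
    show "(y has_real_derivative y1 x) (at x)"
      unfolding y_def[abs_def] y1_def
      by (rule DERIV_cong[OF DERIV_mult[OF DERIV_ident dF]]) (use x in simp)
    have dS: "((\<lambda>x. Re (f1 x * cnj (f x))) has_real_derivative
        ((norm (f1 x))\<^sup>2 + (x\<^sup>2 + Re (\<nu>\<^sup>2)) * (norm (f x))\<^sup>2) / x) (at x)"
    proof (rule DERIV_cong[OF Re[OF has_vector_derivative_mult[OF d(2,3)]]])
      have "f1 x * cnj (f1 x / of_real x) + (of_real (x\<^sup>2) + \<nu>\<^sup>2) * f x / of_real x * cnj (f x) =
          (of_real ((norm (f1 x))\<^sup>2) + (of_real (x\<^sup>2) + \<nu>\<^sup>2) * of_real ((norm (f x))\<^sup>2)) / of_real x"
        unfolding complex_norm_square using x by (simp add: field_simps)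
      then show "Re (f1 x * cnj (f1 x / of_real x) + (of_real (x\<^sup>2) + \<nu>\<^sup>2) * f x / of_real x * cnj (f x)) =
          ((norm (f1 x))\<^sup>2 + (x\<^sup>2 + Re (\<nu>\<^sup>2)) * (norm (f x))\<^sup>2) / x"
        by (simp only: Re_divide_of_real plus_complex.sel Re_complex_of_real times_complex.sel Im_complex_of_real mult_zero_right diff_zero)
    qed
    show "(y1 has_real_derivative y2 x) (at x)"
      unfolding y1_def[abs_def] y2_def
      by (rule DERIV_cong[OF DERIV_add[OF dF DERIV_cmult[OF dS]]])
        (simp add: add_divide_distrib distrib_left mult.assoc)
  qed
  \<comment> \<open>\<open>y\<close> is convex enough because \<open>norm (f1 + f / 2)\<close> has a nonnegative square.\<close>
  have y2: "y2 x \<ge> y x" if x: "x \<ge> x0" for x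
  proof -
    have xp: "x > 0" using x x0 by simp
    have "0 \<le> 2 * (norm (f1 x + f x / 2))\<^sup>2" by simp
    also have "\<dots> = 2 * (norm (f1 x))\<^sup>2 + 2 * Re (f1 x * cnj (f x)) + (norm (f x))\<^sup>2 / 2"
      unfolding cmod_power2 by (simp add: power2_eq_square algebra_simps)
    finally have 1: "0 \<le> 2 * (norm (f1 x))\<^sup>2 + 2 * Re (f1 x * cnj (f x)) + (norm (f x))\<^sup>2 / 2" .
    have "x0\<^sup>2 \<le> x\<^sup>2" using x x0 by (intro power_mono) auto
    then have "0 \<le> (x\<^sup>2 + 2 * Re (\<nu>\<^sup>2) - 1/2) * (norm (f x))\<^sup>2"
      using x0 by (intro mult_nonneg_nonneg) auto
    moreover have "(x\<^sup>2 + 2 * Re (\<nu>\<^sup>2) - 1/2) * (norm (f x))\<^sup>2 =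
        2 * (x\<^sup>2 + Re (\<nu>\<^sup>2)) * (norm (f x))\<^sup>2 - (norm (f x))\<^sup>2 / 2 - x\<^sup>2 * (norm (f x))\<^sup>2"
      by (simp only: algebra_simps)
    ultimately have "x\<^sup>2 * (norm (f x))\<^sup>2 \<le> 2 * Re (f1 x * cnj (f x)) + 2 * (x\<^sup>2 + Re (\<nu>\<^sup>2)) * (norm (f x))\<^sup>2
      + 2 * (norm (f1 x))\<^sup>2"
      using 1 by linarith
    moreover have "y x * x = x\<^sup>2 * (norm (f x))\<^sup>2" by (simp add: y_def power2_eq_square)
    ultimately show ?thesis
      using xp by (simp only: y2_def pos_le_divide_eq)
  qed
  have y1: "y1 s \<ge> y s" if s: "s \<ge> x0" for s
  proof -
    have "exp x0 * (y1 x0 - y x0) \<le> exp s * (y1 s - y s)"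
    proof (rule DERIV_nonneg_imp_nondecreasing[OF s])
      fix x assume x: "x0 \<le> x" "x \<le> s"
      then have xp: "x > 0" using x0 by simp
      have "((\<lambda>s. exp s * (y1 s - y s)) has_real_derivative exp x * (y2 x - y x)) (at x)"
        by (rule DERIV_cong[OF DERIV_mult[OF DERIV_exp DERIV_diff[OF dy1[OF xp] dy[OF xp]]]])
          (simp add: algebra_simps)
      then show "\<exists>z. ((\<lambda>s. exp s * (y1 s - y s)) has_real_derivative z) (at x) \<and> 0 \<le> z"
        using y2[OF x(1)] by (intro exI[of _ "exp x * (y2 x - y x)"]) auto
    qed
    moreover have "y1 x0 - y x0 \<ge> 0" using x0 by (simp add: y1_def y_def init)
    ultimately have "0 \<le> exp s * (y1 s - y s)"
      using mult_nonneg_nonneg[OF exp_ge_zero, of "y1 x0 - y x0" x0] by linarith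
    then show ?thesis by (simp add: zero_le_mult_iff)
  qed
  have "exp (- x) * y x \<le> exp (- t) * y t"
  proof (rule DERIV_nonneg_imp_nondecreasing[OF xt(2)])
    fix s assume s: "x \<le> s" "s \<le> t"
    then have sp: "s > 0" using x0 xt by simp
    have "((\<lambda>s. exp (- s) * y s) has_real_derivative exp (- s) * (y1 s - y s)) (at s)"
      by (rule DERIV_cong[OF DERIV_mult[OF DERIV_chain'[OF DERIV_minus[OF DERIV_ident] DERIV_exp] dy[OF sp]]])
        (simp add: algebra_simps)
    then show "\<exists>z. ((\<lambda>s. exp (- s) * y s) has_real_derivative z) (at s) \<and> 0 \<le> z"
      using y1[of s] s xt by (intro exI[of _ "exp (- s) * (y1 s - y s)"]) auto
  qed
  then have "exp t * (exp (- x) * y x) \<le> exp t * (exp (- t) * y t)" by (intro mult_left_mono) auto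
  also have "exp t * (exp (- t) * y t) = y t"
    by (simp add: mult.assoc[symmetric] exp_add[symmetric])
  also have "exp t * (exp (- x) * y x) = y x * exp (t - x)"
    by (simp add: exp_diff exp_minus field_simps)
  finally show ?thesis by (simp add: y_def)
qed

text \<open>Let \<open>I\<close> be the solution of the preceding lemma and \<open>y = x |I|\<^sup>2\<close>. For a second solution \<open>J\<close> with
  Wronskian \<open>1\<close> the derivative of \<open>J / I\<close> has absolute value \<open>1 / y\<close>, which decays exponentially.
  So \<open>J / I\<close> has a limit \<open>c\<close>, at distance at most \<open>1 / y\<close>, and \<open>sqrt x |J - c I| \<le> 1 / sqrt y\<close>.\<close>
lemma bessel_fundamental_system:
  assumes \<nu>: "\<nu> \<notin> \<int>"
  obtains I I1 K K1 x0 \<delta> C where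
    "bessel_pair \<nu> I I1" "bessel_pair \<nu> K K1" "\<And>x. x > 0 \<Longrightarrow> I x * K1 x - I1 x * K x = 1"
    "x0 > 0" "\<delta> > 0" "\<And>x. x \<ge> x0 \<Longrightarrow> \<delta> * exp (x / 2) \<le> sqrt x * norm (I x)"
    "\<And>x. x \<ge> x0 \<Longrightarrow> sqrt x * norm (K x) \<le> C"
    "\<bar>Re \<nu>\<bar> \<le> 1/2 \<Longrightarrow> \<exists>C. \<forall>x>0. sqrt x * norm (K x) \<le> C"
proof -
  \<comment> \<open>\<open>x0 \<ge> 1\<close> is there for \<open>x0\<^sup>2 \<ge> x0\<close>.\<close>
  define x0 where "x0 = max 1 (1/2 - 2 * Re (\<nu>\<^sup>2))"
  have x0: "x0 > 0" "x0\<^sup>2 \<ge> 1/2 - 2 * Re (\<nu>\<^sup>2)"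
  proof -
    have "x0 * 1 \<le> x0 * x0" by (intro mult_left_mono) (auto simp: x0_def)
    moreover have "1/2 - 2 * Re (\<nu>\<^sup>2) \<le> x0" by (simp add: x0_def)
    ultimately show "x0\<^sup>2 \<ge> 1/2 - 2 * Re (\<nu>\<^sup>2)" unfolding power2_eq_square[of x0] by linarith
  qed (simp add: x0_def)
  obtain I I1 where I: "bessel_pair \<nu> I I1" "I x0 = 1" "I1 x0 = of_real x0"
    and I0: "\<bar>Re \<nu>\<bar> \<le> 1/2 \<Longrightarrow> \<exists>C. \<forall>x. 0 < x \<longrightarrow> x \<le> x0 \<longrightarrow> sqrt x * norm (I x) \<le> C"
    using bessel_initial_value[OF \<nu> x0(1)] by metis
  obtain J J1 where J: "bessel_pair \<nu> J J1" "J x0 = 0" "J1 x0 = 1"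
    and J0: "\<bar>Re \<nu>\<bar> \<le> 1/2 \<Longrightarrow> \<exists>C. \<forall>x. 0 < x \<longrightarrow> x \<le> x0 \<longrightarrow> sqrt x * norm (J x) \<le> C"
    using bessel_initial_value[OF \<nu> x0(1)] by metis
  have W: "I x * J1 x - I1 x * J x = 1" if "x > 0" for x
    using bessel_wronskian_const[OF I(1) J(1)] that x0(1) I J
    by (metis diff_zero mult.right_neutral mult_zero_right)
  define y where "y x = x * (norm (I x))\<^sup>2" for x
  have grow: "y x * exp (t - x) \<le> y t" if "x0 \<le> x" "x \<le> t" for x t
    unfolding y_def by (rule bessel_solution_grows[OF I(1) x0 I(2,3) that])
  have y0: "y x0 > 0" using x0 I by (simp add: y_def)
  have ypos: "y x > 0" if "x \<ge> x0" for x
    using grow[OF order.refl that] mult_pos_pos[OF y0 exp_gt_zero] by (rule less_le_trans[rotated])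
  have Ine: "I x \<noteq> 0" if "x \<ge> x0" for x
    using ypos[OF that] by (auto simp: y_def)
  \<comment> \<open>The recessive solution is \<open>J - c I\<close>, where \<open>c\<close> is the limit of \<open>r = J / I\<close>; by the Wronskian
    \<open>norm (r') = 1 / y\<close>.\<close>
  define r where "r x = J x / I x" for x
  define r' where "r' x = 1 / (x * (I x)\<^sup>2)" for x
  have dr: "(r has_vector_derivative r' x) (at x)" if x: "x \<ge> x0" for x
  proof -
    have xp: "x > 0" using x x0 by simp
    show ?thesis
      unfolding r_def[abs_def] divide_inverse
    proof (rule has_vector_derivative_eq_rhs[OF has_vector_derivative_mult[OF bessel_pairD(1)[OF J(1) xp]
          field_vector_diff_chain_at[OF bessel_pairD(1)[OF I(1) xp] DERIV_inverse[OF Ine[OF x]], unfolded o_def]]])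
      have "r' x = (I x * J1 x - I1 x * J x) / (x * (I x)\<^sup>2)" using W[OF xp] by (simp add: r'_def)
      then show "J x * (I1 x / complex_of_real x * - (inverse (I x) ^ Suc (Suc 0))) +
          J1 x / complex_of_real x * inverse (I x) = r' x"
        using Ine[OF x] xp by (simp add: field_simps power2_eq_square)
    qed
  qed
  have r_diff: "norm (r t - r s) \<le> (exp (x - s) - exp (x - t)) / y x" if "x0 \<le> x" "x \<le> s" "s \<le> t" for x s t
  proof -
    have d\<phi>: "((\<lambda>t. - exp (x - t) / y x) has_vector_derivative exp (x - t) / y x) (at t)" for t
      unfolding has_real_derivative_iff_has_vector_derivative[symmetric]
      using ypos[OF that(1)] by (auto intro!: derivative_eq_intros)
    have "norm (r t - r s) \<le> (- exp (x - t) / y x) - (- exp (x - s) / y x)"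
    proof (cases "s = t")
      case False
      with that have "s < t" by simp
      then show ?thesis
      proof (rule differentiable_bound_general)
        show "continuous_on {s..t} r"
          by (intro continuous_at_imp_continuous_on ballI has_vector_derivative_continuous[OF dr]) (use that in auto)
        show "continuous_on {s..t} (\<lambda>t. - exp (x - t) / y x)"
          by (intro continuous_at_imp_continuous_on ballI has_vector_derivative_continuous[OF d\<phi>])
        fix u assume u: "s < u" "u < t"
        show "(r has_vector_derivative r' u) (at u)" using dr u that by auto
        show "((\<lambda>t. - exp (x - t) / y x) has_vector_derivative exp (x - u) / y x) (at u)" by (rule d\<phi>)
        have "norm (r' u) = 1 / y u" using u that x0 by (simp add: r'_def y_def norm_divide norm_mult norm_power)
        also have "\<dots> \<le> 1 / (y x * exp (u - x))"
          using grow[of x u] ypos[OF that(1)] u that by (intro divide_left_mono mult_pos_pos ypos) auto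
        also have "\<dots> = exp (x - u) / y x" by (simp add: exp_diff field_simps)
        finally show "norm (r' u) \<le> exp (x - u) / y x" .
      qed
    qed simp
    then show ?thesis by (simp add: diff_divide_distrib)
  qed
  have "\<exists>c. ((\<lambda>n. r (x0 + real n)) \<longlonglongrightarrow> c)"
  proof -
    have "Cauchy (\<lambda>n. r (x0 + real n))"
    proof (rule metric_CauchyI)
      fix e :: real assume e: "e > 0"
      obtain N :: nat where "real N > - ln (e * y x0)" using reals_Archimedean2 by blast
      then have "exp (- real N) < exp (ln (e * y x0))" by simp
      then have N: "exp (- real N) / y x0 < e" using e y0 by (simp add: field_simps)
      have 1: "norm (r (x0 + real n) - r (x0 + real m)) < e" if "n \<ge> m" "m \<ge> N" for m n
      proof -
        have "norm (r (x0 + real n) - r (x0 + real m)) \<le>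
            (exp (x0 - (x0 + real m)) - exp (x0 - (x0 + real n))) / y x0"
          using that by (intro r_diff) auto
        also have "\<dots> \<le> exp (- real N) / y x0"
        proof (rule divide_right_mono)
          have "exp (x0 - (x0 + real m)) \<le> exp (- real N)" using that by simp
          then show "exp (x0 - (x0 + real m)) - exp (x0 - (x0 + real n)) \<le> exp (- real N)"
            using exp_gt_zero[of "x0 - (x0 + real n)"] by linarith
        qed (use y0 in simp)
        finally show ?thesis using N by simp
      qed
      have "dist (r (x0 + real m)) (r (x0 + real n)) < e" if "m \<ge> N" "n \<ge> N" for m n
        using 1[of m n] 1[of n m] that by (cases "m \<le> n") (auto simp: dist_norm norm_minus_commute)
      then show "\<exists>M. \<forall>m\<ge>M. \<forall>n\<ge>M. dist (r (x0 + real m)) (r (x0 + real n)) < e" by blast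
    qed
    then show ?thesis by (simp add: Cauchy_convergent_iff convergent_def)
  qed
  then obtain c where c: "((\<lambda>n. r (x0 + real n)) \<longlonglongrightarrow> c)" by blast
  have rc: "norm (c - r x) \<le> 1 / y x" if x: "x \<ge> x0" for x
  proof (rule tendsto_upperbound)
    show "((\<lambda>n. norm (r (x0 + real n) - r x)) \<longlonglongrightarrow> norm (c - r x))"
      by (intro tendsto_intros c)
    have "\<forall>\<^sub>F n in sequentially. real n \<ge> x"
      using filterlim_real_sequentially by (simp add: filterlim_at_top)
    then show "\<forall>\<^sub>F n in sequentially. norm (r (x0 + real n) - r x) \<le> 1 / y x"
    proof eventually_elim
      case (elim n)
      have "norm (r (x0 + real n) - r x) \<le> (exp (x - x) - exp (x - (x0 + real n))) / y x"
        using elim x0 x by (intro r_diff) auto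
      also have "\<dots> \<le> 1 / y x" using ypos[OF x] by (intro divide_right_mono) auto
      finally show ?case .
    qed
  qed simp
  define K where "K x = - c * I x + 1 * J x" for x
  define K1 where "K1 x = - c * I1 x + 1 * J1 x" for x
  have K: "bessel_pair \<nu> K K1"
    unfolding K_def[abs_def] K1_def[abs_def] by (rule bessel_pair_lincomb[OF I(1) J(1)])
  have WK: "I x * K1 x - I1 x * K x = 1" if "x > 0" for x
    using W[OF that] by (simp add: K_def K1_def algebra_simps)
  have Kb: "sqrt x * norm (K x) \<le> 1 / sqrt (y x0)" if x: "x \<ge> x0" for x
  proof -
    have xp: "x > 0" using x x0 by simp
    have "K x = - (c - r x) * I x"
      using Ine[OF x] by (simp add: K_def r_def field_simps)
    then have "sqrt x * norm (K x) = sqrt (y x) * norm (c - r x)"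
    proof -
      have "sqrt (y x) = sqrt x * norm (I x)" by (simp add: y_def real_sqrt_mult)
      moreover have "norm (- (c - r x) * I x) = norm (c - r x) * norm (I x)"
        unfolding norm_mult norm_minus_cancel ..
      ultimately show ?thesis using \<open>K x = - (c - r x) * I x\<close> by simp
    qed
    also have "\<dots> \<le> sqrt (y x) * (1 / y x)"
      using rc[OF x] ypos[OF x] by (intro mult_left_mono) auto
    also have "\<dots> = 1 / sqrt (y x)" using ypos[OF x] by (simp add: real_div_sqrt field_simps)
    also have "\<dots> \<le> 1 / sqrt (y x0)"
    proof -
      have "y x0 * 1 \<le> y x0 * exp (x - x0)" using x y0 by (intro mult_left_mono) auto
      then have "y x0 \<le> y x" using grow[OF order.refl x] by simp
      then show ?thesis using y0 ypos[OF x] by (intro divide_left_mono) auto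
    qed
    finally show ?thesis .
  qed
  have Ib: "sqrt (y x0 * exp (- x0)) * exp (x / 2) \<le> sqrt x * norm (I x)" if x: "x \<ge> x0" for x
  proof -
    have "sqrt (y x0 * exp (- x0)) * exp (x / 2) = sqrt (y x0 * exp (x - x0))"
    proof -
      have "exp (x / 2) = sqrt (exp x)"
        by (rule real_sqrt_unique[symmetric]) (auto simp: power2_eq_square exp_add[symmetric])
      moreover have "exp (x - x0) = exp (- x0) * exp x" by (simp add: exp_add[symmetric])
      ultimately show ?thesis by (simp add: real_sqrt_mult)
    qed
    also have "\<dots> \<le> sqrt (y x)" using grow[OF order.refl x] by simp
    also have "\<dots> = sqrt x * norm (I x)" by (simp add: y_def real_sqrt_mult)
    finally show ?thesis .
  qed
  have K0: "\<exists>C. \<forall>x>0. sqrt x * norm (K x) \<le> C" if small: "\<bar>Re \<nu>\<bar> \<le> 1/2"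
  proof -
    obtain CI where CI: "\<And>x. 0 < x \<Longrightarrow> x \<le> x0 \<Longrightarrow> sqrt x * norm (I x) \<le> CI" using I0[OF small] by blast
    obtain CJ where CJ: "\<And>x. 0 < x \<Longrightarrow> x \<le> x0 \<Longrightarrow> sqrt x * norm (J x) \<le> CJ" using J0[OF small] by blast
    have "sqrt x * norm (K x) \<le> norm c * CI + CJ" if x: "0 < x" "x \<le> x0" for x
    proof -
      have "sqrt x * norm (K x) \<le> sqrt x * (norm (- c * I x) + norm (1 * J x))"
        unfolding K_def using x by (intro mult_left_mono norm_triangle_ineq) auto
      also have "\<dots> = norm c * (sqrt x * norm (I x)) + sqrt x * norm (J x)"
        by (simp add: norm_mult algebra_simps)
      also have "\<dots> \<le> norm c * CI + CJ"
        by (intro add_mono mult_left_mono CI CJ x norm_ge_zero)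
      finally show ?thesis .
    qed
    then have "sqrt x * norm (K x) \<le> max (norm c * CI + CJ) (1 / sqrt (y x0))" if "x > 0" for x
      using that Kb[of x] by (cases "x \<le> x0") (auto simp: le_max_iff_disj)
    then show ?thesis by blast
  qed
  show ?thesis
    using that[OF I(1) K WK x0(1) _ Ib Kb K0] y0 by simp
qed

text \<open>The coefficients of \<open>f\<close> are its Wronskians with \<open>K\<close> and \<open>I\<close>.\<close>
lemma bessel_pair_in_span:
  assumes "bessel_pair \<nu> I I1" "bessel_pair \<nu> K K1" "\<And>x. x > 0 \<Longrightarrow> I x * K1 x - I1 x * K x = 1"
    and "bessel_pair \<nu> f f1"
  obtains a b where "\<And>x. x > 0 \<Longrightarrow> f x = a * I x + b * K x"
proof -
  obtain a where a: "\<And>x. x > 0 \<Longrightarrow> f x * K1 x - f1 x * K x = a"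
    using bessel_wronskian_const[OF assms(4,2)] by metis
  obtain b where b: "\<And>x. x > 0 \<Longrightarrow> f x * I1 x - f1 x * I x = b"
    using bessel_wronskian_const[OF assms(4,1)] by metis
  have "f x = a * I x + (- b) * K x" if x: "x > 0" for x
  proof -
    have "f x = f x * (I x * K1 x - I1 x * K x)" using assms(3)[OF x] by simp
    also have "\<dots> = (f x * K1 x - f1 x * K x) * I x - (f x * I1 x - f1 x * I x) * K x" by algebra
    finally show ?thesis using a[OF x] b[OF x] by simp
  qed
  then show ?thesis using that by blast
qed

section \<open>Calculus of smooth functions\<close>

lemma C_k_bilinear:
  assumes "open S" "bounded_bilinear p"
  shows "C_k n S f \<Longrightarrow> C_k n S g \<Longrightarrow> C_k n S (\<lambda>x. p (f x) (g x))"
proof (induction n arbitrary: f g)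
  case 0
  then show ?case by (simp add: bounded_bilinear.continuous_on[OF assms(2)])
next
  case (Suc n)
  have d: "((\<lambda>x. p (f x) (g x)) has_derivative
      (\<lambda>v. p (f x) (frechet_derivative g (at x) v) + p (frechet_derivative f (at x) v) (g x))) (at x)"
    if "x \<in> S" for x
    using Suc.prems that
    by (auto intro!: bounded_bilinear.FDERIV[OF assms(2)] simp: frechet_derivative_works[symmetric])
  have "C_k n S (\<lambda>x. p (f x) (frechet_derivative g (at x) v) + p (frechet_derivative f (at x) v) (g x))" for v
    using Suc.prems C_k_Suc_imp[of n S f] C_k_Suc_imp[of n S g]
    by (intro C_k_add Suc.IH assms) auto
  then show ?case using C_k_SucI[OF assms(1) d] by blast
qed

lemma smooth_on_bilinear:
  "open S \<Longrightarrow> bounded_bilinear p \<Longrightarrow> smooth_on S f \<Longrightarrow> smooth_on S g \<Longrightarrow> smooth_on S (\<lambda>x. p (f x) (g x))"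
  by (simp add: smooth_on_def C_k_bilinear)

lemma smooth_on_const: "smooth_on S (\<lambda>x. c)"
proof -
  have "C_k n S (\<lambda>x. c)" for n by (cases n) (auto simp: C_k_zero)
  then show ?thesis by (simp add: smooth_on_def)
qed

lemma smooth_on_bounded_linear:
  assumes "open S" "bounded_linear h"
  shows "smooth_on S h"
proof -
  have "C_k n S h" for n
  proof (cases n)
    case 0
    then show ?thesis using assms(2) by (simp add: linear_continuous_on)
  next
    case (Suc m)
    show ?thesis unfolding Suc
      by (rule C_k_SucI[OF assms(1) bounded_linear_imp_has_derivative[OF assms(2)]])
        (use smooth_on_const in \<open>auto simp: smooth_on_def\<close>)
  qed
  then show ?thesis by (simp add: smooth_on_def)
qed

lemma smooth_on_diff: "open S \<Longrightarrow> smooth_on S f \<Longrightarrow> smooth_on S g \<Longrightarrow> smooth_on S (\<lambda>x. f x - g x)"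
  using smooth_on_add[of S f "\<lambda>x. - g x"] smooth_on_linear[OF _ bounded_linear_minus[OF bounded_linear_ident], of S g]
  by simp

text \<open>The order of differentiability is raised for all \<open>h\<close> at once, because the derivative of
  \<open>h \<circ> r\<close> contains the derivative of \<open>h\<close> composed with \<open>r\<close>.\<close>
lemma smooth_on_compose_real:
  fixes r :: "'a::real_normed_vector \<Rightarrow> real"
  assumes S: "open S" and r: "smooth_on S r" and T: "\<And>x. x \<in> S \<Longrightarrow> r x \<in> T" and h: "smooth_on T h"
  shows "smooth_on S (\<lambda>x. h (r x))"
proof -
  have "C_k n S (\<lambda>x. h (r x))" for n
    using h
  proof (induction n arbitrary: h)
    case 0
    have "continuous_on S r" "continuous_on T h"
      using r 0 by (auto simp: smooth_on_def dest: spec[of _ 0])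
    then show ?case
      using T by (simp) (metis continuous_on_compose2 image_subsetI)
  next
    case (Suc n)
    have d: "((\<lambda>x. h (r x)) has_derivative
        (\<lambda>v. frechet_derivative r (at x) v *\<^sub>R frechet_derivative h (at (r x)) 1)) (at x)" if "x \<in> S" for x
    proof -
      have dh: "(h has_derivative frechet_derivative h (at (r x))) (at (r x))"
        using smooth_on_differentiable[OF Suc.prems T[OF that]] by (simp add: frechet_derivative_works[symmetric])
      have "(r has_derivative frechet_derivative r (at x)) (at x)"
        using smooth_on_differentiable[OF r that] by (simp add: frechet_derivative_works[symmetric])
      from has_derivative_compose[OF this dh] show ?thesis
      proof (rule has_derivative_eq_rhs)
        have "frechet_derivative h (at (r x)) a = a *\<^sub>R frechet_derivative h (at (r x)) 1" for a
          using linear_cmul[OF has_derivative_linear[OF dh], of a 1]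
          unfolding real_scaleR_def[of a 1] mult_1_right .
        then show "(\<lambda>v. frechet_derivative h (at (r x)) (frechet_derivative r (at x) v)) =
            (\<lambda>v. frechet_derivative r (at x) v *\<^sub>R frechet_derivative h (at (r x)) 1)" by blast
      qed
    qed
    have "C_k n S (\<lambda>x. frechet_derivative r (at x) v *\<^sub>R frechet_derivative h (at (r x)) 1)" for v
      using smooth_on_deriv[OF r] Suc.IH[OF smooth_on_deriv[OF Suc.prems]]
      by (intro C_k_bilinear[OF S bounded_bilinear_scaleR]) (auto simp: smooth_on_def)
    then show ?case using C_k_SucI[OF S d] by blast
  qed
  then show ?thesis by (simp add: smooth_on_def)
qed

lemma C_k_realI:
  fixes h :: "real \<Rightarrow> 'a::real_normed_vector"
  assumes "open T" "\<And>t. t \<in> T \<Longrightarrow> (h has_vector_derivative h' t) (at t)" "C_k n T h'"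
  shows "C_k (Suc n) T h"
  by (rule C_k_SucI[OF assms(1) assms(2)[unfolded has_vector_derivative_def]])
    (auto intro: C_k_linear[OF assms(1) bounded_linear_scaleR_right assms(3)])

lemma smooth_on_powr: "smooth_on {0<..} (\<lambda>t. t powr (c::real))"
proof -
  have "C_k n {0<..} (\<lambda>t. t powr c)" for n
  proof (induction n arbitrary: c)
    case 0
    then show ?case by (auto intro!: continuous_intros)
  next
    case (Suc n)
    show ?case
    proof (rule C_k_realI)
      show "C_k n {0<..} (\<lambda>t. c * t powr (c - 1))"
        by (intro C_k_linear[OF _ bounded_linear_mult_right] Suc) simp
    qed (auto simp: has_real_derivative_iff_has_vector_derivative[symmetric] intro!: has_real_derivative_powr)
  qed
  then show ?thesis by (simp add: smooth_on_def)
qed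

lemma smooth_on_cpowr: "smooth_on {0<..} (\<lambda>t. of_real t powr (c::complex))"
proof -
  have d: "((\<lambda>t. of_real t powr c) has_vector_derivative c * of_real t powr (c - 1)) (at t)" if "t > 0" for t :: real and c :: complex
    using has_vector_derivative_real_field[OF has_field_derivative_powr, of t c] that by (simp add: complex_nonpos_Reals_iff)
  have "C_k n {0<..} (\<lambda>t. of_real t powr c)" for n
  proof (induction n arbitrary: c)
    case 0
    show ?case
      by (auto intro!: continuous_at_imp_continuous_on has_vector_derivative_continuous[OF d])
  next
    case (Suc n)
    show ?case
      by (rule C_k_realI[OF _ d]) (auto intro!: C_k_linear[OF _ bounded_linear_mult_right] Suc)
  qed
  then show ?thesis by (simp add: smooth_on_def)
qed

lemma smooth_on_exp_imaginary: "smooth_on UNIV (\<lambda>t::real. exp ((c::complex) * of_real t))"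
proof -
  have d: "((\<lambda>t. exp (c * of_real t)) has_vector_derivative c * exp (c * of_real t)) (at t)" for t :: real
    by (rule has_vector_derivative_real_field[of "\<lambda>z. exp (c * z)"]) (auto intro!: derivative_eq_intros)
  have "C_k n UNIV (\<lambda>t::real. exp (c * of_real t))" for n
  proof (induction n)
    case 0
    show ?case by (auto intro!: continuous_intros)
  next
    case (Suc n)
    show ?case
      by (rule C_k_realI[OF _ d]) (auto intro!: C_k_linear[OF _ bounded_linear_mult_right] Suc)
  qed
  then show ?thesis by (simp add: smooth_on_def)
qed

text \<open>The equation expresses the derivatives of a solution through the solution.\<close>

lemma smooth_on_bessel_pair:
  assumes p: "bessel_pair \<nu> f f1"
  shows "smooth_on {0<..} f"
proof -
  note d = bessel_pairD[OF p]
  have inv: "C_k n {0<..} (\<lambda>t. of_real (t powr -1) :: complex)" for n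
    using smooth_on_linear[OF _ bounded_linear_of_real smooth_on_powr[of "-1"]] open_greaterThan
    unfolding smooth_on_def by blast
  have sq: "C_k n {0<..} (\<lambda>t. of_real t * of_real t + \<nu>\<^sup>2)" for n
    using smooth_on_add[OF _ smooth_on_bilinear[OF _ bounded_bilinear_mult
          smooth_on_bounded_linear[OF _ bounded_linear_of_real] smooth_on_bounded_linear[OF _ bounded_linear_of_real]]
        smooth_on_const[of _ "\<nu>\<^sup>2"], of "{0<..}"] by (simp add: smooth_on_def)
  have "C_k n {0<..} f \<and> C_k n {0<..} f1" for n
  proof (induction n)
    case 0
    show ?case
      by (auto intro!: continuous_at_imp_continuous_on has_vector_derivative_continuous[OF d(1)]
          has_vector_derivative_continuous[OF d(2)])
  next
    case (Suc n)
    have "C_k n {0<..} (\<lambda>t. f1 t * of_real (t powr -1))"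
      by (intro C_k_bilinear[OF _ bounded_bilinear_mult] inv) (use Suc in auto)
    then have 1: "C_k n {0<..} (\<lambda>t. f1 t / t)"
      by (rule C_k_cong[rotated 2]) (auto simp: powr_minus_divide)
    have "C_k n {0<..} (\<lambda>t. (of_real t * of_real t + \<nu>\<^sup>2) * f t * of_real (t powr -1))"
      by (intro C_k_bilinear[OF _ bounded_bilinear_mult] inv sq) (use Suc in auto)
    then have 2: "C_k n {0<..} (\<lambda>t. (of_real (t\<^sup>2) + \<nu>\<^sup>2) * f t / t)"
      by (rule C_k_cong[rotated 2]) (auto simp: powr_minus_divide power2_eq_square)
    show ?case
      using C_k_realI[OF _ d(1) 1] C_k_realI[OF _ d(2) 2] by simp
  qed
  then show ?thesis by (simp add: smooth_on_def)
qed

section \<open>Iwasawa decomposition\<close>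

text \<open>Gram--Schmidt orthogonalisation of the rows of \<open>g\<close>, written out so that every step is visibly
  smooth in \<open>g\<close>.\<close>
definition gs1 :: "mat4 \<Rightarrow> real ^ 4" where
  "gs1 g = g $ 1"

definition proj_coeff :: "real ^ 4 \<Rightarrow> real ^ 4 \<Rightarrow> real" where
  "proj_coeff v b = (v \<bullet> b) / (b \<bullet> b)"

definition gs2 :: "mat4 \<Rightarrow> real ^ 4" where
  "gs2 g = g $ 2 - proj_coeff (g $ 2) (gs1 g) *\<^sub>R gs1 g"

definition gs3 :: "mat4 \<Rightarrow> real ^ 4" where
  "gs3 g = g $ 3 - proj_coeff (g $ 3) (gs1 g) *\<^sub>R gs1 g - proj_coeff (g $ 3) (gs2 g) *\<^sub>R gs2 g"

definition gs4 :: "mat4 \<Rightarrow> real ^ 4" where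
  "gs4 g = g $ 4 - proj_coeff (g $ 4) (gs1 g) *\<^sub>R gs1 g - proj_coeff (g $ 4) (gs2 g) *\<^sub>R gs2 g
     - proj_coeff (g $ 4) (gs3 g) *\<^sub>R gs3 g"

definition lower_unipotent :: "mat4 set" where
  "lower_unipotent = {n. (\<forall>i. n $ i $ i = 1) \<and> n $ 1 $ 2 = 0 \<and> n $ 1 $ 3 = 0 \<and> n $ 1 $ 4 = 0 \<and>
     n $ 2 $ 3 = 0 \<and> n $ 2 $ 4 = 0 \<and> n $ 3 $ 4 = 0}"

lemma mat4_eqI: "(\<And>i. (A::mat4) $ i = B $ i) \<Longrightarrow> A = B"
  by (simp add: vec_eq_iff)

lemma row_mult: "((A::mat4) ** B) $ i = A $ i $ 1 *\<^sub>R B $ 1 + A $ i $ 2 *\<^sub>R B $ 2 + A $ i $ 3 *\<^sub>R B $ 3 + A $ i $ 4 *\<^sub>R B $ 4"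
  by (simp add: vec_eq_iff matrix_matrix_mult_def sum_4)

text \<open>By definition \<open>g = n B\<close>, where \<open>B\<close> has the orthogonalised rows and \<open>n\<close> the projection
  coefficients, also where some \<open>proj_coeff\<close> divides by zero. Hence \<open>B\<close> is invertible with \<open>g\<close>.\<close>
lemma gs_nonzero:
  assumes "g \<in> GL4"
  shows "gs1 g \<noteq> 0" "gs2 g \<noteq> 0" "gs3 g \<noteq> 0" "gs4 g \<noteq> 0"
proof -
  define B :: mat4 where "B = vector [gs1 g, gs2 g, gs3 g, gs4 g]"
  define n :: mat4 where "n = vector [vector [1, 0, 0, 0], vector [proj_coeff (g $ 2) (gs1 g), 1, 0, 0],
    vector [proj_coeff (g $ 3) (gs1 g), proj_coeff (g $ 3) (gs2 g), 1, 0],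
    vector [proj_coeff (g $ 4) (gs1 g), proj_coeff (g $ 4) (gs2 g), proj_coeff (g $ 4) (gs3 g), 1]]"
  have B: "B $ 1 = gs1 g" "B $ 2 = gs2 g" "B $ 3 = gs3 g" "B $ 4 = gs4 g"
    by (simp_all add: B_def vector_def)
  have "(n ** B) $ i = g $ i" for i
    unfolding row_mult B using exhaust_4[of i]
    by (auto simp: n_def vector_def gs1_def gs2_def gs3_def gs4_def)
  then have "n ** B = g" by (rule mat4_eqI)
  then have "det n * det B \<noteq> 0"
    using assms by (metis GL4_def det_mul invertible_det_nz mem_Collect_eq)
  then have "row i B \<noteq> 0" for i
    using det_zero_row(2)[of i B] by auto
  then have "B $ i \<noteq> 0" for i
    by (metis row_def vec_lambda_eta)
  then show "gs1 g \<noteq> 0" "gs2 g \<noteq> 0" "gs3 g \<noteq> 0" "gs4 g \<noteq> 0"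
    using B by metis+
qed

lemma gs_orthogonal:
  assumes "g \<in> GL4"
  shows "gs2 g \<bullet> gs1 g = 0" "gs3 g \<bullet> gs1 g = 0" "gs3 g \<bullet> gs2 g = 0"
    "gs4 g \<bullet> gs1 g = 0" "gs4 g \<bullet> gs2 g = 0" "gs4 g \<bullet> gs3 g = 0"
proof -
  note nz = gs_nonzero[OF assms]
  have c: "proj_coeff v b * (b \<bullet> b) = v \<bullet> b" if "b \<noteq> 0" for v b
    using that by (simp add: proj_coeff_def)
  show 21: "gs2 g \<bullet> gs1 g = 0"
    using c[OF nz(1)] by (simp add: gs2_def inner_diff_left)
  show 31: "gs3 g \<bullet> gs1 g = 0" 
    using c[OF nz(1)] 21 by (simp add: gs3_def inner_diff_left)
  show 32: "gs3 g \<bullet> gs2 g = 0"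
    using c[OF nz(2)] 21 by (simp add: gs3_def inner_diff_left inner_commute[of "gs1 g"])
  show "gs4 g \<bullet> gs1 g = 0"
    using c[OF nz(1)] 21 31 by (simp add: gs4_def inner_diff_left)
  show "gs4 g \<bullet> gs2 g = 0"
    using c[OF nz(2)] 21 32 by (simp add: gs4_def inner_diff_left inner_commute[of "gs1 g"])
  show "gs4 g \<bullet> gs3 g = 0"
    using c[OF nz(3)] 31 32 by (simp add: gs4_def inner_diff_left inner_commute[of "gs1 g"] inner_commute[of "gs2 g"])
qed

definition iw_a :: "mat4 \<Rightarrow> real ^ 4" where
  "iw_a g = vector [norm (gs1 g), norm (gs2 g), norm (gs3 g), norm (gs4 g)]"

lemma vector4 [simp]:
  "(vector [a, b, c, d] :: ('a::zero) ^ 4) $ 1 = a" "(vector [a, b, c, d] :: 'a ^ 4) $ 2 = b"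
  "(vector [a, b, c, d] :: 'a ^ 4) $ 3 = c" "(vector [a, b, c, d] :: 'a ^ 4) $ 4 = d"
  by (simp_all add: vector_def)

lemma orthogonal_matrix_rows:
  "orthogonal_matrix (k::mat4) \<longleftrightarrow> (\<forall>i j. k $ i \<bullet> k $ j = (if i = j then 1 else 0))"
proof -
  have "(k ** transpose k) $ i $ j = k $ i \<bullet> k $ j" for i j
    by (simp add: matrix_matrix_mult_def transpose_def inner_vec_def)
  then have "k ** transpose k = mat 1 \<longleftrightarrow> (\<forall>i j. k $ i \<bullet> k $ j = (if i = j then 1 else 0))"
    by (simp add: vec_eq_iff mat_def)
  then show ?thesis
    by (metis orthogonal_matrix_def orthogonal_matrix matrix_left_right_inverse)
qed

lemma diag_mult_row: "(diag a ** (k::mat4)) $ i = a $ i *\<^sub>R k $ i"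
  using exhaust_4[of i] by (auto simp: vec_eq_iff matrix_matrix_mult_def diag_def sum_4)

text \<open>The rows of \<open>k\<close> are the normalised Gram--Schmidt vectors.\<close>
lemma iwasawa_exists:
  assumes "g \<in> GL4"
  obtains n k where "n \<in> lower_unipotent" "k \<in> O4" "g = n ** diag (iw_a g) ** k" "\<forall>i. 0 < iw_a g $ i"
proof -
  note nz = gs_nonzero[OF assms] and o = gs_orthogonal[OF assms]
  define k :: mat4 where "k = vector [sgn (gs1 g), sgn (gs2 g), sgn (gs3 g), sgn (gs4 g)]"
  define n :: mat4 where "n = vector [vector [1, 0, 0, 0], vector [proj_coeff (g $ 2) (gs1 g), 1, 0, 0],
    vector [proj_coeff (g $ 3) (gs1 g), proj_coeff (g $ 3) (gs2 g), 1, 0],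
    vector [proj_coeff (g $ 4) (gs1 g), proj_coeff (g $ 4) (gs2 g), proj_coeff (g $ 4) (gs3 g), 1]]"
  have "n \<in> lower_unipotent" by (simp add: lower_unipotent_def n_def forall_4)
  moreover have "k \<in> O4"
  proof -
    have s: "sgn v \<bullet> sgn v = 1" if "v \<noteq> 0" for v :: "real ^ 4"
      using that by (simp add: sgn_div_norm power2_norm_eq_inner[symmetric] power2_eq_square)
    have "k $ i \<bullet> k $ j = (if i = j then 1 else 0)" for i j
      using exhaust_4[of i] exhaust_4[of j] o nz
      by (auto simp: k_def s) (auto simp: sgn_div_norm inner_commute)
    then show ?thesis by (simp add: O4_def orthogonal_matrix_rows)
  qed
  moreover have "g = n ** diag (iw_a g) ** k"
  proof (rule mat4_eqI)
    fix i
    have ns: "norm v *\<^sub>R sgn v = v" for v :: "real ^ 4"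
      by (cases "v = 0") (simp_all add: sgn_div_norm)
    show "g $ i = (n ** diag (iw_a g) ** k) $ i"
      unfolding matrix_mul_assoc[symmetric] row_mult[of n] diag_mult_row using exhaust_4[of i]
      by (auto simp: n_def k_def iw_a_def ns) (auto simp: gs1_def gs2_def gs3_def gs4_def)
  qed
  moreover have "\<forall>i. 0 < iw_a g $ i" using nz by (simp add: iw_a_def forall_4)
  ultimately show ?thesis using that by blast
qed

text \<open>For \<open>g = n a k\<close> the Gram--Schmidt vectors are the \<open>a\<^sub>i\<close> times the rows of \<open>k\<close>. This is how
  \<open>a\<close> and the two entries of \<open>n\<close> that enter the character are recognised as smooth functions of \<open>g\<close>.\<close>
lemma iwasawa_unique:
  assumes n: "n \<in> lower_unipotent" and k: "k \<in> O4" and a: "\<forall>i. 0 < a $ i" and g: "g = n ** diag a ** k"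
  shows "iw_a g = a" "proj_coeff (g $ 2) (gs1 g) = n $ 2 $ 1" "proj_coeff (g $ 4) (gs3 g) = n $ 4 $ 3"
proof -
  have o: "k $ i \<bullet> k $ j = (if i = j then 1 else 0)" for i j
    using k by (simp add: O4_def orthogonal_matrix_rows)
  have nk: "norm (k $ i) = 1" for i using o[of i i] by (simp add: norm_eq_1)
  have a0': "a $ i > 0" for i using a by simp
  have a0: "a $ i \<noteq> 0" for i using a0'[of i] by simp
  have row: "g $ i = (n $ i $ 1 * a $ 1) *\<^sub>R k $ 1 + (n $ i $ 2 * a $ 2) *\<^sub>R k $ 2
      + (n $ i $ 3 * a $ 3) *\<^sub>R k $ 3 + (n $ i $ 4 * a $ 4) *\<^sub>R k $ 4" for i
    unfolding g matrix_mul_assoc[symmetric] row_mult[of n] diag_mult_row by simp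
  note nn = n[unfolded lower_unipotent_def mem_Collect_eq forall_4]
  have r: "g $ 1 = a $ 1 *\<^sub>R k $ 1" "g $ 2 = (n $ 2 $ 1 * a $ 1) *\<^sub>R k $ 1 + a $ 2 *\<^sub>R k $ 2"
    "g $ 3 = (n $ 3 $ 1 * a $ 1) *\<^sub>R k $ 1 + (n $ 3 $ 2 * a $ 2) *\<^sub>R k $ 2 + a $ 3 *\<^sub>R k $ 3"
    "g $ 4 = (n $ 4 $ 1 * a $ 1) *\<^sub>R k $ 1 + (n $ 4 $ 2 * a $ 2) *\<^sub>R k $ 2 + (n $ 4 $ 3 * a $ 3) *\<^sub>R k $ 3 + a $ 4 *\<^sub>R k $ 4"
    using nn by (simp_all add: row)
  have cf: "proj_coeff v (a $ j *\<^sub>R k $ j) = (v \<bullet> k $ j) / a $ j" for v j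
    using a0[of j] o[of j j] by (simp add: proj_coeff_def)
  have 1: "gs1 g = a $ 1 *\<^sub>R k $ 1" by (simp add: gs1_def r)
  have c2: "proj_coeff (g $ 2) (gs1 g) = n $ 2 $ 1"
    using a0[of 1] by (simp add: 1 cf r inner_add_left o)
  have 2: "gs2 g = a $ 2 *\<^sub>R k $ 2" unfolding gs2_def c2 by (simp add: 1 r)
  have c3: "proj_coeff (g $ 3) (gs1 g) = n $ 3 $ 1" "proj_coeff (g $ 3) (gs2 g) = n $ 3 $ 2"
    using a0[of 1] a0[of 2] by (simp_all add: 1 2 cf r inner_add_left o)
  have 3: "gs3 g = a $ 3 *\<^sub>R k $ 3" unfolding gs3_def c3 by (simp add: 1 2 r)
  have c4: "proj_coeff (g $ 4) (gs1 g) = n $ 4 $ 1" "proj_coeff (g $ 4) (gs2 g) = n $ 4 $ 2" "proj_coeff (g $ 4) (gs3 g) = n $ 4 $ 3"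
    using a0[of 1] a0[of 2] a0[of 3] by (simp_all add: 1 2 3 cf r inner_add_left o)
  have 4: "gs4 g = a $ 4 *\<^sub>R k $ 4" unfolding gs4_def c4 by (simp add: 1 2 3 r)
  show "iw_a g = a"
    using a0' by (simp add: vec_eq_iff forall_4 iw_a_def 1 2 3 4 nk abs_of_pos)
  show "proj_coeff (g $ 2) (gs1 g) = n $ 2 $ 1" "proj_coeff (g $ 4) (gs3 g) = n $ 4 $ 3" by (fact c2 c4(3))+
qed

lemma smooth_on_inner:
  "open S \<Longrightarrow> smooth_on S f \<Longrightarrow> smooth_on S g \<Longrightarrow> smooth_on S (\<lambda>x. f x \<bullet> (g x :: 'b::real_inner))"
  by (rule smooth_on_bilinear[OF _ bounded_bilinear_inner])

lemma smooth_on_real_powr: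
  "open S \<Longrightarrow> smooth_on S r \<Longrightarrow> (\<And>x. x \<in> S \<Longrightarrow> 0 < r x) \<Longrightarrow> smooth_on S (\<lambda>x. r x powr (c::real))"
  by (rule smooth_on_compose_real[OF _ _ _ smooth_on_powr]) auto

lemma smooth_on_proj_coeff:
  assumes "open S" "smooth_on S v" "smooth_on S b" "\<And>x. x \<in> S \<Longrightarrow> b x \<noteq> 0"
  shows "smooth_on S (\<lambda>x. proj_coeff (v x) (b x))"
proof -
  have "smooth_on S (\<lambda>x. (v x \<bullet> b x) * (b x \<bullet> b x) powr -1)"
    by (intro smooth_on_bilinear[OF _ bounded_bilinear_mult] smooth_on_real_powr smooth_on_inner) (use assms in auto)
  then show ?thesis
    by (rule smooth_on_cong[rotated 2]) (use assms in \<open>auto simp: proj_coeff_def powr_minus_divide\<close>)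
qed

lemma smooth_on_gs:
  "smooth_on GL4 gs1" "smooth_on GL4 gs2" "smooth_on GL4 gs3" "smooth_on GL4 gs4"
proof -
  have r: "smooth_on GL4 (\<lambda>g. g $ i)" for i
    by (intro smooth_on_bounded_linear open_GL4 bounded_linear_vec_nth)
  note I = smooth_on_diff smooth_on_bilinear[OF _ bounded_bilinear_scaleR] smooth_on_proj_coeff open_GL4 r gs_nonzero
  show 1: "smooth_on GL4 gs1" unfolding gs1_def[abs_def] by (rule r)
  show 2: "smooth_on GL4 gs2" unfolding gs2_def[abs_def] by (intro I 1)
  show 3: "smooth_on GL4 gs3" unfolding gs3_def[abs_def] by (intro I 1 2)
  show 4: "smooth_on GL4 gs4" unfolding gs4_def[abs_def] by (intro I 1 2 3)
qed

lemma smooth_on_norm: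
  assumes "open S" "smooth_on S b" "\<And>x. x \<in> S \<Longrightarrow> b x \<noteq> 0"
  shows "smooth_on S (\<lambda>x. norm (b x :: 'b::real_inner))"
proof -
  have "smooth_on S (\<lambda>x. (b x \<bullet> b x) powr (1/2))"
    by (intro smooth_on_real_powr smooth_on_inner) (use assms in auto)
  then show ?thesis
    by (rule smooth_on_cong[rotated 2]) (use assms in \<open>auto simp: norm_eq_sqrt_inner powr_half_sqrt\<close>)
qed

lemma smooth_on_iw_a: "smooth_on GL4 (\<lambda>g. iw_a g $ i)"
  using exhaust_4[of i]
  by (auto simp: iw_a_def intro!: smooth_on_norm open_GL4 smooth_on_gs gs_nonzero)

section \<open>The annihilator conditions as differential equations\<close>

abbreviation E :: "4 \<Rightarrow> 4 \<Rightarrow> (mat4 \<Rightarrow> complex) \<Rightarrow> mat4 \<Rightarrow> complex" where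
  "E i j \<equiv> R_real (munit i j)"

lemma R_real_lin:
  assumes "f \<in> Cinf_GL4"
  shows "R_real (X + Y) f g = R_real X f g + R_real Y f g" "R_real (X - Y) f g = R_real X f g - R_real Y f g"
    "R_real (c *\<^sub>R X) f g = c * R_real X f g" "R_real 0 f g = 0"
  using R_real_lin1[OF assms, of 1 X 1 Y g] R_real_lin1[OF assms, of 1 X "-1" Y g]
    R_real_lin1[OF assms, of c X 0 X g] R_real_lin1[OF assms, of 0 X 0 X g] by simp_all

lemma R_real_sum:
  "f \<in> Cinf_GL4 \<Longrightarrow> R_real (\<Sum>i\<in>A. X i) f g = (\<Sum>i\<in>A. R_real (X i) f g)"
  by (induction A rule: infinite_finite_induct) (auto simp: R_real_lin)

lemma R_gl4_munit: "f \<in> Cinf_GL4 \<Longrightarrow> R_gl4 (munit i j) f = E i j f"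
proof -
  assume f: "f \<in> Cinf_GL4"
  have "map_matrix Re (munit i j) = munit i j" "map_matrix Im (munit i j) = 0"
    by (simp_all add: vec_eq_iff munit_def)
  then show ?thesis by (simp add: R_gl4_def fun_eq_iff R_real_lin[OF f])
qed

lemma munit_mult: "munit i j ** (munit k l :: mat4) = (if j = k then munit i l else 0)"
proof -
  have "(munit i j ** munit k l :: mat4) $ a $ b = (if j = k then munit i l else 0) $ a $ b" for a b
  proof -
    have "(munit i j ** munit k l :: mat4) $ a $ b = (\<Sum>c\<in>UNIV. if c = j then (if a = i \<and> j = k \<and> b = l then 1 else 0) else 0)"
      unfolding matrix_matrix_mult_def munit_def vec_lambda_beta by (intro sum.cong) auto
    then show ?thesis by (simp add: munit_def)
  qed
  then show ?thesis by (simp add: vec_eq_iff)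
qed

lemma E_commute:
  assumes f: "f \<in> Cinf_GL4"
  shows "E i j (E k l f) g = E k l (E i j f) g + (if j = k then E i l f g else 0) - (if l = i then E k j f g else 0)"
  using R_real_bracket[OF f, of "munit i j" "munit k l" g]
  by (auto simp: munit_mult R_real_lin[OF f] algebra_simps split: if_splits)

lemma Cinf_eq_0: "f \<in> Cinf_GL4 \<Longrightarrow> (\<And>g. g \<in> GL4 \<Longrightarrow> f g = 0) \<Longrightarrow> f = (\<lambda>g. 0)"
  by (auto simp: Cinf_GL4_def fun_eq_iff)

lemma Ugl4_representative: obtains t where "u = abs_Ugl4 t"
  by (metis Quotient3_abs_rep[OF Quotient3_Ugl4])

lemma R_U_Cinf: "f \<in> Cinf_GL4 \<Longrightarrow> R_U u f \<in> Cinf_GL4"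
  by (simp add: R_U_def R_free_Cinf)

lemma R_U_add: "f \<in> Cinf_GL4 \<Longrightarrow> R_U (u + v) f g = R_U u f g + R_U v f g"
  by (rule Ugl4_representative[of u], rule Ugl4_representative[of v]) (simp add: plus_Ugl4.abs_eq R_U_abs R_free_add)

lemma R_U_diff: "f \<in> Cinf_GL4 \<Longrightarrow> R_U (u - v) f g = R_U u f g - R_U v f g"
  by (rule Ugl4_representative[of u], rule Ugl4_representative[of v]) (simp add: minus_Ugl4.abs_eq R_U_abs R_free_diff)

lemma R_U_0: "f \<in> Cinf_GL4 \<Longrightarrow> R_U 0 f g = 0"
  using R_U_diff[of f 0 0 g] by simp

lemma R_U_sum: "f \<in> Cinf_GL4 \<Longrightarrow> R_U (\<Sum>i\<in>A. u i) f g = (\<Sum>i\<in>A. R_U (u i) f g)"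
  by (induction A rule: infinite_finite_induct) (auto simp: R_U_0 R_U_add)

lemma R_U_of_scalar: "f \<in> Cinf_GL4 \<Longrightarrow> R_U (of_scalar c) f g = c * f g"
  by (simp add: of_scalar_def const_def R_U_abs R_free_single zero_free_monoid_def)

lemma R_U_zero_arg: "R_U u (\<lambda>g. 0) = (\<lambda>g. 0)"
  unfolding R_U_def using R_free_arg_cmult[OF Cinf_zero, of "rep_Ugl4 u" 0] by simp

lemma R_U_EE: "f \<in> Cinf_GL4 \<Longrightarrow> R_U (EE $ i $ j) f = E i j f"
  by (simp add: EE_def R_U_of_gl4 R_gl4_munit)

text \<open>With \<open>c = \<lambda>\<^sub>1 + \<lambda>\<^sub>2 + k\<close> and \<open>d = \<lambda>\<^sub>1 (\<lambda>\<^sub>2 + k)\<close> this is the action of the entry \<open>(i,j)\<close> of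
  \<open>(\<bbbE> - \<lambda>\<^sub>1)(\<bbbE> - \<lambda>\<^sub>2 - k)\<close>.\<close>
definition quadratic_op :: "complex \<Rightarrow> complex \<Rightarrow> 4 \<Rightarrow> 4 \<Rightarrow> (mat4 \<Rightarrow> complex) \<Rightarrow> mat4 \<Rightarrow> complex" where
  "quadratic_op c d i j f g = (\<Sum>m\<in>UNIV. E i m (E m j f) g) - c * E i j f g + (if i = j then d * f g else 0)"

lemma R_U_quadratic:
  assumes f: "f \<in> Cinf_GL4"
  shows "R_U (((EE - mat (of_scalar a)) ** (EE - mat (of_scalar b))) $ i $ j) f g = quadratic_op (a + b) (a * b) i j f g"
proof -
  have 1: "R_U ((EE - mat (of_scalar b)) $ m $ j) f = (\<lambda>g. E m j f g + (if m = j then - b else 0) * f g)" for m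
    using f by (auto simp: fun_eq_iff mat_def R_U_diff R_U_EE R_U_of_scalar R_U_0)
  have 2: "R_U ((EE - mat (of_scalar a)) $ i $ m) h g = E i m h g - (if i = m then a * h g else 0)"
    if "h \<in> Cinf_GL4" for h m
    using that by (simp add: mat_def R_U_diff R_U_EE R_U_of_scalar R_U_0)
  have "R_U ((EE - mat (of_scalar a)) $ i $ m * (EE - mat (of_scalar b)) $ m $ j) f g =
      E i m (E m j f) g + (if m = j then - b * E i m f g else 0)
        - (if i = m then a * (E m j f g + (if m = j then - b else 0) * f g) else 0)" for m
  proof -
    have C: "(\<lambda>g. E m j f g + (if m = j then - b else 0) * f g) \<in> Cinf_GL4"
      by (intro Cinf_add Cinf_cmult R_real_Cinf f)
    show ?thesis
      unfolding R_U_mult[OF f] 1 2[OF C]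
      by (simp add: R_real_add[OF R_real_Cinf[OF f] Cinf_cmult[OF f]] R_real_cmult[OF f])
  qed
  then have "R_U (((EE - mat (of_scalar a)) ** (EE - mat (of_scalar b))) $ i $ j) f g =
      (\<Sum>m\<in>UNIV. E i m (E m j f) g) + (\<Sum>m\<in>UNIV. if m = j then - b * E i m f g else 0)
        - (\<Sum>m\<in>UNIV. if i = m then a * (E m j f g + (if m = j then - b else 0) * f g) else 0)"
    unfolding matrix_matrix_mult_def vec_lambda_beta R_U_sum[OF f] by (simp add: sum.distrib sum_subtractf)
  then show ?thesis by (cases "i = j") (simp_all add: quadratic_op_def algebra_simps)
qed

text \<open>A left ideal annihilates \<open>f\<close> as soon as its generators do, because \<open>R_U (u * v)\<close> applies \<open>v\<close>
  first.\<close>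
lemma ideal_annihilates_iff:
  assumes f: "f \<in> Cinf_GL4"
  shows "(\<forall>X\<in>I_ideal k l1 l2. \<forall>g\<in>GL4. R_U X f g = 0) \<longleftrightarrow>
    (\<forall>g\<in>GL4. (\<forall>i j. quadratic_op (l1 + l2 + of_nat k) (l1 * (l2 + of_nat k)) i j f g = 0) \<and>
       (\<Sum>i\<in>UNIV. E i i f g) = (of_nat k * l1 + (4 - of_nat k) * l2) * f g)" (is "?L \<longleftrightarrow> ?R")
proof -
  define Q where "Q i j = ((EE - mat (of_scalar l1)) ** (EE - mat (of_scalar (l2 + of_nat k)))) $ i $ j" for i j
  define T where "T = (\<Sum>i\<in>UNIV. EE $ i $ i) - of_scalar (of_nat k * l1 + (4 - of_nat k) * l2)"
  have I: "I_ideal k l1 l2 = {(\<Sum>i\<in>UNIV. \<Sum>j\<in>UNIV. u i j * Q i j) + v * T | u v. True}"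
    by (simp add: I_ideal_def Q_def T_def)
  have Q: "R_U (Q i j) f g = quadratic_op (l1 + l2 + of_nat k) (l1 * (l2 + of_nat k)) i j f g" for i j g
    unfolding Q_def R_U_quadratic[OF f] by (simp add: add.assoc)
  have T: "R_U T f g = (\<Sum>i\<in>UNIV. E i i f g) - (of_nat k * l1 + (4 - of_nat k) * l2) * f g" for g
    unfolding T_def by (simp only: R_U_diff[OF f] R_U_sum[OF f] R_U_EE[OF f] R_U_of_scalar[OF f])
  have "?R \<longleftrightarrow> (\<forall>g\<in>GL4. (\<forall>i j. R_U (Q i j) f g = 0) \<and> R_U T f g = 0)"
    by (simp add: Q T)
  also have "\<dots> \<longleftrightarrow> ?L"
  proof
    assume *: "\<forall>g\<in>GL4. (\<forall>i j. R_U (Q i j) f g = 0) \<and> R_U T f g = 0"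
    then have "R_U (Q i j) f = (\<lambda>g. 0)" "R_U T f = (\<lambda>g. 0)" for i j
      using Cinf_eq_0[OF R_U_Cinf[OF f]] by simp_all
    then show ?L
      by (auto simp: I R_U_add[OF f] R_U_sum[OF f] R_U_mult[OF f] R_U_zero_arg)
  next
    assume L: ?L
    have "Q i j \<in> I_ideal k l1 l2" for i j
    proof -
      have "(\<Sum>b\<in>UNIV. (if a = i \<and> b = j then 1 else 0) * Q a b) = (if a = i then Q i j else 0)" for a
        by (cases "a = i") (simp_all add: if_distrib[of "\<lambda>x. x * _"] cong: if_cong)
      then have "(\<Sum>a\<in>UNIV. \<Sum>b\<in>UNIV. (if a = i \<and> b = j then 1 else 0) * Q a b) + 0 * T = Q i j"
        by simp
      then show ?thesis
        unfolding I
        by (intro CollectI exI[of _ "\<lambda>a b. if a = i \<and> b = j then 1 else 0"] exI[of _ 0]) simp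
    qed
    moreover have "T \<in> I_ideal k l1 l2"
    proof -
      have "(\<Sum>a\<in>UNIV. \<Sum>b\<in>UNIV. 0 * Q a b) + 1 * T = T" by simp
      then show ?thesis
        unfolding I by (intro CollectI exI[of _ "\<lambda>a b. 0"] exI[of _ 1]) simp
    qed
    ultimately show "\<forall>g\<in>GL4. (\<forall>i j. R_U (Q i j) f g = 0) \<and> R_U T f g = 0" using L by blast
  qed
  finally show ?thesis by blast
qed

section \<open>Covariance under translations\<close>

text \<open>Only the velocity of a curve matters, so that \<open>g exp (t X)\<close> may be replaced by any curve that is
  better adapted to the symmetries of \<open>F\<close>.\<close>
lemma has_vector_derivative_along_curve:
  assumes "F \<in> Cinf_GL4" "c t \<in> GL4" "(c has_vector_derivative c t ** X) (at t)"
  shows "((\<lambda>t. F (c t)) has_vector_derivative R_real X F (c t)) (at t)"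
proof -
  have dF: "(F has_derivative frechet_derivative F (at (c t))) (at (c t))"
    by (rule Cinf_has_derivative[OF assms(1,2)])
  have "((\<lambda>t. F (c t)) has_derivative (\<lambda>s. frechet_derivative F (at (c t)) (s *\<^sub>R (c t ** X)))) (at t)"
    by (rule has_derivative_compose[OF assms(3)[unfolded has_vector_derivative_def] dF])
  then show ?thesis
    unfolding has_vector_derivative_def R_real_eq[OF assms(1,2)]
    by (simp only: linear_cmul[OF has_derivative_linear[OF dF]])
qed

text \<open>Used for left and for right translations \<open>T\<close>.\<close>
lemma frechet_derivative_translate:
  assumes "F \<in> Cinf_GL4" "H \<in> Cinf_GL4" "bounded_linear T" "g \<in> GL4"
    "\<And>g. g \<in> GL4 \<Longrightarrow> T g \<in> GL4" "\<And>g. g \<in> GL4 \<Longrightarrow> F (T g) = H g"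
  shows "frechet_derivative F (at (T g)) (T v) = frechet_derivative H (at g) v"
proof -
  have "((\<lambda>g. F (T g)) has_derivative (\<lambda>v. frechet_derivative F (at (T g)) (T v))) (at g)"
    by (rule has_derivative_compose[OF bounded_linear_imp_has_derivative[OF assms(3)] Cinf_has_derivative[OF assms(1) assms(5)[OF assms(4)]]])
  then have "(H has_derivative (\<lambda>v. frechet_derivative F (at (T g)) (T v))) (at g)"
    by (rule has_derivative_transform_within_open[OF _ open_GL4 assms(4)]) (rule assms(6))
  from frechet_derivative_at[OF this] show ?thesis by metis
qed

lemma GL4_mult: "g \<in> GL4 \<Longrightarrow> h \<in> GL4 \<Longrightarrow> g ** h \<in> GL4"
  by (simp add: GL4_def invertible_mult)

lemma O4_GL4: "k \<in> O4 \<Longrightarrow> k \<in> GL4"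
  by (auto simp: O4_def GL4_def orthogonal_matrix_def invertible_def)

abbreviation S_span :: "mat4 set" where
  "S_span \<equiv> span {munit 2 1, munit 4 3, munit 3 1, munit 4 2, munit 4 1}"

lemma S_span_nilp: "S_span \<subseteq> nilp"
  unfolding nilp_def by (rule span_mono) auto

lemma mexp_nilp_entries:
  assumes "X \<in> nilp"
  shows "mexp X \<in> lower_unipotent" "mexp X $ 2 $ 1 = X $ 2 $ 1" "mexp X $ 3 $ 2 = X $ 3 $ 2" "mexp X $ 4 $ 3 = X $ 4 $ 3"
  by (simp_all add: lower_unipotent_def forall_4 mexp_nilp[OF assms] nilp_entries[OF assms] matrix_matrix_mult_def sum_4 mat_def)

lemma lower_unipotent_GL4: "n \<in> lower_unipotent \<Longrightarrow> n \<in> GL4"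
proof -
  assume n: "n \<in> lower_unipotent"
  note nn = n[unfolded lower_unipotent_def mem_Collect_eq forall_4]
  let ?a = "n $ 2 $ 1" and ?b = "n $ 3 $ 2" and ?c = "n $ 4 $ 3" and ?d = "n $ 3 $ 1" and ?e = "n $ 4 $ 2" and ?f = "n $ 4 $ 1"
  define m :: mat4 where "m = vector [vector [1,0,0,0], vector [- ?a, 1, 0, 0],
    vector [?a * ?b - ?d, - ?b, 1, 0], vector [?d * ?c + ?a * ?e - ?a * ?b * ?c - ?f, ?b * ?c - ?e, - ?c, 1]]"
  have "n ** m = mat 1"
    using nn by (simp add: vec_eq_iff forall_4 matrix_matrix_mult_def sum_4 mat_def m_def algebra_simps)
  then show ?thesis unfolding GL4_def mem_Collect_eq invertible_right_inverse by blast
qed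

lemma S_II_GL4: "s \<in> S_II \<Longrightarrow> s \<in> GL4"
  unfolding S_II_def using mexp_nilp_entries(1) lower_unipotent_GL4 S_span_nilp by blast

definition left_equivariant :: "(mat4 \<Rightarrow> complex) \<Rightarrow> (mat4 \<Rightarrow> complex) \<Rightarrow> bool" where
  "left_equivariant ch F \<longleftrightarrow> (\<forall>s\<in>S_II. \<forall>g\<in>GL4. F (s ** g) = ch s * F g)"

lemma left_equivariant_R_real:
  assumes F: "F \<in> Cinf_GL4" "left_equivariant ch F"
  shows "left_equivariant ch (R_real X F)"
  unfolding left_equivariant_def
proof (intro ballI)
  fix s g assume s: "s \<in> S_II" and g: "g \<in> GL4"
  have sG: "s \<in> GL4" by (rule S_II_GL4[OF s])
  have "frechet_derivative F (at (s ** g)) (s ** (g ** X)) = frechet_derivative (\<lambda>g. ch s * F g) (at g) (g ** X)"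
    using F s sG by (intro frechet_derivative_translate[OF F(1) Cinf_cmult[OF F(1)] bl_mult_right g])
      (auto simp: left_equivariant_def GL4_mult)
  then have "R_real X F (s ** g) = R_real X (\<lambda>g. ch s * F g) g"
    using g sG by (simp add: R_real_eq F Cinf_cmult GL4_mult matrix_mul_assoc)
  then show "R_real X F (s ** g) = ch s * R_real X F g"
    by (simp add: R_real_cmult F)
qed

lemma munit_conj: "(k::mat4) ** munit i j ** transpose k = (\<Sum>a\<in>UNIV. \<Sum>b\<in>UNIV. (k $ a $ i * k $ b $ j) *\<^sub>R munit a b)"
proof -
  have "(k ** munit i j) $ a $ c = (if c = j then k $ a $ i else 0)" for a c
  proof -
    have "(k ** munit i j) $ a $ c = (\<Sum>m\<in>UNIV. if m = i then (if c = j then k $ a $ i else 0) else 0)"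
      unfolding matrix_matrix_mult_def munit_def vec_lambda_beta by (intro sum.cong) auto
    then show ?thesis by simp
  qed
  then have 1: "(k ** munit i j ** transpose k) $ a $ b = k $ a $ i * k $ b $ j" for a b
    by (simp add: matrix_matrix_mult_def[of "k ** munit i j"] transpose_def if_distrib[of "\<lambda>x. x * _"] cong: if_cong)
  have "(\<Sum>a\<in>UNIV. \<Sum>b\<in>UNIV. (k $ a $ i * k $ b $ j) *\<^sub>R munit a b :: mat4) $ x $ y = k $ x $ i * k $ y $ j" for x y
  proof -
    have "(\<Sum>b\<in>UNIV. k $ a $ i * k $ b $ j * (if x = a \<and> y = b then 1 else 0)) =
        (if a = x then k $ x $ i * k $ y $ j else 0)" for a
      by (cases "a = x") (simp_all add: if_distrib[of "\<lambda>x. _ * x"] cong: if_cong)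
    then show ?thesis by (simp add: munit_def)
  qed
  with 1 show ?thesis by (simp add: vec_eq_iff)
qed

lemma E_right_translate:
  assumes F: "F \<in> Cinf_GL4" and H: "H \<in> Cinf_GL4" and k: "k \<in> O4" and g: "g \<in> GL4"
    and FH: "\<And>g. g \<in> GL4 \<Longrightarrow> F (g ** k) = H g"
  shows "E i j F (g ** k) = (\<Sum>a\<in>UNIV. \<Sum>b\<in>UNIV. of_real (k $ a $ i * k $ b $ j) * E a b H g)"
proof -
  have kk: "transpose k ** k = mat 1" using k by (simp add: O4_def orthogonal_matrix_def)
  have "g ** k ** munit i j = (g ** (k ** munit i j ** transpose k)) ** k"
    by (simp add: matrix_mul_assoc[symmetric] kk)
  then have "E i j F (g ** k) = frechet_derivative F (at (g ** k)) ((g ** (k ** munit i j ** transpose k)) ** k)"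
    using g k by (simp add: R_real_eq F GL4_mult O4_GL4)
  also have "\<dots> = frechet_derivative H (at g) (g ** (k ** munit i j ** transpose k))"
    using k by (intro frechet_derivative_translate[OF F H bl_mult_left g]) (auto simp: GL4_mult O4_GL4 FH)
  also have "\<dots> = R_real (k ** munit i j ** transpose k) H g"
    by (simp add: R_real_eq H g)
  also have "\<dots> = (\<Sum>a\<in>UNIV. \<Sum>b\<in>UNIV. of_real (k $ a $ i * k $ b $ j) * E a b H g)"
    unfolding munit_conj by (simp only: R_real_sum[OF H] R_real_lin[OF H])
  finally show ?thesis .
qed

definition right_invariant :: "(mat4 \<Rightarrow> complex) \<Rightarrow> bool" where
  "right_invariant f \<longleftrightarrow> (\<forall>g\<in>GL4. \<forall>k\<in>O4. f (g ** k) = f g)"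

lemma E_right_invariant:
  assumes "f \<in> Cinf_GL4" "right_invariant f" "k \<in> O4" "g \<in> GL4"
  shows "E i j f (g ** k) = (\<Sum>a\<in>UNIV. \<Sum>b\<in>UNIV. of_real (k $ a $ i * k $ b $ j) * E a b f g)"
  by (rule E_right_translate) (use assms in \<open>auto simp: right_invariant_def\<close>)

lemma trace_right_invariant:
  assumes "f \<in> Cinf_GL4" "right_invariant f" "k \<in> O4" "g \<in> GL4"
  shows "(\<Sum>i\<in>UNIV. E i i f (g ** k)) = (\<Sum>i\<in>UNIV. E i i f g)"
proof -
  have o: "(\<Sum>i\<in>UNIV. k $ a $ i * k $ b $ i) = (if a = b then 1 else 0)" for a b
    using assms(3) by (simp add: O4_def orthogonal_matrix_rows inner_vec_def)
  have "(\<Sum>i\<in>UNIV. E i i f (g ** k)) = (\<Sum>a\<in>UNIV. \<Sum>b\<in>UNIV. \<Sum>i\<in>UNIV. of_real (k $ a $ i * k $ b $ i) * E a b f g)"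
    unfolding E_right_invariant[OF assms]
    by (rule trans[OF sum.swap], rule sum.cong[OF refl], rule sum.swap)
  also have "\<dots> = (\<Sum>a\<in>UNIV. \<Sum>b\<in>UNIV. of_real (if a = b then 1 else 0) * E a b f g)"
    unfolding sum_distrib_right[symmetric] of_real_sum[symmetric] o ..
  also have "\<dots> = (\<Sum>a\<in>UNIV. E a a f g)"
    by (simp add: if_distrib[of of_real] if_distrib[of "\<lambda>x. x * _"] cong: if_cong)
  finally show ?thesis .
qed

text \<open>Right translation by \<open>k\<close> conjugates the matrix of operators \<open>E\<^sub>i\<^sub>j\<close> by \<open>k\<close>, and therefore also
  its square, because \<open>k k\<^sup>T = 1\<close>. So the entries at \<open>g k\<close> are combinations of the entries at \<open>g\<close>.\<close>
lemma quadratic_op_right_invariant: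
  assumes "f \<in> Cinf_GL4" "right_invariant f" "k \<in> O4" "g \<in> GL4"
    and zero: "\<And>a b. quadratic_op c d a b f g = 0"
  shows "quadratic_op c d i j f (g ** k) = 0"
proof -
  note f = assms(1)
  have o: "(\<Sum>m\<in>UNIV. k $ a $ m * k $ b $ m) = (if a = b then 1 else 0)" for a b
    using assms(3) by (simp add: O4_def orthogonal_matrix_rows inner_vec_def)
  have o': "(\<Sum>a\<in>UNIV. k $ a $ i * k $ a $ j) = (if i = j then 1 else 0)"
  proof -
    have "(transpose k ** k) $ i $ j = (mat 1 :: mat4) $ i $ j"
      using assms(3) by (simp add: O4_def orthogonal_matrix_def)
    then show ?thesis by (simp add: matrix_matrix_mult_def transpose_def mat_def)
  qed
  have "E i m (E m j f) (g ** k) = (\<Sum>a\<in>UNIV. \<Sum>b\<in>UNIV. \<Sum>c\<in>UNIV. \<Sum>d\<in>UNIV.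
      of_real (k $ b $ m * k $ c $ m) * (of_real (k $ a $ i * k $ d $ j) * E a b (E c d f) g))" for m
  proof -
    let ?H = "\<lambda>g. \<Sum>c\<in>UNIV. \<Sum>d\<in>UNIV. of_real (k $ c $ m * k $ d $ j) * E c d f g"
    have C: "(\<lambda>g. of_real (k $ c $ m * k $ d $ j) * E c d f g) \<in> Cinf_GL4" for c d
      by (intro Cinf_cmult R_real_Cinf f)
    have H: "?H \<in> Cinf_GL4" by (intro Cinf_sum C)
    have S: "R_real X (\<lambda>g. \<Sum>i\<in>A. h i g) g = (\<Sum>i\<in>A. R_real X (h i) g)"
      if "\<And>i. h i \<in> Cinf_GL4" for h :: "4 \<Rightarrow> mat4 \<Rightarrow> complex" and A X
    proof (induction A rule: infinite_finite_induct)
      case (insert x F)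
      then show ?case by (simp add: R_real_add[OF that Cinf_sum[OF that]])
    next
      case (infinite A)
      then show ?case using R_real_cmult[OF Cinf_zero, of X 0] by simp
    qed (use R_real_cmult[OF Cinf_zero, of X 0] in simp)
    have "E i m (E m j f) (g ** k) = (\<Sum>a\<in>UNIV. \<Sum>b\<in>UNIV. of_real (k $ a $ i * k $ b $ m) * E a b ?H g)"
      by (rule E_right_translate[OF R_real_Cinf[OF f] H assms(3,4)]) (rule E_right_invariant[OF assms(1,2,3)])
    moreover have "E a b ?H g = (\<Sum>c\<in>UNIV. \<Sum>d\<in>UNIV. of_real (k $ c $ m * k $ d $ j) * E a b (E c d f) g)" for a b
      unfolding S[OF Cinf_sum[OF C]] S[OF C] R_real_cmult[OF R_real_Cinf[OF f]] ..
    ultimately show ?thesis by (simp add: sum_distrib_left mult_ac)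
  qed
  then have "(\<Sum>m\<in>UNIV. E i m (E m j f) (g ** k)) = (\<Sum>m\<in>UNIV. \<Sum>a\<in>UNIV. \<Sum>b\<in>UNIV. \<Sum>c\<in>UNIV. \<Sum>d\<in>UNIV.
      of_real (k $ b $ m * k $ c $ m) * (of_real (k $ a $ i * k $ d $ j) * E a b (E c d f) g))" by simp
  also have "\<dots> = (\<Sum>a\<in>UNIV. \<Sum>b\<in>UNIV. \<Sum>c\<in>UNIV. \<Sum>d\<in>UNIV. \<Sum>m\<in>UNIV.
      of_real (k $ b $ m * k $ c $ m) * (of_real (k $ a $ i * k $ d $ j) * E a b (E c d f) g))"
    by ((rule trans[OF sum.swap], rule sum.cong[OF refl])+, rule refl)
  also have "\<dots> = (\<Sum>a\<in>UNIV. \<Sum>b\<in>UNIV. \<Sum>c\<in>UNIV. \<Sum>d\<in>UNIV.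
      of_real (if b = c then 1 else 0) * (of_real (k $ a $ i * k $ d $ j) * E a b (E c d f) g))"
    unfolding sum_distrib_right[symmetric] of_real_sum[symmetric] o ..
  also have "\<dots> = (\<Sum>a\<in>UNIV. \<Sum>b\<in>UNIV. \<Sum>d\<in>UNIV. of_real (k $ a $ i * k $ d $ j) * E a b (E b d f) g)"
  proof (rule sum.cong[OF refl], rule sum.cong[OF refl])
    fix a b :: 4
    have "(\<Sum>c\<in>UNIV. \<Sum>d\<in>UNIV. of_real (if b = c then 1 else 0) * (of_real (k $ a $ i * k $ d $ j) * E a b (E c d f) g))
      = (\<Sum>c\<in>UNIV. if b = c then \<Sum>d\<in>UNIV. of_real (k $ a $ i * k $ d $ j) * E a b (E c d f) g else 0)"
      by (intro sum.cong) auto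
    then show "(\<Sum>c\<in>UNIV. \<Sum>d\<in>UNIV. of_real (if b = c then 1 else 0) * (of_real (k $ a $ i * k $ d $ j) * E a b (E c d f) g))
      = (\<Sum>d\<in>UNIV. of_real (k $ a $ i * k $ d $ j) * E a b (E b d f) g)" by simp
  qed
  also have "\<dots> = (\<Sum>a\<in>UNIV. \<Sum>d\<in>UNIV. of_real (k $ a $ i * k $ d $ j) * (\<Sum>b\<in>UNIV. E a b (E b d f) g))"
    unfolding sum_distrib_left by (rule sum.cong[OF refl], rule sum.swap)
  also have "\<dots> = (\<Sum>a\<in>UNIV. \<Sum>b\<in>UNIV. of_real (k $ a $ i * k $ b $ j) * (c * E a b f g)) -
      (\<Sum>a\<in>UNIV. \<Sum>b\<in>UNIV. of_real (k $ a $ i * k $ b $ j) * (if a = b then d * f g else 0))"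
  proof -
    have "(\<Sum>m\<in>UNIV. E a m (E m b f) g) = c * E a b f g - (if a = b then d * f g else 0)" for a b
      using zero[of a b] by (simp add: quadratic_op_def algebra_simps)
    then show ?thesis by (simp add: right_diff_distrib sum_subtractf)
  qed
  also have "(\<Sum>a\<in>UNIV. \<Sum>b\<in>UNIV. of_real (k $ a $ i * k $ b $ j) * (c * E a b f g)) = c * E i j f (g ** k)"
    unfolding E_right_invariant[OF assms(1-4)] sum_distrib_left by (intro sum.cong refl) (simp add: mult_ac)
  also have "(\<Sum>a\<in>UNIV. \<Sum>b\<in>UNIV. of_real (k $ a $ i * k $ b $ j) * (if a = b then d * f g else 0)) =
      of_real (\<Sum>a\<in>UNIV. k $ a $ i * k $ a $ j) * (d * f g)"
    by (simp add: if_distrib[of "\<lambda>x. _ * x"] sum_distrib_right cong: if_cong)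
  also have "\<dots> = (if i = j then d * f (g ** k) else 0)"
    unfolding o' using assms by (simp add: right_invariant_def)
  finally show ?thesis by (simp add: quadratic_op_def)
qed

definition rotation :: "4 \<Rightarrow> 4 \<Rightarrow> real \<Rightarrow> mat4" where
  "rotation i j t = mat 1 + (cos t - 1) *\<^sub>R (munit i i + munit j j) + sin t *\<^sub>R (munit i j - munit j i)"

lemma rotation_O4:
  assumes "i \<noteq> j"
  shows "rotation i j t \<in> O4"
proof -
  have sc: "cos t * cos t + sin t * sin t = 1" "sin t * sin t + cos t * cos t = 1"
    using sin_cos_squared_add[of t] by (simp_all add: power2_eq_square)
  have "rotation i j t $ a \<bullet> rotation i j t $ b = (if a = b then 1 else 0)" for a b
    using exhaust_4[of i] exhaust_4[of j] exhaust_4[of a] exhaust_4[of b] assms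
    unfolding inner_vec_def sum_4 rotation_def
    by (elim disjE) (simp_all add: munit_def mat_def sc)
  then show ?thesis by (simp add: O4_def orthogonal_matrix_rows)
qed

text \<open>The matrix \<open>E\<^sub>i\<^sub>j - E\<^sub>j\<^sub>i\<close> is tangent to the rotations of the \<open>(i,j)\<close>-plane.\<close>
lemma E_symmetric:
  assumes f: "f \<in> Cinf_GL4" "right_invariant f"
  shows "E i j f = E j i f"
proof (cases "i = j")
  case False
  have "E i j f g = E j i f g" if g: "g \<in> GL4" for g
  proof -
    let ?X = "munit i j - munit j i"
    have d: "(rotation i j has_vector_derivative ?X) (at 0)"
      unfolding rotation_def[abs_def]
      by (auto intro!: derivative_eq_intros simp: has_real_derivative_iff_has_vector_derivative[symmetric])
    have r0: "rotation i j 0 = mat 1" by (simp add: rotation_def)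
    have "((\<lambda>t. g ** rotation i j t) has_vector_derivative g ** ?X) (at 0)"
      by (rule bounded_linear.has_vector_derivative[OF bl_mult_right d])
    then have "((\<lambda>t. f (g ** rotation i j t)) has_vector_derivative R_real ?X f (g ** rotation i j 0)) (at 0)"
      using g by (intro has_vector_derivative_along_curve f) (simp_all add: r0)
    moreover have "f (g ** rotation i j t) = f g" for t
      using f(2) g rotation_O4[OF False] by (simp add: right_invariant_def)
    ultimately have "((\<lambda>t. f g) has_vector_derivative R_real ?X f g) (at (0::real))"
      by (simp add: r0)
    then have "R_real ?X f g = 0"
      using vector_derivative_unique_at has_vector_derivative_const by blast
    then show ?thesis by (simp add: R_real_lin f)
  qed
  then show ?thesis by (auto simp: fun_eq_iff R_real_def)
qed simp

text \<open>After replacing \<open>E\<^sub>m\<^sub>j f\<close> by \<open>E\<^sub>j\<^sub>m f\<close>, the commutators of \<open>E\<^sub>i\<^sub>m\<close> and \<open>E\<^sub>j\<^sub>m\<close> add up to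
  \<open>E\<^sub>i\<^sub>j f - E\<^sub>j\<^sub>i f = 0\<close>.\<close>
lemma quadratic_op_symmetric:
  assumes f: "f \<in> Cinf_GL4" "right_invariant f"
  shows "quadratic_op c d i j f g = quadratic_op c d j i f g"
proof -
  note sym = E_symmetric[OF f]
  have "(\<Sum>m\<in>UNIV. E i m (E m j f) g) = (\<Sum>m\<in>UNIV. E i m (E j m f) g)"
    by (simp only: sym[of _ j])
  also have "\<dots> = (\<Sum>m\<in>UNIV. E j m (E i m f) g + (if m = j then E i m f g else 0) - (if m = i then E j m f g else 0))"
    by (subst E_commute[OF f(1)]) simp
  also have "\<dots> = (\<Sum>m\<in>UNIV. E j m (E i m f) g) + E i j f g - E j i f g"
    by (simp add: sum.distrib sum_subtractf)
  also have "\<dots> = (\<Sum>m\<in>UNIV. E j m (E m i f) g)"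
    by (simp only: sym[of i]) simp
  finally show ?thesis by (simp add: quadratic_op_def sym[of i j])
qed

section \<open>Radial parts\<close>

text \<open>Representatives of the double cosets of \<open>S\<close> and \<open>K\<close>.\<close>
definition pt :: "real \<Rightarrow> real ^ 4 \<Rightarrow> mat4" where
  "pt u a = mexp (u *\<^sub>R munit 3 2) ** diag a"

lemma unipotent_32: "mexp (u *\<^sub>R munit 3 2) = mat 1 + u *\<^sub>R munit 3 2"
proof -
  have N: "u *\<^sub>R munit 3 2 \<in> nilp"
    unfolding nilp_def by (intro span_scale span_base) simp
  have "u *\<^sub>R munit 3 2 ** u *\<^sub>R munit 3 2 = (0::mat4)"
    by (simp add: vec_eq_iff forall_4 matrix_matrix_mult_def sum_4 munit_def)
  moreover have "(0::mat4) ** A = 0" for A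
    by (simp add: vec_eq_iff matrix_matrix_mult_def)
  ultimately have "mexp (u *\<^sub>R munit 3 2) $ i $ j = (mat 1 + u *\<^sub>R munit 3 2) $ i $ j" for i j
    unfolding mexp_nilp[OF N] by simp
  then show ?thesis by (simp add: vec_eq_iff)
qed

lemma pt_entries: "pt u a $ i $ j = (if i = j then a $ i else if i = 3 \<and> j = 2 then u * a $ 2 else 0)"
  using exhaust_4[of i] exhaust_4[of j] unfolding pt_def unipotent_32 matrix_matrix_mult_def vec_lambda_beta sum_4
  by (elim disjE) (simp_all add: diag_def mat_def munit_def)

lemma pt_GL4:
  assumes "\<forall>i. 0 < a $ i"
  shows "pt u a \<in> GL4"
proof -
  have d: "diag a \<in> GL4"
  proof -
    have "a $ i \<noteq> 0" for i using assms by (metis less_irrefl)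
    then have "diag a ** diag (\<chi> i. 1 / a $ i) = mat 1" "diag (\<chi> i. 1 / a $ i) ** diag a = mat 1"
      by (simp_all add: vec_eq_iff diag_mult_row forall_4) (simp_all add: diag_def mat_def)
    then show ?thesis unfolding GL4_def invertible_def by blast
  qed
  have "(mat 1 + v *\<^sub>R munit 3 2) ** (mat 1 + (- v) *\<^sub>R munit 3 2) = (mat 1 :: mat4)" for v :: real
    by (simp add: vec_eq_iff forall_4 matrix_matrix_mult_def sum_4 munit_def mat_def)
  from this[of u] this[of "- u"] have "mexp (u *\<^sub>R munit 3 2) \<in> GL4"
    unfolding GL4_def invertible_def unipotent_32 by (auto intro!: exI[of _ "mat 1 + (- u) *\<^sub>R munit 3 2"])
  then show ?thesis unfolding pt_def using d by (rule GL4_mult)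
qed

abbreviation (input) char_II :: "mat4 \<Rightarrow> complex" where
  "char_II \<equiv> character (lform 0 0 0 1 0 1)"

lemma char_II_mexp: "Y \<in> nilp \<Longrightarrow> char_II (mexp Y) = exp (2 * of_real pi * \<i> * of_real (Y $ 2 $ 1 + Y $ 4 $ 3))"
  by (simp add: character_mexp lform_def)

text \<open>The curve \<open>exp (t Y) g\<close> has velocity \<open>Y g = g X\<close>, and along it \<open>F\<close> is multiplied by the
  character.\<close>
lemma R_real_character:
  assumes F: "F \<in> Cinf_GL4" "left_equivariant char_II F" and g: "g \<in> GL4"
    and Y: "Y \<in> S_span" "g ** X = Y ** g"
  shows "R_real X F g = 2 * of_real pi * \<i> * of_real (Y $ 2 $ 1 + Y $ 4 $ 3) * F g"
proof -
  let ?c = "\<lambda>t. mexp (t *\<^sub>R Y) ** g"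
  let ?l = "2 * of_real pi * \<i> * of_real (Y $ 2 $ 1 + Y $ 4 $ 3)"
  have "(?c has_vector_derivative Y ** g) (at 0)"
    by (rule bounded_linear.has_vector_derivative[OF bl_mult_left mexp_has_derivative_0])
  then have "((\<lambda>t. F (?c t)) has_vector_derivative R_real X F (?c 0)) (at 0)"
    using g Y by (intro has_vector_derivative_along_curve F) simp_all
  moreover have "F (?c t) = exp (?l * of_real t) * F g" for t
  proof -
    have "t *\<^sub>R Y \<in> S_span" using Y by (simp add: span_scale)
    then have "F (?c t) = char_II (mexp (t *\<^sub>R Y)) * F g"
      using F(2) g S_II_GL4 unfolding left_equivariant_def S_II_def by blast
    moreover have "t *\<^sub>R Y \<in> nilp" using \<open>t *\<^sub>R Y \<in> S_span\<close> S_span_nilp by blast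
    ultimately show ?thesis by (simp add: char_II_mexp algebra_simps)
  qed
  moreover have "((\<lambda>t::real. exp (?l * of_real t) * F g) has_vector_derivative ?l * F g) (at 0)"
    by (rule has_vector_derivative_real_field[of "\<lambda>z. exp (?l * z) * F g"]) (auto intro!: derivative_eq_intros)
  ultimately show ?thesis
    by (auto dest: vector_derivative_unique_at)
qed

context
  fixes F :: "mat4 \<Rightarrow> complex" and a :: "real ^ 4" and u :: real
  assumes F: "F \<in> Cinf_GL4" "left_equivariant char_II F" and a: "\<forall>i. 0 < a $ i"
begin

text \<open>Conjugation by \<open>exp(u E\<^sub>3\<^sub>2) a\<close> sends \<open>E\<^sub>2\<^sub>1\<close> to \<open>(a\<^sub>2/a\<^sub>1)(E\<^sub>2\<^sub>1 + u E\<^sub>3\<^sub>1)\<close> and \<open>E\<^sub>4\<^sub>3\<close> to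
  \<open>(a\<^sub>4/a\<^sub>3)(E\<^sub>4\<^sub>3 - u E\<^sub>4\<^sub>2)\<close>, and it rescales \<open>E\<^sub>3\<^sub>1\<close>, \<open>E\<^sub>4\<^sub>2\<close>, \<open>E\<^sub>4\<^sub>1\<close>. The character only sees the
  coefficients of \<open>E\<^sub>2\<^sub>1\<close> and \<open>E\<^sub>4\<^sub>3\<close>.\<close>
lemma E_nilpotent:
  "E 2 1 F (pt u a) = 2 * of_real pi * \<i> * of_real (a $ 2 / a $ 1) * F (pt u a)"
  "E 4 3 F (pt u a) = 2 * of_real pi * \<i> * of_real (a $ 4 / a $ 3) * F (pt u a)"
  "E 3 1 F (pt u a) = 0" "E 4 2 F (pt u a) = 0" "E 4 1 F (pt u a) = 0"
proof -
  note g = pt_GL4[OF a, of u]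
  have nz: "a $ i \<noteq> 0" for i using a by (metis less_irrefl)
  have R: "R_real X F (pt u a) = 2 * of_real pi * \<i> * of_real (Y $ 2 $ 1 + Y $ 4 $ 3) * F (pt u a)"
    if "Y \<in> S_span" "\<And>i j. (pt u a ** X) $ i $ j = (Y ** pt u a) $ i $ j" for X Y
    using that by (intro R_real_character F g) (simp_all add: vec_eq_iff)
  note e = forall_4 matrix_matrix_mult_def sum_4 pt_entries munit_def nz
  have "\<forall>i j. (pt u a ** munit 2 1) $ i $ j = ((a $ 2 / a $ 1) *\<^sub>R (munit 2 1 + u *\<^sub>R munit 3 1) ** pt u a) $ i $ j"
    by (simp add: e)
  from R[OF _ this[rule_format]] show "E 2 1 F (pt u a) = 2 * of_real pi * \<i> * of_real (a $ 2 / a $ 1) * F (pt u a)"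
    by (simp add: span_scale span_add span_base) (simp add: munit_def)
  have "\<forall>i j. (pt u a ** munit 4 3) $ i $ j = ((a $ 4 / a $ 3) *\<^sub>R (munit 4 3 + (- u) *\<^sub>R munit 4 2) ** pt u a) $ i $ j"
    by (simp add: e)
  from R[OF _ this[rule_format]] show "E 4 3 F (pt u a) = 2 * of_real pi * \<i> * of_real (a $ 4 / a $ 3) * F (pt u a)"
    by (simp add: span_scale span_add span_diff span_base) (simp add: munit_def)
  have "\<forall>i j. (pt u a ** munit 3 1) $ i $ j = ((a $ 3 / a $ 1) *\<^sub>R munit 3 1 ** pt u a) $ i $ j"
    by (simp add: e)
  from R[OF _ this[rule_format]] show "E 3 1 F (pt u a) = 0"
    by (simp add: span_scale span_add span_base) (simp add: munit_def)
  have "\<forall>i j. (pt u a ** munit 4 2) $ i $ j = ((a $ 4 / a $ 2) *\<^sub>R munit 4 2 ** pt u a) $ i $ j"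
    by (simp add: e)
  from R[OF _ this[rule_format]] show "E 4 2 F (pt u a) = 0"
    by (simp add: span_scale span_add span_base) (simp add: munit_def)
  have "\<forall>i j. (pt u a ** munit 4 1) $ i $ j = ((a $ 4 / a $ 1) *\<^sub>R munit 4 1 ** pt u a) $ i $ j"
    by (simp add: e)
  from R[OF _ this[rule_format]] show "E 4 1 F (pt u a) = 0"
    by (simp add: span_scale span_add span_base) (simp add: munit_def)
qed

lemma E_32_derivative: "((\<lambda>u. F (pt u a)) has_vector_derivative of_real (a $ 2 / a $ 3) * E 3 2 F (pt u a)) (at u)"
proof -
  have nz: "a $ i \<noteq> 0" for i using a by (metis less_irrefl)
  have eq: "munit 3 2 ** diag a = pt u a ** ((a $ 2 / a $ 3) *\<^sub>R munit 3 2)"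
    by (simp add: vec_eq_iff forall_4 matrix_matrix_mult_def sum_4 pt_entries munit_def nz diag_def)
  have "((\<lambda>u. mat 1 + u *\<^sub>R munit 3 2) has_vector_derivative (munit 3 2 :: mat4)) (at u)"
    by (auto intro!: derivative_eq_intros)
  from bounded_linear.has_vector_derivative[OF bl_mult_left this]
  have "((\<lambda>u. pt u a) has_vector_derivative munit 3 2 ** diag a) (at u)"
    unfolding pt_def unipotent_32 .
  from has_vector_derivative_along_curve[OF F(1) pt_GL4[OF a] this[unfolded eq]]
  show ?thesis by (simp add: R_real_lin F)
qed

end

lemma E_diagonal_derivative:
  assumes F: "F \<in> Cinf_GL4" and a: "\<forall>i. 0 < a t $ i" and d: "\<And>i. ((\<lambda>t. a t $ i) has_real_derivative a' i) (at t)"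
  shows "((\<lambda>t. F (pt u (a t))) has_vector_derivative (\<Sum>i\<in>UNIV. of_real (a' i / a t $ i) * E i i F (pt u (a t)))) (at t)"
proof -
  let ?X = "\<Sum>i\<in>UNIV. (a' i / a t $ i) *\<^sub>R munit i i :: mat4"
  have nz: "a t $ i \<noteq> 0" for i using a by (metis less_irrefl)
  have bl: "bounded_linear (\<lambda>x::real. x *\<^sub>R A)" for A :: mat4 by (rule bounded_linear_scaleR_left)
  have pt_eq: "pt u b = (\<Sum>i\<in>UNIV. (b $ i) *\<^sub>R (mexp (u *\<^sub>R munit 3 2) ** munit i i))" for b
  proof -
    have "diag b = (\<Sum>i\<in>UNIV. (b $ i) *\<^sub>R munit i i)"
      by (simp add: vec_eq_iff forall_4 sum_4 diag_def munit_def)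
    moreover have "A ** (\<Sum>i\<in>UNIV. (b $ i) *\<^sub>R munit i i) = (\<Sum>i\<in>UNIV. (b $ i) *\<^sub>R (A ** munit i i))" for A :: mat4
      by (simp only: linear_sum[OF bounded_linear.linear[OF bl_mult_right]]
          linear_cmul[OF bounded_linear.linear[OF bl_mult_right]])
    ultimately show ?thesis by (simp only: pt_def)
  qed
  have "((\<lambda>t. pt u (a t)) has_vector_derivative (\<Sum>i\<in>UNIV. a' i *\<^sub>R (mexp (u *\<^sub>R munit 3 2) ** munit i i))) (at t)"
    unfolding pt_eq
    by (intro has_vector_derivative_sum bounded_linear.has_vector_derivative[OF bl])
      (simp add: d has_real_derivative_iff_has_vector_derivative[symmetric])
  also have "(\<Sum>i\<in>UNIV. a' i *\<^sub>R (mexp (u *\<^sub>R munit 3 2) ** munit i i)) = pt u (\<chi> i. a' i)"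
    by (simp add: pt_eq)
  also have "\<dots> = pt u (a t) ** ?X"
    by (simp add: vec_eq_iff forall_4 matrix_matrix_mult_def sum_4 pt_entries munit_def nz)
  finally have "((\<lambda>t. pt u (a t)) has_vector_derivative pt u (a t) ** ?X) (at t)" .
  from has_vector_derivative_along_curve[OF F pt_GL4[OF a] this]
  show ?thesis by (simp add: R_real_lin R_real_sum F)
qed

text \<open>An upper triangular \<open>E\<^sub>i\<^sub>j\<close> next to \<open>f\<close> is replaced by \<open>E\<^sub>j\<^sub>i\<close>. Commutators then move \<open>E\<^sub>2\<^sub>1\<close>, \<open>E\<^sub>4\<^sub>3\<close>,
  \<open>E\<^sub>3\<^sub>1\<close>, \<open>E\<^sub>4\<^sub>2\<close>, \<open>E\<^sub>4\<^sub>1\<close> to the left, where they are the scalars \<open>p\<close>, \<open>q\<close>, \<open>0\<close>, \<open>0\<close>, \<open>0\<close>.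
  The entries above the diagonal are given by \<open>quadratic_op_symmetric\<close>.\<close>
lemma radial_parts:
  fixes a :: "real ^ 4" and u :: real
  assumes f: "f \<in> Cinf_GL4" "left_equivariant char_II f" "right_invariant f" and a: "\<forall>i. 0 < a $ i"
  defines "p \<equiv> 2 * of_real pi * \<i> * of_real (a $ 2 / a $ 1)" and "q \<equiv> 2 * of_real pi * \<i> * of_real (a $ 4 / a $ 3)"
    and "g \<equiv> pt u a"
  shows "quadratic_op c d 1 1 f g = E 1 1 (E 1 1 f) g + 3 * E 1 1 f g - E 2 2 f g - E 3 3 f g - E 4 4 f g
      - c * E 1 1 f g + (p\<^sup>2 + d) * f g"
    and "quadratic_op c d 2 2 f g = E 2 2 (E 2 2 f) g + E 3 2 (E 3 2 f) g + 2 * E 2 2 f g - E 3 3 f g - E 4 4 f g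
      - c * E 2 2 f g + (p\<^sup>2 + d) * f g"
    and "quadratic_op c d 3 3 f g = E 3 3 (E 3 3 f) g + E 3 2 (E 3 2 f) g + E 3 3 f g - E 4 4 f g
      - c * E 3 3 f g + (q\<^sup>2 + d) * f g"
    and "quadratic_op c d 4 4 f g = E 4 4 (E 4 4 f) g - c * E 4 4 f g + (q\<^sup>2 + d) * f g"
    and "quadratic_op c d 2 1 f g = p * (E 1 1 f g + E 2 2 f g + (3 - c) * f g)"
    and "quadratic_op c d 4 3 f g = q * (E 3 3 f g + E 4 4 f g + (1 - c) * f g)"
    and "quadratic_op c d 3 1 f g = p * E 3 2 f g"
    and "quadratic_op c d 4 2 f g = q * E 3 2 f g"
    and "quadratic_op c d 4 1 f g = 0"
    and "quadratic_op c d 3 2 f g = E 3 2 (E 2 2 f) g + E 3 2 (E 3 3 f) g + (2 - c) * E 3 2 f g"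
proof -
  have F: "E i j f \<in> Cinf_GL4" "left_equivariant char_II (E i j f)" for i j
    by (simp_all add: R_real_Cinf left_equivariant_R_real f)
  note nil = E_nilpotent[OF f(1,2) a, of u, folded p_def q_def g_def]
  note nil' = E_nilpotent[OF F a, where u=u, folded p_def q_def g_def]
  note sym = E_symmetric[OF f(1,3)]
  have s: "E 1 2 f = E 2 1 f" "E 1 3 f = E 3 1 f" "E 1 4 f = E 4 1 f" "E 2 3 f = E 3 2 f" "E 2 4 f = E 4 2 f" "E 3 4 f = E 4 3 f"
    by (rule sym)+
  note C = E_commute[OF f(1)]
  note cs = C[of 1 2 2 1 g] C[of 1 3 3 1 g] C[of 1 4 4 1 g] C[of 2 3 3 2 g] C[of 2 4 4 2 g] C[of 3 4 4 3 g]
    C[of 2 2 2 1 g] C[of 2 3 3 1 g] C[of 2 4 4 1 g] C[of 3 2 2 1 g] C[of 3 3 3 1 g] C[of 3 4 4 1 g]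
    C[of 3 3 3 2 g] C[of 3 4 4 2 g] C[of 4 4 4 1 g] C[of 4 4 4 2 g] C[of 4 4 4 3 g]
  note S = quadratic_op_def sum_4 s cs nil nil'
  show "quadratic_op c d 1 1 f g = E 1 1 (E 1 1 f) g + 3 * E 1 1 f g - E 2 2 f g - E 3 3 f g - E 4 4 f g
      - c * E 1 1 f g + (p\<^sup>2 + d) * f g"
    by (simp add: S) (simp add: algebra_simps power2_eq_square)
  show "quadratic_op c d 2 2 f g = E 2 2 (E 2 2 f) g + E 3 2 (E 3 2 f) g + 2 * E 2 2 f g - E 3 3 f g - E 4 4 f g
      - c * E 2 2 f g + (p\<^sup>2 + d) * f g"
    by (simp add: S) (simp add: algebra_simps power2_eq_square)
  show "quadratic_op c d 3 3 f g = E 3 3 (E 3 3 f) g + E 3 2 (E 3 2 f) g + E 3 3 f g - E 4 4 f g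
      - c * E 3 3 f g + (q\<^sup>2 + d) * f g"
    by (simp add: S) (simp add: algebra_simps power2_eq_square)
  show "quadratic_op c d 4 4 f g = E 4 4 (E 4 4 f) g - c * E 4 4 f g + (q\<^sup>2 + d) * f g"
    by (simp add: S) (simp add: algebra_simps power2_eq_square)
  show "quadratic_op c d 2 1 f g = p * (E 1 1 f g + E 2 2 f g + (3 - c) * f g)"
    by (simp add: S) (simp add: algebra_simps)
  show "quadratic_op c d 4 3 f g = q * (E 3 3 f g + E 4 4 f g + (1 - c) * f g)"
    by (simp add: S) (simp add: algebra_simps)
  show "quadratic_op c d 3 1 f g = p * E 3 2 f g"
    by (simp add: S)
  show "quadratic_op c d 4 2 f g = q * E 3 2 f g"
    by (simp add: S)
  show "quadratic_op c d 4 1 f g = 0"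
    by (simp add: S)
  show "quadratic_op c d 3 2 f g = E 3 2 (E 2 2 f) g + E 3 2 (E 3 3 f) g + (2 - c) * E 3 2 f g"
    by (simp add: S) (simp add: algebra_simps)
qed

lemma O4_one: "mat 1 \<in> O4"
  by (simp add: O4_def orthogonal_matrix_def)

lemma Cinf_chi_iff:
  "f \<in> Cinf_chi char_II I \<longleftrightarrow> f \<in> Cinf_GL4 \<and> left_equivariant char_II f \<and> right_invariant f \<and> (\<forall>X\<in>I. \<forall>g\<in>GL4. R_U X f g = 0)"
proof -
  have "(0::mat4) \<in> S_span" by (rule span_zero)
  then have 0: "mat 1 \<in> S_II" "(0::mat4) \<in> nilp" using S_span_nilp unfolding S_II_def by (auto intro!: image_eqI[of _ mexp 0])
  have ch1: "char_II (mat 1) = 1" using char_II_mexp[OF 0(2)] by simp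
  have "(\<forall>s\<in>S_II. \<forall>g\<in>GL4. \<forall>k\<in>O4. f (s ** g ** k) = char_II s * f g) \<longleftrightarrow> left_equivariant char_II f \<and> right_invariant f"
  proof (intro iffI conjI)
    assume *: "\<forall>s\<in>S_II. \<forall>g\<in>GL4. \<forall>k\<in>O4. f (s ** g ** k) = char_II s * f g"
    show "left_equivariant char_II f"
      unfolding left_equivariant_def using * O4_one by (metis matrix_mul_rid)
    show "right_invariant f"
      unfolding right_invariant_def using *[rule_format, OF 0(1)] by (simp add: ch1)
  next
    assume *: "left_equivariant char_II f \<and> right_invariant f"
    show "\<forall>s\<in>S_II. \<forall>g\<in>GL4. \<forall>k\<in>O4. f (s ** g ** k) = char_II s * f g"
    proof (intro ballI)
      fix s g k assume "s \<in> S_II" "g \<in> GL4" "k \<in> O4"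
      then show "f (s ** g ** k) = char_II s * f g"
        using * by (simp add: left_equivariant_def right_invariant_def S_II_GL4 GL4_mult)
    qed
  qed
  then show ?thesis by (auto simp: Cinf_chi_def)
qed

lemma Xi_II_pt: "Xi_II f (u, a) = (if \<forall>i. 0 < a $ i then f (pt u a) else 0)"
  by (simp add: Xi_II_def pt_def)

lemma Cinf_zero_in_Cinf_chi: "(\<lambda>g. 0) \<in> Cinf_chi char_II I"
  by (simp add: Cinf_chi_iff Cinf_zero left_equivariant_def right_invariant_def R_U_zero_arg)

section \<open>Necessary conditions\<close>

context
  fixes f :: "mat4 \<Rightarrow> complex" and k :: nat and l1 l2 :: complex
  assumes f: "f \<in> Cinf_chi char_II (I_ideal k l1 l2)"
begin

lemma solution_properties: "f \<in> Cinf_GL4" "left_equivariant char_II f" "right_invariant f"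
    "g \<in> GL4 \<Longrightarrow> quadratic_op (l1 + l2 + of_nat k) (l1 * (l2 + of_nat k)) i j f g = 0"
    "g \<in> GL4 \<Longrightarrow> (\<Sum>i\<in>UNIV. E i i f g) = (of_nat k * l1 + (4 - of_nat k) * l2) * f g"
  using f ideal_annihilates_iff[of f k l1 l2] unfolding Cinf_chi_iff by blast+

context
  fixes a :: "real ^ 4"
  assumes a: "\<forall>i. 0 < a $ i"
begin

text \<open>The entries \<open>(2,1)\<close>, \<open>(4,3)\<close> and \<open>(3,1)\<close>, divided by the nonzero numbers \<open>p\<close> and \<open>q\<close>.\<close>
lemma first_order_equations:
  "E 1 1 f (pt u a) + E 2 2 f (pt u a) = (l1 + l2 + of_nat k - 3) * f (pt u a)"
  "E 3 3 f (pt u a) + E 4 4 f (pt u a) = (l1 + l2 + of_nat k - 1) * f (pt u a)"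
  "E 3 2 f (pt u a) = 0"
proof -
  have "a $ i > 0" for i using a by simp
  then have nz: "a $ i \<noteq> 0" for i by (metis less_irrefl)
  note q = solution_properties(4)[OF pt_GL4[OF a, of u]]
  note r = radial_parts[OF solution_properties(1-3) a, where u=u]
  show "E 1 1 f (pt u a) + E 2 2 f (pt u a) = (l1 + l2 + of_nat k - 3) * f (pt u a)"
  proof -
    have "E 1 1 f (pt u a) + E 2 2 f (pt u a) + (3 - (l1 + l2 + of_nat k)) * f (pt u a) = 0"
      using q[of 2 1] unfolding r mult_eq_0_iff using nz by simp
    then show ?thesis by algebra
  qed
  show "E 3 3 f (pt u a) + E 4 4 f (pt u a) = (l1 + l2 + of_nat k - 1) * f (pt u a)"
  proof -
    have "E 3 3 f (pt u a) + E 4 4 f (pt u a) + (1 - (l1 + l2 + of_nat k)) * f (pt u a) = 0"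
      using q[of 4 3] unfolding r mult_eq_0_iff using nz by simp
    then show ?thesis by algebra
  qed
  show "E 3 2 f (pt u a) = 0"
    using q[of 3 1] unfolding r using nz by simp
qed

lemma second_order_equations:
  "E 1 1 (E 1 1 f) (pt u a) + 3 * E 1 1 f (pt u a) - E 2 2 f (pt u a) - E 3 3 f (pt u a) - E 4 4 f (pt u a)
      - (l1 + l2 + of_nat k) * E 1 1 f (pt u a)
      + (l1 * (l2 + of_nat k) - of_real ((2 * pi * (a $ 2 / a $ 1))\<^sup>2)) * f (pt u a) = 0"
  "E 4 4 (E 4 4 f) (pt u a) - (l1 + l2 + of_nat k) * E 4 4 f (pt u a)
      + (l1 * (l2 + of_nat k) - of_real ((2 * pi * (a $ 4 / a $ 3))\<^sup>2)) * f (pt u a) = 0"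
proof -
  note q = solution_properties(4)[OF pt_GL4[OF a, of u]]
  note r = radial_parts[OF solution_properties(1-3) a, where u=u]
  have sq: "(2 * of_real pi * \<i> * of_real x)\<^sup>2 = - of_real ((2 * pi * x)\<^sup>2)" for x
    by (simp add: power_mult_distrib)
  show "E 1 1 (E 1 1 f) (pt u a) + 3 * E 1 1 f (pt u a) - E 2 2 f (pt u a) - E 3 3 f (pt u a) - E 4 4 f (pt u a)
      - (l1 + l2 + of_nat k) * E 1 1 f (pt u a)
      + (l1 * (l2 + of_nat k) - of_real ((2 * pi * (a $ 2 / a $ 1))\<^sup>2)) * f (pt u a) = 0"
    using q[of 1 1] unfolding r sq by (simp only: uminus_add_conv_diff)
  show "E 4 4 (E 4 4 f) (pt u a) - (l1 + l2 + of_nat k) * E 4 4 f (pt u a)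
      + (l1 * (l2 + of_nat k) - of_real ((2 * pi * (a $ 4 / a $ 3))\<^sup>2)) * f (pt u a) = 0"
    using q[of 4 4] unfolding r sq by (simp only: uminus_add_conv_diff)
qed

lemma independent_of_u: "f (pt u a) = f (pt 0 a)"
proof -
  have "((\<lambda>u. f (pt u a)) has_vector_derivative 0) (at u within UNIV)" for u
    using E_32_derivative[OF solution_properties(1,2) a, of u] first_order_equations(3)[of u] by simp
  then obtain c where "\<And>u. f (pt u a) = c"
    using has_vector_derivative_zero_constant[of UNIV "\<lambda>u. f (pt u a)"] by auto
  then show ?thesis by simp
qed

text \<open>The two degrees of homogeneity add up to \<open>2 (\<lambda>\<^sub>1 + \<lambda>\<^sub>2) - 2\<close>, whereas the trace acts by
  \<open>\<lambda>\<^sub>1 + 3 \<lambda>\<^sub>2\<close>.\<close>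
lemma vanishes_unless_shift:
  assumes "k = 1" "l1 - l2 \<noteq> 2"
  shows "f (pt u a) = 0"
proof -
  have "E 1 1 f (pt u a) + E 2 2 f (pt u a) = (l1 + l2 - 2) * f (pt u a)"
    "E 3 3 f (pt u a) + E 4 4 f (pt u a) = (l1 + l2) * f (pt u a)"
    "E 1 1 f (pt u a) + E 2 2 f (pt u a) + E 3 3 f (pt u a) + E 4 4 f (pt u a) = (l1 + 3 * l2) * f (pt u a)"
    using first_order_equations(1,2)[of u] solution_properties(5)[OF pt_GL4[OF a, of u]] assms(1)
    unfolding sum_4 by simp_all
  then have "(l1 - l2 - 2) * f (pt u a) = 0" by algebra
  then show ?thesis using assms(2) by auto
qed

end

end

text \<open>At the points \<open>pt u a\<close> the operator \<open>E\<^sub>j\<^sub>j\<close> differentiates along \<open>A\<close>. So it may be applied to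
  relations that hold at these points only.\<close>
lemma vanishing_on_NA_diagonal:
  assumes G: "G \<in> Cinf_GL4" "\<And>a. \<forall>i. 0 < a $ i \<Longrightarrow> G (pt u a) = 0" and a: "\<forall>i. 0 < a $ i"
  shows "E j j G (pt u a) = 0"
proof -
  have ap: "0 < a $ i" for i using a by simp
  then have nz: "a $ i \<noteq> 0" for i by (metis less_irrefl)
  let ?c = "\<lambda>t::real. \<chi> i. if i = j then a $ i * t else a $ i"
  have c1: "?c 1 = a" by (simp add: vec_eq_iff)
  have "((\<lambda>t. G (pt u (?c t))) has_vector_derivative (\<Sum>i\<in>UNIV. of_real ((if i = j then a $ i else 0) / ?c 1 $ i) * E i i G (pt u (?c 1)))) (at 1)"
    by (rule E_diagonal_derivative[OF G(1)]) (use ap in \<open>auto intro!: derivative_eq_intros\<close>)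
  moreover have "(\<Sum>i\<in>UNIV. of_real ((if i = j then a $ i else 0) / ?c 1 $ i) * E i i G (pt u (?c 1))) =
     (\<Sum>i\<in>UNIV. if i = j then E i i G (pt u a) else 0)"
    unfolding c1 by (intro sum.cong refl) (simp add: nz)
  ultimately have "((\<lambda>t. G (pt u (?c t))) has_vector_derivative E j j G (pt u a)) (at 1)"
    by simp
  moreover have "((\<lambda>t. G (pt u (?c t))) has_vector_derivative 0) (at 1)"
  proof (rule has_vector_derivative_transform_within_open[of "\<lambda>t. 0" _ _ "{0<..}"])
    fix t :: real assume "t \<in> {0<..}"
    then have "\<forall>i. 0 < ?c t $ i" using ap by simp
    then show "0 = G (pt u (?c t))" by (rule G(2)[symmetric])
  qed auto
  ultimately show ?thesis by (rule vector_derivative_unique_at)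
qed

lemma E_diagonal_lincomb_on_NA:
  assumes F: "F \<in> Cinf_GL4" "F' \<in> Cinf_GL4" "G \<in> Cinf_GL4"
    and eq: "\<And>a. \<forall>i. 0 < a $ i \<Longrightarrow> F (pt u a) + F' (pt u a) = c * G (pt u a)" and a: "\<forall>i. 0 < a $ i"
  shows "E j j F (pt u a) + E j j F' (pt u a) = c * E j j G (pt u a)"
proof -
  have C: "(\<lambda>g. F g + F' g) \<in> Cinf_GL4" "(\<lambda>g. - c * G g) \<in> Cinf_GL4" by (intro Cinf_add Cinf_cmult F)+
  have "E j j (\<lambda>g. (F g + F' g) + - c * G g) (pt u a) = 0"
    by (rule vanishing_on_NA_diagonal[OF Cinf_add[OF C] _ a]) (use eq in auto)
  then show ?thesis
    by (simp only: R_real_add[OF C] R_real_add[OF F(1,2)] R_real_cmult[OF F(3)]) simp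
qed

lemma homogeneous_ode:
  assumes "\<And>t. t > 0 \<Longrightarrow> (h has_vector_derivative m / of_real t * h t) (at t)" and t: "t > 0"
  shows "h t = of_real t powr m * (h 1 :: complex)"
proof -
  have pw: "((\<lambda>t. of_real t powr - m) has_vector_derivative (- m) * of_real t powr (- m - 1)) (at t)" if "t > 0" for t :: real
    using has_vector_derivative_real_field[OF has_field_derivative_powr, of t "- m"] that by (simp add: complex_nonpos_Reals_iff)
  have d0: "((\<lambda>t. of_real t powr - m * h t) has_vector_derivative 0) (at t within {0<..})"
    if "t \<in> {0<..}" for t
  proof -
    have t: "t > 0" using that by simp
    show ?thesis
      by (rule has_vector_derivative_at_within,
          rule has_vector_derivative_eq_rhs[OF has_vector_derivative_mult[OF pw[OF t] assms(1)[OF t]]])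
        (use t in \<open>simp add: powr_diff\<close>)
  qed
  obtain c where c: "\<And>t. t > 0 \<Longrightarrow> of_real t powr - m * h t = c"
    by (rule has_vector_derivative_zero_constant[OF _ d0]) auto
  have "of_real t powr m * (of_real t powr - m * h t) = h t" using t by (simp add: powr_minus)
  then show ?thesis using c[OF t] c[of 1] by simp
qed

text \<open>In both lemmas the Bessel equation has the form \<open>(\<theta> - 1/2)\<^sup>2 h = (\<nu>\<^sup>2 + (2 \<pi> y)\<^sup>2) h\<close> with \<open>\<theta> = y d/dy\<close>.\<close>

lemma bessel_pair_of_radial:
  assumes d: "\<And>y. y > 0 \<Longrightarrow> (h has_vector_derivative h1 y / of_real y) (at y)"
      "\<And>y. y > 0 \<Longrightarrow> (h1 has_vector_derivative h2 y / of_real y) (at y)"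
    and eq: "\<And>y. y > 0 \<Longrightarrow> h2 y - h1 y + h y / 4 = (\<nu>\<^sup>2 + of_real ((2 * pi * y)\<^sup>2)) * h y"
  shows "bessel_pair \<nu> (\<lambda>Y. of_real ((Y / (2 * pi)) powr (- 1/2)) * h (Y / (2 * pi)))
           (\<lambda>Y. of_real ((Y / (2 * pi)) powr (- 1/2)) * (h1 (Y / (2 * pi)) - h (Y / (2 * pi)) / 2))"
  unfolding bessel_pair_def
proof (intro allI impI)
  fix Y :: real assume Y: "Y > 0"
  define y where "y = Y / (2 * pi)"
  have y: "y > 0" "Y = 2 * pi * y" using Y by (simp_all add: y_def)
  have sc: "((\<lambda>Y. Y / (2 * pi)) has_vector_derivative 1 / (2 * pi)) (at Y)"
    by (auto intro!: derivative_eq_intros simp: has_real_derivative_iff_has_vector_derivative[symmetric])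
  have chain: "((\<lambda>Y. k (Y / (2 * pi))) has_vector_derivative (1 / (2 * pi)) *\<^sub>R k') (at Y)"
    if "(k has_vector_derivative k') (at y)" for k :: "real \<Rightarrow> complex" and k'
    using vector_diff_chain_at[OF sc, of k k'] that by (simp add: y_def o_def)
  have pw: "((\<lambda>y. of_real (y powr (- 1/2)) :: complex) has_vector_derivative - 1/2 * of_real (y powr (- 1/2)) / of_real y) (at y)"
  proof -
    have "((\<lambda>y. y powr (- 1/2)) has_real_derivative - 1/2 * y powr (- 1/2 - 1)) (at y)"
      by (rule has_real_derivative_powr[OF y(1)])
    moreover have "y powr (- 1/2 - 1) = y powr (- 1/2) / y" using y by (subst powr_diff) simp
    ultimately have "((\<lambda>y. y powr (- 1/2)) has_real_derivative - 1/2 * (y powr (- 1/2) / y)) (at y)" by (simp only:)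
    from has_vector_derivative_of_real[OF this] show ?thesis
      by (rule has_vector_derivative_eq_rhs) simp
  qed
  let ?w = "of_real (y powr (- 1/2)) :: complex"
  have Yc: "complex_of_real Y = 2 * of_real pi * of_real y" by (simp add: y)
  have nz: "complex_of_real y \<noteq> 0" using y by simp
  have alg: "P * (F1 / c) + - 1/2 * P / c * F = P * (F1 - F / 2) / c"
    "P * (F2 / c - F1 / c / 2) + - 1/2 * P / c * (F1 - F / 2) = P * (F2 - F1 + F / 4) / c"
    if "c \<noteq> 0" for P F F1 F2 c :: complex
    using that by (simp_all add: field_simps)
  have "((\<lambda>y. of_real (y powr (- 1/2)) * h y) has_vector_derivative ?w * (h1 y - h y / 2) / of_real y) (at y)"
    by (rule has_vector_derivative_eq_rhs[OF has_vector_derivative_mult[OF pw d(1)[OF y(1)]] alg(1)[OF nz]])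
  from chain[OF this]
  have 1: "((\<lambda>Y. of_real ((Y / (2 * pi)) powr (- 1/2)) * h (Y / (2 * pi))) has_vector_derivative
      ?w * (h1 y - h y / 2) / of_real Y) (at Y)"
    unfolding Yc by (simp add: scaleR_conv_of_real)
  have "((\<lambda>y. of_real (y powr (- 1/2)) * (h1 y - h y / 2)) has_vector_derivative
      ?w * (h2 y - h1 y + h y / 4) / of_real y) (at y)"
    by (rule has_vector_derivative_eq_rhs[OF has_vector_derivative_mult[OF pw
          has_vector_derivative_diff[OF d(2)[OF y(1)] has_vector_derivative_divide[OF d(1)[OF y(1)]]]] alg(2)[OF nz]])
  from chain[OF this[unfolded eq[OF y(1)]]]
  have 2: "((\<lambda>Y. of_real ((Y / (2 * pi)) powr (- 1/2)) * (h1 (Y / (2 * pi)) - h (Y / (2 * pi)) / 2)) has_vector_derivative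
      (of_real (Y\<^sup>2) + \<nu>\<^sup>2) * (?w * h y) / of_real Y) (at Y)"
    unfolding Yc by (simp add: scaleR_conv_of_real y(2) mult_ac add_ac)
  show "((\<lambda>Y. of_real ((Y / (2 * pi)) powr (- 1/2)) * h (Y / (2 * pi))) has_vector_derivative
      of_real ((Y / (2 * pi)) powr (- 1/2)) * (h1 (Y / (2 * pi)) - h (Y / (2 * pi)) / 2) / of_real Y) (at Y) \<and>
    ((\<lambda>Y. of_real ((Y / (2 * pi)) powr (- 1/2)) * (h1 (Y / (2 * pi)) - h (Y / (2 * pi)) / 2)) has_vector_derivative
      (of_real (Y\<^sup>2) + \<nu>\<^sup>2) * (of_real ((Y / (2 * pi)) powr (- 1/2)) * h (Y / (2 * pi))) / of_real Y) (at Y)"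
    using 1 2 unfolding y_def by blast
qed

lemma radial_of_bessel_pair:
  assumes p: "bessel_pair \<nu> f f1" and y: "y > 0"
  defines "h \<equiv> \<lambda>y. of_real y powr (1/2) * f (2 * pi * y)"
    and "h1 \<equiv> \<lambda>y. of_real y powr (1/2) * (f (2 * pi * y) / 2 + f1 (2 * pi * y))"
  shows "(h has_vector_derivative h1 y / of_real y) (at y)"
    "(h1 has_vector_derivative (h1 y - h y / 4 + (\<nu>\<^sup>2 + of_real ((2 * pi * y)\<^sup>2)) * h y) / of_real y) (at y)"
proof -
  have sc: "((\<lambda>y. 2 * pi * y) has_vector_derivative 2 * pi) (at y)"
    by (auto intro!: derivative_eq_intros simp: has_real_derivative_iff_has_vector_derivative[symmetric])
  have chain: "((\<lambda>y. k (2 * pi * y)) has_vector_derivative of_real (2 * pi) * k') (at y)"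
    if "(k has_vector_derivative k') (at (2 * pi * y))" for k :: "real \<Rightarrow> complex" and k'
    using vector_diff_chain_at[OF sc, of k k'] that by (simp add: o_def scaleR_conv_of_real)
  have pw: "((\<lambda>y. of_real y powr (1/2 :: complex)) has_vector_derivative 1/2 * of_real y powr (1/2) / of_real y) (at y)"
  proof -
    have "complex_of_real y powr (1/2 - 1) = of_real y powr (1/2) / of_real y" using y by (subst powr_diff) simp
    then have "1/2 * complex_of_real y powr (1/2 - 1) = 1/2 * of_real y powr (1/2) / of_real y" by simp
    moreover have "complex_of_real y \<notin> \<real>\<^sub>\<le>\<^sub>0" using y by (simp add: complex_nonpos_Reals_iff)
    ultimately show ?thesis
      using has_vector_derivative_real_field[OF has_field_derivative_powr, of y "1/2"] by metis
  qed
  have Y: "2 * pi * y > 0" using y by simp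
  note d = bessel_pairD[OF p Y]
  have nz: "complex_of_real y \<noteq> 0" using y by simp
  have f: "((\<lambda>y. f (2 * pi * y)) has_vector_derivative f1 (2 * pi * y) / of_real y) (at y)"
    by (rule has_vector_derivative_eq_rhs[OF chain[OF d(1)]]) (use y in simp)
  have f1: "((\<lambda>y. f1 (2 * pi * y)) has_vector_derivative (of_real ((2 * pi * y)\<^sup>2) + \<nu>\<^sup>2) * f (2 * pi * y) / of_real y) (at y)"
    by (rule has_vector_derivative_eq_rhs[OF chain[OF d(2)]]) (use y in simp)
  have alg: "P * (F1 / c) + 1/2 * P / c * F = P * (F / 2 + F1) / c"
    "P * (F1 / c / 2 + (X + n) * F / c) + 1/2 * P / c * (F / 2 + F1) =
      (P * (F / 2 + F1) - P * F / 4 + (n + X) * (P * F)) / c" if "c \<noteq> 0" for P F F1 X n c :: complex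
    using that by (simp_all add: field_simps)
  show "(h has_vector_derivative h1 y / of_real y) (at y)"
    unfolding h_def h1_def
    by (rule has_vector_derivative_eq_rhs[OF has_vector_derivative_mult[OF pw f] alg(1)[OF nz]])
  show "(h1 has_vector_derivative (h1 y - h y / 4 + (\<nu>\<^sup>2 + of_real ((2 * pi * y)\<^sup>2)) * h y) / of_real y) (at y)"
    unfolding h_def h1_def
    by (rule has_vector_derivative_eq_rhs[OF has_vector_derivative_mult[OF pw
          has_vector_derivative_add[OF has_vector_derivative_divide[OF f] f1]] alg(2)[OF nz]])
qed

section \<open>Reduction to the Bessel equation\<close>

text \<open>The coordinates of \<open>A\<close> are \<open>s = sqrt x\<^sub>1\<close>, \<open>t = sqrt x\<^sub>3\<close>, \<open>y = x\<^sub>2\<close> and \<open>z = x\<^sub>4\<close>.\<close>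
definition chart :: "real \<Rightarrow> real \<Rightarrow> real \<Rightarrow> real \<Rightarrow> real ^ 4" where
  "chart s t y z = vector [s * y powr (- 1/2), s * y powr (1/2), t * z powr (- 1/2), t * z powr (1/2)]"

lemma chart_pos: "s > 0 \<Longrightarrow> t > 0 \<Longrightarrow> y > 0 \<Longrightarrow> z > 0 \<Longrightarrow> \<forall>i. 0 < chart s t y z $ i"
  by (simp add: forall_4 chart_def)

lemma chart_ratio:
  assumes "s > 0" "t > 0" "y > 0" "z > 0"
  shows "chart s t y z $ 2 / chart s t y z $ 1 = y" "chart s t y z $ 4 / chart s t y z $ 3 = z"
  using assms by (simp_all add: chart_def powr_minus_divide powr_half_sqrt flip: real_sqrt_mult)

lemma chart_of_x:
  assumes a: "\<forall>i. 0 < a $ i"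
  shows "a = chart (sqrt (a $ 1 * a $ 2)) (sqrt (a $ 3 * a $ 4)) (a $ 2 / a $ 1) (a $ 4 / a $ 3)"
proof -
  have *: "sqrt (p * q) * (q / p) powr (- 1/2) = p" "sqrt (p * q) * (q / p) powr (1/2) = q" if "p > 0" "q > 0" for p q
  proof -
    have "sqrt (p * q) * sqrt (p / q) = p" "sqrt (p * q) * sqrt (q / p) = q"
      using that by (simp_all add: real_sqrt_mult[symmetric] power2_eq_square[symmetric])
    moreover have "(q / p) powr (- 1/2) = sqrt (p / q)"
    proof -
      have "(q / p) powr (- 1/2) = 1 / (q / p) powr (1/2)" using powr_minus_divide[of "q / p" "1/2"] by simp
      then show ?thesis using that by (simp add: powr_half_sqrt real_sqrt_divide)
    qed
    ultimately show "sqrt (p * q) * (q / p) powr (- 1/2) = p" "sqrt (p * q) * (q / p) powr (1/2) = q"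
      using that by (simp_all add: powr_half_sqrt)
  qed
  show ?thesis using a by (simp only: vec_eq_iff forall_4 chart_def vector4 *)
qed

text \<open>Each of the four coordinates moves the \<open>a\<^sub>i\<close> by fixed weights.\<close>

lemma weighted_curve_derivative:
  assumes G: "G \<in> Cinf_GL4" and r: "r > 0" and pos: "\<forall>i. 0 < c r $ i"
    and w: "\<And>i. ((\<lambda>r. c r $ i) has_real_derivative w i * c r $ i / r) (at r)"
  shows "((\<lambda>r. G (pt u (c r))) has_vector_derivative (\<Sum>i\<in>UNIV. of_real (w i) * E i i G (pt u (c r))) / of_real r) (at r)"
proof -
  have "c r $ i > 0" for i using pos by simp
  then have nz: "c r $ i \<noteq> 0" for i by (metis less_irrefl)
  show ?thesis
    by (rule has_vector_derivative_eq_rhs[OF E_diagonal_derivative[OF G pos w]])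
      (use nz r in \<open>simp add: sum_divide_distrib\<close>)
qed

lemma chart_derivatives:
  assumes G: "G \<in> Cinf_GL4" and pos: "s > 0" "t > 0" "y > 0" "z > 0"
  shows "((\<lambda>s. G (pt u (chart s t y z))) has_vector_derivative
      (E 1 1 G (pt u (chart s t y z)) + E 2 2 G (pt u (chart s t y z))) / of_real s) (at s)"
    and "((\<lambda>t. G (pt u (chart s t y z))) has_vector_derivative
      (E 3 3 G (pt u (chart s t y z)) + E 4 4 G (pt u (chart s t y z))) / of_real t) (at t)"
    and "((\<lambda>y. G (pt u (chart s t y z))) has_vector_derivative
      (E 2 2 G (pt u (chart s t y z)) - E 1 1 G (pt u (chart s t y z))) / 2 / of_real y) (at y)"
    and "((\<lambda>z. G (pt u (chart s t y z))) has_vector_derivative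
      (E 4 4 G (pt u (chart s t y z)) - E 3 3 G (pt u (chart s t y z))) / 2 / of_real z) (at z)"
proof -
  have i: "i = 1 \<or> i = 2 \<or> i = 3 \<or> i = 4" for i :: 4 by (rule exhaust_4)
  note p = chart_pos[OF pos]
  have pw: "((\<lambda>y. y powr (- 1/2)) has_real_derivative - 1/2 * y powr (- 1/2) / y) (at y)"
      "((\<lambda>y. y powr (1/2)) has_real_derivative 1/2 * y powr (1/2) / y) (at y)" if "y > 0" for y :: real
  proof -
    have e: "y powr (c - 1) = y powr c / y" for c using that by (subst powr_diff) simp_all
    show "((\<lambda>y. y powr (- 1/2)) has_real_derivative - 1/2 * y powr (- 1/2) / y) (at y)"
      using has_real_derivative_powr[OF that, of "- 1/2"] unfolding e times_divide_eq_right .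
    show "((\<lambda>y. y powr (1/2)) has_real_derivative 1/2 * y powr (1/2) / y) (at y)"
      using has_real_derivative_powr[OF that, of "1/2"] unfolding e times_divide_eq_right .
  qed
  let ?w = "\<lambda>a b c d. ($) (vector [a, b, c, d] :: real ^ 4)"
  have "((\<lambda>s. chart s t y z $ i) has_real_derivative ?w 1 1 0 0 i * chart s t y z $ i / s) (at s)" for i
    using i[of i] pos by (elim disjE) (auto simp: chart_def intro!: derivative_eq_intros)
  from weighted_curve_derivative[OF G pos(1) p this]
  show "((\<lambda>s. G (pt u (chart s t y z))) has_vector_derivative
      (E 1 1 G (pt u (chart s t y z)) + E 2 2 G (pt u (chart s t y z))) / of_real s) (at s)"
    by (simp add: sum_4)
  have "((\<lambda>t. chart s t y z $ i) has_real_derivative ?w 0 0 1 1 i * chart s t y z $ i / t) (at t)" for i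
    using i[of i] pos by (elim disjE) (auto simp: chart_def intro!: derivative_eq_intros)
  from weighted_curve_derivative[OF G pos(2) p this]
  show "((\<lambda>t. G (pt u (chart s t y z))) has_vector_derivative
      (E 3 3 G (pt u (chart s t y z)) + E 4 4 G (pt u (chart s t y z))) / of_real t) (at t)"
    by (simp add: sum_4)
  have "((\<lambda>y. chart s t y z $ i) has_real_derivative ?w (- 1/2) (1/2) 0 0 i * chart s t y z $ i / y) (at y)" for i
    using i[of i] DERIV_cmult[OF pw(1)[OF pos(3)], of s] DERIV_cmult[OF pw(2)[OF pos(3)], of s]
    by (elim disjE) (auto simp: chart_def mult_ac)
  from weighted_curve_derivative[OF G pos(3) p this]
  show "((\<lambda>y. G (pt u (chart s t y z))) has_vector_derivative
      (E 2 2 G (pt u (chart s t y z)) - E 1 1 G (pt u (chart s t y z))) / 2 / of_real y) (at y)"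
    by (rule has_vector_derivative_eq_rhs) (simp add: sum_4 diff_divide_distrib)
  have "((\<lambda>z. chart s t y z $ i) has_real_derivative ?w 0 0 (- 1/2) (1/2) i * chart s t y z $ i / z) (at z)" for i
    using i[of i] DERIV_cmult[OF pw(1)[OF pos(4)], of t] DERIV_cmult[OF pw(2)[OF pos(4)], of t]
    by (elim disjE) (auto simp: chart_def mult_ac)
  from weighted_curve_derivative[OF G pos(4) p this]
  show "((\<lambda>z. G (pt u (chart s t y z))) has_vector_derivative
      (E 4 4 G (pt u (chart s t y z)) - E 3 3 G (pt u (chart s t y z))) / 2 / of_real z) (at z)"
    by (rule has_vector_derivative_eq_rhs) (simp add: sum_4 diff_divide_distrib)
qed

lemma sqrt_cpowr: "x > 0 \<Longrightarrow> complex_of_real (sqrt x) powr m = of_real x powr (m / 2)"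
  by (simp add: powr_def Ln_of_real ln_sqrt)

context
  fixes f :: "mat4 \<Rightarrow> complex" and l1 l2 :: complex
  assumes f: "f \<in> Cinf_chi char_II (I_ideal 2 l1 l2)"
begin

lemma radial_equations:
  assumes a: "\<forall>i. 0 < a $ i"
  shows "E 1 1 f (pt u a) + E 2 2 f (pt u a) = (l1 + l2 - 1) * f (pt u a)"
    and "E 4 4 f (pt u a) + E 3 3 f (pt u a) = (l1 + l2 + 1) * f (pt u a)"
    and "E 1 1 (E 1 1 f) (pt u a) = (l1 + l2 - 2) * E 1 1 f (pt u a)
      + (2 * l2 - l1 * l2 + of_real ((2 * pi * (a $ 2 / a $ 1))\<^sup>2)) * f (pt u a)"
    and "E 4 4 (E 4 4 f) (pt u a) = (l1 + l2 + 2) * E 4 4 f (pt u a)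
      - (l1 * (l2 + 2) - of_real ((2 * pi * (a $ 4 / a $ 3))\<^sup>2)) * f (pt u a)"
proof -
  define X where "X = complex_of_real ((2 * pi * (a $ 2 / a $ 1))\<^sup>2)"
  define Z where "Z = complex_of_real ((2 * pi * (a $ 4 / a $ 3))\<^sup>2)"
  note 1 = first_order_equations[OF f a, of u] and 2 = second_order_equations[OF f a, of u, folded X_def Z_def]
  have k: "of_nat 2 = (2::complex)" by simp
  show 11: "E 1 1 f (pt u a) + E 2 2 f (pt u a) = (l1 + l2 - 1) * f (pt u a)"
    using 1(1) unfolding k by algebra
  show 34: "E 4 4 f (pt u a) + E 3 3 f (pt u a) = (l1 + l2 + 1) * f (pt u a)"
    using 1(2) unfolding k by algebra
  show "E 1 1 (E 1 1 f) (pt u a) = (l1 + l2 - 2) * E 1 1 f (pt u a)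
      + (2 * l2 - l1 * l2 + of_real ((2 * pi * (a $ 2 / a $ 1))\<^sup>2)) * f (pt u a)"
    unfolding X_def[symmetric] using 2(1) 11 34 unfolding k by algebra
  show "E 4 4 (E 4 4 f) (pt u a) = (l1 + l2 + 2) * E 4 4 f (pt u a)
      - (l1 * (l2 + 2) - of_real ((2 * pi * (a $ 4 / a $ 3))\<^sup>2)) * f (pt u a)"
    unfolding Z_def[symmetric] using 2(2) unfolding k by algebra
qed

text \<open>The two first order equations hold at all points \<open>pt u a\<close>, so \<open>E\<^sub>1\<^sub>1\<close> and \<open>E\<^sub>4\<^sub>4\<close> can be applied
  to them.\<close>
lemma mixed_equations:
  assumes a: "\<forall>i. 0 < a $ i"
  shows "E 1 1 (E 1 1 f) (pt u a) + E 2 2 (E 1 1 f) (pt u a) = (l1 + l2 - 1) * E 1 1 f (pt u a)"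
    and "E 4 4 (E 4 4 f) (pt u a) + E 3 3 (E 4 4 f) (pt u a) = (l1 + l2 + 1) * E 4 4 f (pt u a)"
proof -
  note F = solution_properties(1)[OF f]
  have "E 2 2 (E 1 1 f) (pt u a) = E 1 1 (E 2 2 f) (pt u a)"
    "E 3 3 (E 4 4 f) (pt u a) = E 4 4 (E 3 3 f) (pt u a)"
    using E_commute[OF F, of 2 2 1 1] E_commute[OF F, of 3 3 4 4] by simp_all
  moreover have "E 1 1 (E 1 1 f) (pt u a) + E 1 1 (E 2 2 f) (pt u a) = (l1 + l2 - 1) * E 1 1 f (pt u a)"
    by (rule E_diagonal_lincomb_on_NA[OF R_real_Cinf[OF F] R_real_Cinf[OF F] F radial_equations(1) a])
  moreover have "E 4 4 (E 4 4 f) (pt u a) + E 4 4 (E 3 3 f) (pt u a) = (l1 + l2 + 1) * E 4 4 f (pt u a)"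
    by (rule E_diagonal_lincomb_on_NA[OF R_real_Cinf[OF F] R_real_Cinf[OF F] F radial_equations(2) a])
  ultimately show "E 1 1 (E 1 1 f) (pt u a) + E 2 2 (E 1 1 f) (pt u a) = (l1 + l2 - 1) * E 1 1 f (pt u a)"
    "E 4 4 (E 4 4 f) (pt u a) + E 3 3 (E 4 4 f) (pt u a) = (l1 + l2 + 1) * E 4 4 f (pt u a)"
    by simp_all
qed

text \<open>The restriction of \<open>f\<close> to \<open>x\<^sub>1 = x\<^sub>3 = 1\<close>, as a function of \<open>x\<^sub>2\<close> and \<open>x\<^sub>4\<close>.\<close>
definition profile :: "real \<Rightarrow> real \<Rightarrow> complex" where
  "profile y z = f (pt 0 (chart 1 1 y z))"

lemma separation_of_scalings:
  assumes a: "\<forall>i. 0 < a $ i"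
  shows "f (pt u a) = of_real (a $ 1 * a $ 2) powr ((l1 + l2 - 1) / 2) * of_real (a $ 3 * a $ 4) powr ((l1 + l2 + 1) / 2)
    * profile (a $ 2 / a $ 1) (a $ 4 / a $ 3)"
proof -
  note F = solution_properties(1)[OF f]
  have ap: "a $ i > 0" for i using a by simp
  define s where "s = sqrt (a $ 1 * a $ 2)"
  define t where "t = sqrt (a $ 3 * a $ 4)"
  define y where "y = a $ 2 / a $ 1"
  define z where "z = a $ 4 / a $ 3"
  have pos: "s > 0" "t > 0" "y > 0" "z > 0" using ap by (simp_all add: s_def t_def y_def z_def)
  have "f (pt u a) = f (pt 0 (chart s t y z))"
    using independent_of_u[OF f a] chart_of_x[OF a] by (simp add: s_def t_def y_def z_def)
  also have "\<dots> = of_real s powr (l1 + l2 - 1) * f (pt 0 (chart 1 t y z))"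
  proof (rule homogeneous_ode[OF _ pos(1), where h="\<lambda>s. f (pt 0 (chart s t y z))"])
    fix s :: real assume s: "s > 0"
    show "((\<lambda>s. f (pt 0 (chart s t y z))) has_vector_derivative
        (l1 + l2 - 1) / of_real s * f (pt 0 (chart s t y z))) (at s)"
      by (rule has_vector_derivative_eq_rhs[OF chart_derivatives(1)[OF F s pos(2-4)]])
        (simp add: radial_equations(1)[OF chart_pos[OF s pos(2-4)]])
  qed
  also have "f (pt 0 (chart 1 t y z)) = of_real t powr (l1 + l2 + 1) * f (pt 0 (chart 1 1 y z))"
  proof (rule homogeneous_ode[OF _ pos(2), where h="\<lambda>t. f (pt 0 (chart 1 t y z))"])
    fix t :: real assume t: "t > 0"
    show "((\<lambda>t. f (pt 0 (chart 1 t y z))) has_vector_derivative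
        (l1 + l2 + 1) / of_real t * f (pt 0 (chart 1 t y z))) (at t)"
      by (rule has_vector_derivative_eq_rhs[OF chart_derivatives(2)[OF F zero_less_one t pos(3,4)]])
        (use radial_equations(2)[OF chart_pos[OF zero_less_one t pos(3,4)]] in \<open>simp add: add.commute\<close>)
  qed
  finally show ?thesis
    unfolding s_def t_def using ap by (simp only: sqrt_cpowr mult_pos_pos profile_def y_def z_def mult_ac)
qed

text \<open>The operator \<open>y d/dy\<close> is \<open>(E\<^sub>2\<^sub>2 - E\<^sub>1\<^sub>1) / 2\<close>, which the first order equation turns into
  \<open>(\<lambda>\<^sub>1 + \<lambda>\<^sub>2 - 1) / 2 - E\<^sub>1\<^sub>1\<close>; the entry \<open>(1,1)\<close> expresses \<open>E\<^sub>1\<^sub>1 E\<^sub>1\<^sub>1 f\<close> through \<open>E\<^sub>1\<^sub>1 f\<close> and \<open>f\<close>.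
  Likewise \<open>z d/dz\<close> is \<open>E\<^sub>4\<^sub>4 - (\<lambda>\<^sub>1 + \<lambda>\<^sub>2 + 1) / 2\<close>, and the entry \<open>(4,4)\<close> determines \<open>E\<^sub>4\<^sub>4 E\<^sub>4\<^sub>4 f\<close>.\<close>
lemma profile_bessel:
  defines "\<nu> \<equiv> (l1 - l2 - 2) / 2"
  shows "z > 0 \<Longrightarrow> \<exists>f1. bessel_pair \<nu> (\<lambda>Y. of_real ((Y / (2 * pi)) powr (- 1/2)) * profile (Y / (2 * pi)) z) f1"
    and "y > 0 \<Longrightarrow> \<exists>f1. bessel_pair \<nu> (\<lambda>Z. of_real ((Z / (2 * pi)) powr (- 1/2)) * profile y (Z / (2 * pi))) f1"
proof -
  note F = solution_properties(1)[OF f]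
  assume z: "z > 0"
  let ?\<sigma> = "(l1 + l2 - 1) / 2"
  let ?e = "\<lambda>y. E 1 1 f (pt 0 (chart 1 1 y z))" and ?ee = "\<lambda>y. E 1 1 (E 1 1 f) (pt 0 (chart 1 1 y z))"
  define h where "h y = profile y z" for y
  have d: "(h has_vector_derivative (?\<sigma> * h y - ?e y) / of_real y) (at y)"
    "(?e has_vector_derivative (?\<sigma> * ?e y - ?ee y) / of_real y) (at y)" if y: "y > 0" for y
  proof -
    note p = chart_pos[OF zero_less_one zero_less_one y z]
    have h: "h y = f (pt 0 (chart 1 1 y z))" by (simp add: h_def profile_def)
    show "(h has_vector_derivative (?\<sigma> * h y - ?e y) / of_real y) (at y)"
    proof (rule has_vector_derivative_eq_rhs[OF chart_derivatives(3)[OF F zero_less_one zero_less_one y z, of 0, folded profile_def, folded h_def]])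
      show "(E 2 2 f (pt 0 (chart 1 1 y z)) - ?e y) / 2 / of_real y = (?\<sigma> * h y - ?e y) / of_real y"
        using radial_equations(1)[OF p, of 0] unfolding h by (simp add: field_simps)
    qed
    show "(?e has_vector_derivative (?\<sigma> * ?e y - ?ee y) / of_real y) (at y)"
    proof (rule has_vector_derivative_eq_rhs[OF chart_derivatives(3)[OF R_real_Cinf[OF F] zero_less_one zero_less_one y z]])
      show "(E 2 2 (E 1 1 f) (pt 0 (chart 1 1 y z)) - ?ee y) / 2 / of_real y = (?\<sigma> * ?e y - ?ee y) / of_real y"
        using mixed_equations(1)[OF p, of 0] by (simp add: field_simps)
    qed
  qed
  have "bessel_pair \<nu> (\<lambda>Y. of_real ((Y / (2 * pi)) powr (- 1/2)) * h (Y / (2 * pi)))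
      (\<lambda>Y. of_real ((Y / (2 * pi)) powr (- 1/2)) * ((?\<sigma> * h (Y / (2 * pi)) - ?e (Y / (2 * pi))) - h (Y / (2 * pi)) / 2))"
  proof (rule bessel_pair_of_radial[where ?h2.0="\<lambda>y. ?\<sigma> * (?\<sigma> * h y - ?e y) - (?\<sigma> * ?e y - ?ee y)"])
    fix y :: real assume y: "y > 0"
    note p = chart_pos[OF zero_less_one zero_less_one y z]
    show "(h has_vector_derivative (?\<sigma> * h y - ?e y) / of_real y) (at y)" by (rule d(1)[OF y])
    show "((\<lambda>y. ?\<sigma> * h y - ?e y) has_vector_derivative
        (?\<sigma> * (?\<sigma> * h y - ?e y) - (?\<sigma> * ?e y - ?ee y)) / of_real y) (at y)"
      by (rule has_vector_derivative_eq_rhs[OF has_vector_derivative_diff[OF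
            has_vector_derivative_mult_right[OF d(1)[OF y]] d(2)[OF y]]]) (simp only: times_divide_eq_right diff_divide_distrib[symmetric])
    define X where "X = complex_of_real ((2 * pi * y)\<^sup>2)"
    have ee: "?ee y = (l1 + l2 - 2) * ?e y + (2 * l2 - l1 * l2 + X) * h y"
      using radial_equations(3)[OF p, of 0] unfolding chart_ratio[OF zero_less_one zero_less_one y z]
      by (simp add: h_def profile_def X_def)
    show "?\<sigma> * (?\<sigma> * h y - ?e y) - (?\<sigma> * ?e y - ?ee y) - (?\<sigma> * h y - ?e y) + h y / 4 = (\<nu>\<^sup>2 + of_real ((2 * pi * y)\<^sup>2)) * h y"
      unfolding X_def[symmetric] \<nu>_def ee by (simp add: field_simps power2_eq_square)
  qed
  then show "\<exists>f1. bessel_pair \<nu> (\<lambda>Y. of_real ((Y / (2 * pi)) powr (- 1/2)) * profile (Y / (2 * pi)) z) f1"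
    unfolding h_def by blast
next
  note F = solution_properties(1)[OF f]
  assume y: "y > 0"
  let ?\<sigma> = "(l1 + l2 + 1) / 2"
  let ?e = "\<lambda>z. E 4 4 f (pt 0 (chart 1 1 y z))" and ?ee = "\<lambda>z. E 4 4 (E 4 4 f) (pt 0 (chart 1 1 y z))"
  define h where "h z = profile y z" for z
  have d: "(h has_vector_derivative (?e z - ?\<sigma> * h z) / of_real z) (at z)"
    "(?e has_vector_derivative (?ee z - ?\<sigma> * ?e z) / of_real z) (at z)" if z: "z > 0" for z
  proof -
    note p = chart_pos[OF zero_less_one zero_less_one y z]
    have h: "h z = f (pt 0 (chart 1 1 y z))" by (simp add: h_def profile_def)
    show "(h has_vector_derivative (?e z - ?\<sigma> * h z) / of_real z) (at z)"
    proof (rule has_vector_derivative_eq_rhs[OF chart_derivatives(4)[OF F zero_less_one zero_less_one y z, of 0, folded profile_def, folded h_def]])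
      show "(?e z - E 3 3 f (pt 0 (chart 1 1 y z))) / 2 / of_real z = (?e z - ?\<sigma> * h z) / of_real z"
        using radial_equations(2)[OF p, of 0] unfolding h by (simp add: field_simps)
    qed
    show "(?e has_vector_derivative (?ee z - ?\<sigma> * ?e z) / of_real z) (at z)"
    proof (rule has_vector_derivative_eq_rhs[OF chart_derivatives(4)[OF R_real_Cinf[OF F] zero_less_one zero_less_one y z]])
      show "(?ee z - E 3 3 (E 4 4 f) (pt 0 (chart 1 1 y z))) / 2 / of_real z = (?ee z - ?\<sigma> * ?e z) / of_real z"
        using mixed_equations(2)[OF p, of 0] by (simp add: field_simps)
    qed
  qed
  have "bessel_pair \<nu> (\<lambda>Z. of_real ((Z / (2 * pi)) powr (- 1/2)) * h (Z / (2 * pi)))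
      (\<lambda>Z. of_real ((Z / (2 * pi)) powr (- 1/2)) * ((?e (Z / (2 * pi)) - ?\<sigma> * h (Z / (2 * pi))) - h (Z / (2 * pi)) / 2))"
  proof (rule bessel_pair_of_radial[where ?h2.0="\<lambda>z. (?ee z - ?\<sigma> * ?e z) - ?\<sigma> * (?e z - ?\<sigma> * h z)"])
    fix z :: real assume z: "z > 0"
    note p = chart_pos[OF zero_less_one zero_less_one y z]
    show "(h has_vector_derivative (?e z - ?\<sigma> * h z) / of_real z) (at z)" by (rule d(1)[OF z])
    show "((\<lambda>z. ?e z - ?\<sigma> * h z) has_vector_derivative
        ((?ee z - ?\<sigma> * ?e z) - ?\<sigma> * (?e z - ?\<sigma> * h z)) / of_real z) (at z)"
      by (rule has_vector_derivative_eq_rhs[OF has_vector_derivative_diff[OF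
            d(2)[OF z] has_vector_derivative_mult_right[OF d(1)[OF z]]]]) (simp only: times_divide_eq_right diff_divide_distrib[symmetric])
    define X where "X = complex_of_real ((2 * pi * z)\<^sup>2)"
    have ee: "?ee z = (l1 + l2 + 2) * ?e z - (l1 * (l2 + 2) - X) * h z"
      using radial_equations(4)[OF p, of 0] unfolding chart_ratio[OF zero_less_one zero_less_one y z]
      by (simp add: h_def profile_def X_def)
    show "(?ee z - ?\<sigma> * ?e z) - ?\<sigma> * (?e z - ?\<sigma> * h z) - (?e z - ?\<sigma> * h z) + h z / 4 = (\<nu>\<^sup>2 + of_real ((2 * pi * z)\<^sup>2)) * h z"
      unfolding X_def[symmetric] \<nu>_def ee by (simp add: field_simps power2_eq_square)
  qed
  then show "\<exists>f1. bessel_pair \<nu> (\<lambda>Z. of_real ((Z / (2 * pi)) powr (- 1/2)) * profile y (Z / (2 * pi))) f1"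
    unfolding h_def by blast
qed

end

section \<open>Construction of solutions\<close>

text \<open>In the coordinates \<open>x\<^sub>i\<close> this is \<open>x\<^sub>1\<close> to the power \<open>c1\<close> times \<open>x\<^sub>3\<close> to the power \<open>c3\<close> times
  \<open>Y(x\<^sub>2) Z(x\<^sub>4)\<close>.\<close>
definition separated :: "complex \<Rightarrow> complex \<Rightarrow> (real \<Rightarrow> complex) \<Rightarrow> (real \<Rightarrow> complex) \<Rightarrow> real ^ 4 \<Rightarrow> complex" where
  "separated c1 c3 Y Z a = of_real (a $ 1 * a $ 2) powr c1 * of_real (a $ 3 * a $ 4) powr c3 * (Y (a $ 2 / a $ 1) * Z (a $ 4 / a $ 3))"

lemma separated_chart:
  assumes "s > 0" "t > 0" "y > 0" "z > 0"
  shows "separated c1 c3 Y Z (chart s t y z) = of_real s powr (2 * c1) * of_real t powr (2 * c3) * (Y y * Z z)"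
proof -
  have m: "(s * y powr (- 1/2)) * (s * y powr (1/2)) = s * s" if "y > 0" for s y :: real
  proof -
    have "(s * y powr (- 1/2)) * (s * y powr (1/2)) = s * s * (y powr (- 1/2) * y powr (1/2))" by (simp only: mult_ac)
    also have "y powr (- 1/2) * y powr (1/2) = 1" using that by (simp add: powr_add[symmetric])
    finally show ?thesis by simp
  qed
  have sq: "of_real (s * s) powr c = complex_of_real s powr (2 * c)" if "s > 0" for s c
    using sqrt_cpowr[of "s * s" "2 * c"] that by simp
  show ?thesis
    unfolding separated_def chart_ratio[OF assms]
    using assms by (simp only: chart_def vector4 m sq)
qed

text \<open>The \<open>E\<^sub>i\<^sub>i\<close> preserve this class of functions, and can therefore be iterated on it.\<close>
lemma diagonal_action_on_separated:
  assumes F: "F \<in> Cinf_GL4" and eq: "\<And>a. \<forall>i. 0 < a $ i \<Longrightarrow> F (pt u a) = separated c1 c3 Y Z a"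
    and Y: "\<And>y. y > 0 \<Longrightarrow> (Y has_vector_derivative Y1 y / of_real y) (at y)"
    and Z: "\<And>z. z > 0 \<Longrightarrow> (Z has_vector_derivative Z1 z / of_real z) (at z)"
    and a: "\<forall>i. 0 < a $ i"
  shows "E 1 1 F (pt u a) = separated c1 c3 (\<lambda>y. c1 * Y y - Y1 y) Z a"
    "E 2 2 F (pt u a) = separated c1 c3 (\<lambda>y. c1 * Y y + Y1 y) Z a"
    "E 3 3 F (pt u a) = separated c1 c3 Y (\<lambda>z. c3 * Z z - Z1 z) a"
    "E 4 4 F (pt u a) = separated c1 c3 Y (\<lambda>z. c3 * Z z + Z1 z) a"
proof -
  have ap: "a $ i > 0" for i using a by simp
  define s where "s = sqrt (a $ 1 * a $ 2)"
  define t where "t = sqrt (a $ 3 * a $ 4)"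
  define y where "y = a $ 2 / a $ 1"
  define z where "z = a $ 4 / a $ 3"
  have pos: "s > 0" "t > 0" "y > 0" "z > 0" using ap by (simp_all add: s_def t_def y_def z_def)
  have ac: "a = chart s t y z" using chart_of_x[OF a] by (simp add: s_def t_def y_def z_def)
  have Fc: "F (pt u (chart s t y z)) = of_real s powr (2 * c1) * of_real t powr (2 * c3) * (Y y * Z z)"
    if "s > 0" "t > 0" "y > 0" "z > 0" for s t y z
    using eq[OF chart_pos[OF that]] separated_chart[OF that] by simp
  note S = separated_chart[OF pos]
  note d = chart_derivatives[OF F pos, where u=u]
  have pw: "((\<lambda>t. of_real t powr m) has_vector_derivative m * of_real t powr m / of_real t) (at t)" if "t > 0" for t :: real and m :: complex
  proof -
    have "complex_of_real t powr (m - 1) = of_real t powr m / of_real t" using that by (subst powr_diff) simp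
    moreover have "complex_of_real t \<notin> \<real>\<^sub>\<le>\<^sub>0" using that by (simp add: complex_nonpos_Reals_iff)
    ultimately show ?thesis
      using has_vector_derivative_real_field[OF has_field_derivative_powr, of t m] by (metis times_divide_eq_right)
  qed
  have tr: "D = D'" if "((\<lambda>r. F (pt u (c r))) has_vector_derivative D) (at r)" "(h has_vector_derivative D') (at r)"
      "r > 0" "\<And>r. r > 0 \<Longrightarrow> h r = F (pt u (c r))" for c h D D' and r :: real
    using vector_derivative_unique_at[OF that(1) has_vector_derivative_transform_within_open[OF that(2) open_greaterThan[of 0]]] that(3,4)
    by auto
  define A where "A = of_real s powr (2 * c1) * of_real t powr (2 * c3)"
  have 1: "(E 1 1 F (pt u a) + E 2 2 F (pt u a)) / of_real s = 2 * c1 * (A * (Y y * Z z)) / of_real s"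
    unfolding ac
  proof (rule tr[OF d(1) _ pos(1) Fc[symmetric]])
    show "((\<lambda>s. of_real s powr (2 * c1) * of_real t powr (2 * c3) * (Y y * Z z)) has_vector_derivative
      2 * c1 * (A * (Y y * Z z)) / of_real s) (at s)"
      by (rule has_vector_derivative_eq_rhs[OF has_vector_derivative_mult_left[OF has_vector_derivative_mult_left[OF pw[OF pos(1)]]]])
        (simp add: A_def)
  qed (use pos in auto)
  have 2: "(E 3 3 F (pt u a) + E 4 4 F (pt u a)) / of_real t = 2 * c3 * (A * (Y y * Z z)) / of_real t"
    unfolding ac
  proof (rule tr[OF d(2) _ pos(2) Fc[symmetric]])
    show "((\<lambda>t. of_real s powr (2 * c1) * of_real t powr (2 * c3) * (Y y * Z z)) has_vector_derivative
      2 * c3 * (A * (Y y * Z z)) / of_real t) (at t)"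
      by (rule has_vector_derivative_eq_rhs[OF has_vector_derivative_mult_left[OF has_vector_derivative_mult_right[OF pw[OF pos(2)]]]])
        (simp add: A_def)
  qed (use pos in auto)
  have 3: "(E 2 2 F (pt u a) - E 1 1 F (pt u a)) / 2 / of_real y = A * (Y1 y * Z z) / of_real y"
    unfolding ac
  proof (rule tr[OF d(3) _ pos(3) Fc[symmetric]])
    show "((\<lambda>y. of_real s powr (2 * c1) * of_real t powr (2 * c3) * (Y y * Z z)) has_vector_derivative
      A * (Y1 y * Z z) / of_real y) (at y)"
      by (rule has_vector_derivative_eq_rhs[OF has_vector_derivative_mult_right[OF has_vector_derivative_mult_left[OF Y[OF pos(3)]]]])
        (simp add: A_def)
  qed (use pos in auto)
  have 4: "(E 4 4 F (pt u a) - E 3 3 F (pt u a)) / 2 / of_real z = A * (Y y * Z1 z) / of_real z"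
    unfolding ac
  proof (rule tr[OF d(4) _ pos(4) Fc[symmetric]])
    show "((\<lambda>z. of_real s powr (2 * c1) * of_real t powr (2 * c3) * (Y y * Z z)) has_vector_derivative
      A * (Y y * Z1 z) / of_real z) (at z)"
      by (rule has_vector_derivative_eq_rhs[OF has_vector_derivative_mult_right[OF has_vector_derivative_mult_right[OF Z[OF pos(4)]]]])
        (simp add: A_def)
  qed (use pos in auto)
  have h: "x = 2 * r" if "x / 2 / c = r / c" "c \<noteq> 0" for x r c :: complex
    using that by (simp add: field_simps)
  have "E 1 1 F (pt u a) + E 2 2 F (pt u a) = 2 * c1 * (A * (Y y * Z z))"
    "E 3 3 F (pt u a) + E 4 4 F (pt u a) = 2 * c3 * (A * (Y y * Z z))"
    "E 2 2 F (pt u a) - E 1 1 F (pt u a) = 2 * (A * (Y1 y * Z z))"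
    "E 4 4 F (pt u a) - E 3 3 F (pt u a) = 2 * (A * (Y y * Z1 z))"
    using 1 2 pos h[OF 3] h[OF 4] by simp_all
  then have "E 1 1 F (pt u a) = A * ((c1 * Y y - Y1 y) * Z z)" "E 2 2 F (pt u a) = A * ((c1 * Y y + Y1 y) * Z z)"
    "E 3 3 F (pt u a) = A * (Y y * (c3 * Z z - Z1 z))" "E 4 4 F (pt u a) = A * (Y y * (c3 * Z z + Z1 z))"
    by algebra+
  then show "E 1 1 F (pt u a) = separated c1 c3 (\<lambda>y. c1 * Y y - Y1 y) Z a"
    "E 2 2 F (pt u a) = separated c1 c3 (\<lambda>y. c1 * Y y + Y1 y) Z a"
    "E 3 3 F (pt u a) = separated c1 c3 Y (\<lambda>z. c3 * Z z - Z1 z) a"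
    "E 4 4 F (pt u a) = separated c1 c3 Y (\<lambda>z. c3 * Z z + Z1 z) a"
    unfolding ac S A_def .
qed

lemma E_32_vanishes:
  assumes "F \<in> Cinf_GL4" "left_equivariant char_II F" "\<forall>i. 0 < a $ i" "\<And>u. F (pt u a) = c"
  shows "E 3 2 F (pt u a) = 0"
proof -
  have "a $ i > 0" for i using assms by simp
  then have nz: "a $ i \<noteq> 0" for i by (metis less_irrefl)
  have "((\<lambda>u. c) has_vector_derivative of_real (a $ 2 / a $ 3) * E 3 2 F (pt u a)) (at u)"
    using E_32_derivative[OF assms(1-3), of u] by (simp only: assms(4))
  then have "of_real (a $ 2 / a $ 3) * E 3 2 F (pt u a) = 0"
    using vector_derivative_unique_at has_vector_derivative_const by blast
  then show ?thesis using nz by simp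
qed

lemma lower_unipotent_mult:
  assumes "m \<in> lower_unipotent" "n \<in> lower_unipotent"
  shows "m ** n \<in> lower_unipotent" "(m ** n) $ 2 $ 1 = m $ 2 $ 1 + n $ 2 $ 1" "(m ** n) $ 4 $ 3 = m $ 4 $ 3 + n $ 4 $ 3"
  using assms by (auto simp: lower_unipotent_def forall_4 matrix_matrix_mult_def sum_4)

text \<open>The factor \<open>s\<close> is \<open>n (1 - u E\<^sub>3\<^sub>2)\<close> with \<open>u\<close> the entry \<open>(3,2)\<close> of \<open>n\<close>, and \<open>X\<close> is its logarithm
  \<open>(s - 1) - (s - 1)\<^sup>2 / 2\<close>.\<close>
lemma lower_unipotent_factor:
  assumes n: "n \<in> lower_unipotent"
  obtains s u where "s \<in> S_II" "n = s ** mexp (u *\<^sub>R munit 3 2)"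
proof -
  note nn = n[unfolded lower_unipotent_def mem_Collect_eq forall_4]
  define e where "e = n $ 4 $ 2 - n $ 3 $ 2 * n $ 4 $ 3"
  define X :: mat4 where "X = n $ 2 $ 1 *\<^sub>R munit 2 1 + n $ 4 $ 3 *\<^sub>R munit 4 3 + n $ 3 $ 1 *\<^sub>R munit 3 1 + e *\<^sub>R munit 4 2
    + (n $ 4 $ 1 - (e * n $ 2 $ 1 + n $ 4 $ 3 * n $ 3 $ 1) / 2) *\<^sub>R munit 4 1"
  have "X \<in> S_span" unfolding X_def by (intro span_add span_scale span_base) auto
  then have s: "mexp X \<in> S_II" and N: "X \<in> nilp" using S_span_nilp unfolding S_II_def by auto
  have Xe: "X $ i $ j = (if i = 2 \<and> j = 1 then n $ 2 $ 1 else if i = 4 \<and> j = 3 then n $ 4 $ 3 else if i = 3 \<and> j = 1 then n $ 3 $ 1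
     else if i = 4 \<and> j = 2 then e else if i = 4 \<and> j = 1 then n $ 4 $ 1 - (e * n $ 2 $ 1 + n $ 4 $ 3 * n $ 3 $ 1) / 2 else 0)" for i j
    by (simp add: X_def munit_def)
  have mX: "mexp X $ i $ j = (if i = j then 1 else if i = 2 \<and> j = 1 then n $ 2 $ 1 else if i = 4 \<and> j = 3 then n $ 4 $ 3 
     else if i = 3 \<and> j = 1 then n $ 3 $ 1 else if i = 4 \<and> j = 2 then e else if i = 4 \<and> j = 1 then n $ 4 $ 1 else 0)" for i j
    using exhaust_4[of i] exhaust_4[of j]
    unfolding mexp_nilp[OF N] by (elim disjE) (simp_all add: Xe matrix_matrix_mult_def sum_4 mat_def field_simps)
  have "n = mexp X ** mexp (n $ 3 $ 2 *\<^sub>R munit 3 2)"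
    unfolding unipotent_32 using nn
    by (simp add: vec_eq_iff forall_4 matrix_matrix_mult_def sum_4 mX mat_def munit_def) (simp add: e_def)
  with s show ?thesis using that by blast
qed

lemma quadratic_op_left_equivariant:
  assumes f: "f \<in> Cinf_GL4" "left_equivariant char_II f" and s: "s \<in> S_II" and g: "g \<in> GL4"
  shows "quadratic_op c d i j f (s ** g) = char_II s * quadratic_op c d i j f g"
proof -
  have L: "left_equivariant char_II (E i j f)" "left_equivariant char_II (E k l (E i j f))" for i j k l
    by (intro left_equivariant_R_real R_real_Cinf f)+
  show ?thesis
    using L f(2) s g S_II_GL4[OF s] unfolding quadratic_op_def left_equivariant_def
    by (simp add: sum_distrib_left algebra_simps)
qed

text \<open>Every \<open>g\<close> is of the form \<open>s exp(u E\<^sub>3\<^sub>2) a k\<close>, and the equations are equivariant under \<open>s\<close> and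
  covariant under \<open>k\<close>.\<close>
lemma annihilated_if_annihilated_on_NA:
  assumes f: "f \<in> Cinf_GL4" "left_equivariant char_II f" "right_invariant f" and g: "g \<in> GL4"
    and q: "\<And>u a i j. \<forall>i. 0 < a $ i \<Longrightarrow> quadratic_op c d i j f (pt u a) = 0"
    and t: "\<And>u a. \<forall>i. 0 < a $ i \<Longrightarrow> (\<Sum>i\<in>UNIV. E i i f (pt u a)) = m * f (pt u a)"
  shows "quadratic_op c d i j f g = 0" "(\<Sum>i\<in>UNIV. E i i f g) = m * f g"
proof -
  obtain n k where nk: "n \<in> lower_unipotent" "k \<in> O4" "g = n ** diag (iw_a g) ** k" and a: "\<forall>i. 0 < iw_a g $ i"
    using iwasawa_exists[OF g] by metis
  obtain s u where s: "s \<in> S_II" "n = s ** mexp (u *\<^sub>R munit 3 2)"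
    using lower_unipotent_factor[OF nk(1)] by metis
  have g': "g = s ** pt u (iw_a g) ** k"
    using nk(3) s(2) by (simp add: pt_def matrix_mul_assoc)
  note p = pt_GL4[OF a, of u]
  have sp: "s ** pt u (iw_a g) \<in> GL4" by (intro GL4_mult S_II_GL4 s p)
  have "quadratic_op c d i j f (s ** pt u (iw_a g)) = 0" for i j
    unfolding quadratic_op_left_equivariant[OF f(1,2) s(1) p] q[OF a] by simp
  then show "quadratic_op c d i j f g = 0"
    using quadratic_op_right_invariant[OF f(1,3) nk(2) sp] g' by metis
  have L: "left_equivariant char_II (E i i f)" for i by (intro left_equivariant_R_real f)
  have "(\<Sum>i\<in>UNIV. E i i f (s ** pt u (iw_a g))) = char_II s * (\<Sum>i\<in>UNIV. E i i f (pt u (iw_a g)))"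
    using L s(1) p S_II_GL4[OF s(1)] unfolding left_equivariant_def by (simp add: sum_distrib_left)
  also have "\<dots> = m * f (s ** pt u (iw_a g))"
    using f(2) s(1) p S_II_GL4[OF s(1)] unfolding left_equivariant_def by (simp add: t[OF a])
  finally have "(\<Sum>i\<in>UNIV. E i i f (s ** pt u (iw_a g) ** k)) = m * f (s ** pt u (iw_a g) ** k)"
    using trace_right_invariant[OF f(1,3) nk(2) sp] f(3) sp nk(2) by (simp add: right_invariant_def)
  then show "(\<Sum>i\<in>UNIV. E i i f g) = m * f g" using g' by simp
qed

text \<open>The extension of a function on \<open>A\<close> to \<open>G\<close>. The two projection coefficients are the entries
  \<open>(2,1)\<close> and \<open>(4,3)\<close> of the factor in \<open>N\<close>; they are additive on \<open>N\<close>, so that the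
  exponential is a character of \<open>N\<close> that extends the given one of \<open>S\<close>.\<close>
definition lift_NA :: "(real ^ 4 \<Rightarrow> complex) \<Rightarrow> mat4 \<Rightarrow> complex" where
  "lift_NA \<phi> g = (if g \<in> GL4 then
     exp (2 * of_real pi * \<i> * of_real (proj_coeff (g $ 2) (gs1 g) + proj_coeff (g $ 4) (gs3 g))) * \<phi> (iw_a g) else 0)"

lemma diag_GL4: "\<forall>i. 0 < a $ i \<Longrightarrow> diag a \<in> GL4"
  using pt_GL4[of a 0] by (simp add: pt_def)

lemma lift_NA_iwasawa:
  assumes "n \<in> lower_unipotent" "k \<in> O4" "\<forall>i. 0 < a $ i"
  shows "lift_NA \<phi> (n ** diag a ** k) = exp (2 * of_real pi * \<i> * of_real (n $ 2 $ 1 + n $ 4 $ 3)) * \<phi> a"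
  using iwasawa_unique[OF assms refl] assms
  by (simp add: lift_NA_def GL4_mult lower_unipotent_GL4 O4_GL4 diag_GL4)

lemma O4_mult: "k \<in> O4 \<Longrightarrow> k' \<in> O4 \<Longrightarrow> k ** k' \<in> O4"
  by (simp add: O4_def orthogonal_matrix_mul)

lemma lift_NA_equivariant: "left_equivariant char_II (lift_NA \<phi>)" "right_invariant (lift_NA \<phi>)"
proof -
  show "left_equivariant char_II (lift_NA \<phi>)"
    unfolding left_equivariant_def
  proof (intro ballI)
    fix s g assume s: "s \<in> S_II" and g: "g \<in> GL4"
    obtain X where X: "X \<in> nilp" "s = mexp X" using s S_span_nilp unfolding S_II_def by blast
    obtain n k where nk: "n \<in> lower_unipotent" "k \<in> O4" "g = n ** diag (iw_a g) ** k" and a: "\<forall>i. 0 < iw_a g $ i"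
      using iwasawa_exists[OF g] by metis
    have "lift_NA \<phi> (s ** g) = lift_NA \<phi> ((s ** n) ** diag (iw_a g) ** k)"
      using nk(3) by (simp add: matrix_mul_assoc[symmetric])
    also have "\<dots> = char_II s * lift_NA \<phi> (n ** diag (iw_a g) ** k)"
      using lower_unipotent_mult[OF mexp_nilp_entries(1)[OF X(1)] nk(1)] nk(1,2) a
      by (simp add: lift_NA_iwasawa X(2) char_II_mexp[OF X(1)] mexp_nilp_entries(2-4)[OF X(1)] exp_add[symmetric] algebra_simps)
    finally show "lift_NA \<phi> (s ** g) = char_II s * lift_NA \<phi> g" using nk(3) by simp
  qed
  show "right_invariant (lift_NA \<phi>)"
    unfolding right_invariant_def
  proof (intro ballI)
    fix g k' assume g: "g \<in> GL4" and k': "k' \<in> O4"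
    obtain n k where nk: "n \<in> lower_unipotent" "k \<in> O4" "g = n ** diag (iw_a g) ** k" and a: "\<forall>i. 0 < iw_a g $ i"
      using iwasawa_exists[OF g] by metis
    have "lift_NA \<phi> (g ** k') = lift_NA \<phi> (n ** diag (iw_a g) ** (k ** k'))"
      using nk(3) by (simp add: matrix_mul_assoc)
    also have "\<dots> = lift_NA \<phi> (n ** diag (iw_a g) ** k)"
      using nk(1,2) a k' by (simp add: lift_NA_iwasawa O4_mult)
    finally show "lift_NA \<phi> (g ** k') = lift_NA \<phi> g" using nk(3) by simp
  qed
qed

lemma lift_NA_pt: "\<forall>i. 0 < a $ i \<Longrightarrow> lift_NA \<phi> (pt u a) = \<phi> a"
proof -
  assume a: "\<forall>i. 0 < a $ i"
  have "mexp (u *\<^sub>R munit 3 2) \<in> lower_unipotent"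
    unfolding unipotent_32 by (simp add: lower_unipotent_def forall_4 mat_def munit_def)
  from lift_NA_iwasawa[OF this O4_one a] 
  have "lift_NA \<phi> (pt u a) = exp (2 * of_real pi * \<i> *
      of_real (mexp (u *\<^sub>R munit 3 2) $ 2 $ 1 + mexp (u *\<^sub>R munit 3 2) $ 4 $ 3)) * \<phi> a"
    by (simp only: pt_def matrix_mul_rid)
  also have "mexp (u *\<^sub>R munit 3 2) $ 2 $ 1 + mexp (u *\<^sub>R munit 3 2) $ 4 $ 3 = 0"
    unfolding unipotent_32 by (simp add: mat_def munit_def)
  finally show ?thesis by simp
qed

lemma smooth_on_complex_mult:
  "open S \<Longrightarrow> smooth_on S f \<Longrightarrow> smooth_on S g \<Longrightarrow> smooth_on S (\<lambda>x. f x * (g x :: complex))"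
  by (rule smooth_on_bilinear[OF _ bounded_bilinear_mult])

lemma smooth_on_real_mult:
  "open S \<Longrightarrow> smooth_on S f \<Longrightarrow> smooth_on S g \<Longrightarrow> smooth_on S (\<lambda>x. f x * (g x :: real))"
  by (rule smooth_on_bilinear[OF _ bounded_bilinear_mult])

lemma lift_separated_Cinf:
  assumes Y: "smooth_on {0<..} Y" and Z: "smooth_on {0<..} Z"
  shows "lift_NA (separated c1 c3 Y Z) \<in> Cinf_GL4"
proof -
  have pos: "0 < iw_a g $ i" if "g \<in> GL4" for g i using iwasawa_exists[OF that] by metis
  have r: "smooth_on GL4 (\<lambda>g. g $ i)" for i
    by (intro smooth_on_bounded_linear open_GL4 bounded_linear_vec_nth)
  have quot: "smooth_on GL4 (\<lambda>g. iw_a g $ j / iw_a g $ i)" for i j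
  proof -
    have "smooth_on GL4 (\<lambda>g. iw_a g $ j * iw_a g $ i powr -1)"
      by (intro smooth_on_real_mult smooth_on_real_powr open_GL4 smooth_on_iw_a pos)
    then show ?thesis
      by (rule smooth_on_cong[OF open_GL4, rotated]) (simp add: powr_minus_divide abs_of_pos[OF pos])
  qed
  have e: "smooth_on GL4 (\<lambda>g. exp (2 * of_real pi * \<i> * of_real (proj_coeff (g $ 2) (gs1 g) + proj_coeff (g $ 4) (gs3 g))))"
    by (rule smooth_on_compose_real[OF open_GL4 _ _ smooth_on_exp_imaginary])
      (auto intro!: smooth_on_add smooth_on_proj_coeff open_GL4 r smooth_on_gs gs_nonzero)
  have p: "smooth_on GL4 (\<lambda>g. of_real (iw_a g $ i * iw_a g $ j) powr (c::complex))" for i j c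
    by (rule smooth_on_compose_real[OF open_GL4 _ _ smooth_on_cpowr])
      (auto intro!: smooth_on_real_mult open_GL4 smooth_on_iw_a mult_pos_pos pos)
  have q: "smooth_on GL4 (\<lambda>g. h (iw_a g $ j / iw_a g $ i))" if "smooth_on {0<..} h" for h :: "real \<Rightarrow> complex" and i j
    by (rule smooth_on_compose_real[OF open_GL4 quot _ that]) (simp add: pos)
  have "smooth_on GL4 (\<lambda>g. exp (2 * of_real pi * \<i> * of_real (proj_coeff (g $ 2) (gs1 g) + proj_coeff (g $ 4) (gs3 g)))
      * separated c1 c3 Y Z (iw_a g))"
    unfolding separated_def by (intro smooth_on_complex_mult open_GL4 e p q Y Z)
  then have "smooth_on GL4 (lift_NA (separated c1 c3 Y Z))"
    by (rule smooth_on_cong[OF open_GL4, rotated]) (simp add: lift_NA_def)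
  then show ?thesis by (simp add: Cinf_GL4_def lift_NA_def)
qed

text \<open>The function does not depend on \<open>u\<close>, which makes \<open>E\<^sub>3\<^sub>2\<close> vanish wherever it occurs in
  \<open>radial_parts\<close>. The exponents of \<open>x\<^sub>1\<close> and \<open>x\<^sub>3\<close> take care of the entries \<open>(2,1)\<close>, \<open>(4,3)\<close> and of
  the trace; each of the four diagonal entries is the Bessel equation for \<open>Y\<close> or for \<open>Z\<close>.\<close>
lemma lift_separated_in_Cinf_chi:
  fixes l1 l2 :: complex
  defines "\<nu> \<equiv> (l1 - l2 - 2) / 2"
  assumes sm: "smooth_on {0<..} Y" "smooth_on {0<..} Z"
    and Y: "\<And>y. y > 0 \<Longrightarrow> (Y has_vector_derivative Y1 y / of_real y) (at y)"
      "\<And>y. y > 0 \<Longrightarrow> (Y1 has_vector_derivative (Y1 y - Y y / 4 + (\<nu>\<^sup>2 + of_real ((2 * pi * y)\<^sup>2)) * Y y) / of_real y) (at y)"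
    and Z: "\<And>z. z > 0 \<Longrightarrow> (Z has_vector_derivative Z1 z / of_real z) (at z)"
      "\<And>z. z > 0 \<Longrightarrow> (Z1 has_vector_derivative (Z1 z - Z z / 4 + (\<nu>\<^sup>2 + of_real ((2 * pi * z)\<^sup>2)) * Z z) / of_real z) (at z)"
  shows "lift_NA (separated ((l1 + l2 - 1) / 2) ((l1 + l2 + 1) / 2) Y Z) \<in> Cinf_chi char_II (I_ideal 2 l1 l2)"
proof -
  define c1 where "c1 = (l1 + l2 - 1) / 2"
  define c3 where "c3 = (l1 + l2 + 1) / 2"
  define f where "f = lift_NA (separated c1 c3 Y Z)"
  have f: "f \<in> Cinf_GL4" "left_equivariant char_II f" "right_invariant f"
    by (simp_all add: f_def lift_separated_Cinf sm lift_NA_equivariant)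
  note C = R_real_Cinf[OF f(1)]
  have fa: "f (pt u a) = separated c1 c3 Y Z a" if "\<forall>i. 0 < a $ i" for u a
    unfolding f_def by (rule lift_NA_pt[OF that])
  have d1: "E 1 1 f (pt u a) = separated c1 c3 (\<lambda>y. c1 * Y y - Y1 y) Z a"
    "E 2 2 f (pt u a) = separated c1 c3 (\<lambda>y. c1 * Y y + Y1 y) Z a"
    "E 3 3 f (pt u a) = separated c1 c3 Y (\<lambda>z. c3 * Z z - Z1 z) a"
    "E 4 4 f (pt u a) = separated c1 c3 Y (\<lambda>z. c3 * Z z + Z1 z) a" if a: "\<forall>i. 0 < a $ i" for u a
    by (rule diagonal_action_on_separated[OF f(1) fa Y(1) Z(1) a]; assumption)+
  define Y2 where "Y2 y = Y1 y - Y y / 4 + (\<nu>\<^sup>2 + of_real ((2 * pi * y)\<^sup>2)) * Y y" for y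
  define Z2 where "Z2 z = Z1 z - Z z / 4 + (\<nu>\<^sup>2 + of_real ((2 * pi * z)\<^sup>2)) * Z z" for z
  have lin: "((\<lambda>y. c * A y - A1 y) has_vector_derivative (c * A1 y - A2 y) / of_real y) (at y)"
    "((\<lambda>y. c * A y + A1 y) has_vector_derivative (c * A1 y + A2 y) / of_real y) (at y)"
    if "(A has_vector_derivative A1 y / of_real y) (at y)" "(A1 has_vector_derivative A2 y / of_real y) (at y)"
    for A A1 A2 :: "real \<Rightarrow> complex" and c y
  proof -
    show "((\<lambda>y. c * A y - A1 y) has_vector_derivative (c * A1 y - A2 y) / of_real y) (at y)"
      by (rule has_vector_derivative_eq_rhs[OF has_vector_derivative_diff[OF has_vector_derivative_mult_right[OF that(1)] that(2)]])
        (simp add: diff_divide_distrib)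
    show "((\<lambda>y. c * A y + A1 y) has_vector_derivative (c * A1 y + A2 y) / of_real y) (at y)"
      by (rule has_vector_derivative_eq_rhs[OF has_vector_derivative_add[OF has_vector_derivative_mult_right[OF that(1)] that(2)]])
        (simp add: add_divide_distrib)
  qed
  have Yl: "((\<lambda>y. c * Y y - Y1 y) has_vector_derivative (c * Y1 y - Y2 y) / of_real y) (at y)"
    "((\<lambda>y. c * Y y + Y1 y) has_vector_derivative (c * Y1 y + Y2 y) / of_real y) (at y)" if "y > 0" for c y
    using lin[where A=Y and ?A1.0=Y1 and ?A2.0=Y2 and y=y, OF Y(1)[OF that] Y(2)[OF that, folded Y2_def]] .
  have Zl: "((\<lambda>z. c * Z z - Z1 z) has_vector_derivative (c * Z1 z - Z2 z) / of_real z) (at z)"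
    "((\<lambda>z. c * Z z + Z1 z) has_vector_derivative (c * Z1 z + Z2 z) / of_real z) (at z)" if "z > 0" for c z
    using lin[where A=Z and ?A1.0=Z1 and ?A2.0=Z2 and y=z, OF Z(1)[OF that] Z(2)[OF that, folded Z2_def]] .
  have d2: "E 1 1 (E 1 1 f) (pt u a) = separated c1 c3 (\<lambda>y. c1 * (c1 * Y y - Y1 y) - (c1 * Y1 y - Y2 y)) Z a"
    "E 2 2 (E 2 2 f) (pt u a) = separated c1 c3 (\<lambda>y. c1 * (c1 * Y y + Y1 y) + (c1 * Y1 y + Y2 y)) Z a"
    "E 3 3 (E 3 3 f) (pt u a) = separated c1 c3 Y (\<lambda>z. c3 * (c3 * Z z - Z1 z) - (c3 * Z1 z - Z2 z)) a"
    "E 4 4 (E 4 4 f) (pt u a) = separated c1 c3 Y (\<lambda>z. c3 * (c3 * Z z + Z1 z) + (c3 * Z1 z + Z2 z)) a"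
    if a: "\<forall>i. 0 < a $ i" for u a
    by (rule diagonal_action_on_separated(1)[where Y="\<lambda>y. c1 * Y y - Y1 y" and ?Y1.0="\<lambda>y. c1 * Y1 y - Y2 y", OF C d1(1) Yl(1) Z(1) a]
          diagonal_action_on_separated(2)[where Y="\<lambda>y. c1 * Y y + Y1 y" and ?Y1.0="\<lambda>y. c1 * Y1 y + Y2 y", OF C d1(2) Yl(2) Z(1) a]
          diagonal_action_on_separated(3)[where Z="\<lambda>z. c3 * Z z - Z1 z" and ?Z1.0="\<lambda>z. c3 * Z1 z - Z2 z", OF C d1(3) Y(1) Zl(1) a]
          diagonal_action_on_separated(4)[where Z="\<lambda>z. c3 * Z z + Z1 z" and ?Z1.0="\<lambda>z. c3 * Z1 z + Z2 z", OF C d1(4) Y(1) Zl(2) a]; assumption)+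
  have E32: "E 3 2 f (pt u a) = 0" "E 3 2 (E 3 2 f) (pt u a) = 0" "E 3 2 (E 2 2 f) (pt u a) = 0" "E 3 2 (E 3 3 f) (pt u a) = 0"
    if a: "\<forall>i. 0 < a $ i" for u a
  proof -
    show *: "E 3 2 f (pt u a) = 0" for u by (rule E_32_vanishes[OF f(1,2) a fa[OF a]])
    show "E 3 2 (E 3 2 f) (pt u a) = 0" by (rule E_32_vanishes[OF C left_equivariant_R_real[OF f(1,2)] a *])
    show "E 3 2 (E 2 2 f) (pt u a) = 0" by (rule E_32_vanishes[OF C left_equivariant_R_real[OF f(1,2)] a d1(2)[OF a]])
    show "E 3 2 (E 3 3 f) (pt u a) = 0" by (rule E_32_vanishes[OF C left_equivariant_R_real[OF f(1,2)] a d1(3)[OF a]])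
  qed
  have k: "of_nat 2 = (2::complex)" by simp
  have tr: "(\<Sum>i\<in>UNIV. E i i f (pt u a)) = (of_nat 2 * l1 + (4 - of_nat 2) * l2) * f (pt u a)" if a: "\<forall>i. 0 < a $ i" for u a
    unfolding sum_4 d1[OF a] fa[OF a] by (simp add: separated_def c1_def c3_def field_simps)
  have q: "quadratic_op (l1 + l2 + of_nat 2) (l1 * (l2 + of_nat 2)) i j f (pt u a) = 0" if a: "\<forall>i. 0 < a $ i" for u a i j
  proof -
    define y where "y = a $ 2 / a $ 1"
    define z where "z = a $ 4 / a $ 3"
    define B where "B = of_real (a $ 1 * a $ 2) powr c1 * of_real (a $ 3 * a $ 4) powr c3"
    have sep: "separated c1 c3 U V a = B * (U y * V z)" for U V by (simp add: separated_def B_def y_def z_def)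
    have sq: "(2 * of_real pi * \<i> * of_real x)\<^sup>2 = - of_real ((2 * pi * x)\<^sup>2)" for x
      by (simp add: power_mult_distrib)
    define X where "X = complex_of_real ((2 * pi * y)\<^sup>2)"
    define W where "W = complex_of_real ((2 * pi * z)\<^sup>2)"
    have 2: "Y2 y = Y1 y - Y y / 4 + (\<nu>\<^sup>2 + X) * Y y" "Z2 z = Z1 z - Z z / 4 + (\<nu>\<^sup>2 + W) * Z z"
      by (simp_all add: Y2_def Z2_def X_def W_def)
    let ?q = "\<lambda>i j. quadratic_op (l1 + l2 + of_nat 2) (l1 * (l2 + of_nat 2)) i j f (pt u a)"
    note r = radial_parts[OF f a, where u=u, folded y_def z_def, unfolded sq, folded X_def W_def]
    note v = d1[OF a, of u] d2[OF a, of u] fa[OF a, of u] E32[OF a, of u]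
    note c = c1_def c3_def \<nu>_def 2
    have "?q 1 1 = 0" "?q 2 2 = 0" "?q 3 3 = 0" "?q 4 4 = 0"
      unfolding r v sep k unfolding c by (simp_all add: field_simps power2_eq_square)
    moreover have "?q 2 1 = 0" "?q 4 3 = 0"
      unfolding r v sep k unfolding c by (simp_all add: field_simps)
    moreover have "?q 3 1 = 0" "?q 4 2 = 0" "?q 4 1 = 0" "?q 3 2 = 0"
      unfolding r v by simp_all
    ultimately show ?thesis
      using exhaust_4[of i] exhaust_4[of j] quadratic_op_symmetric[OF f(1,3)] by metis
  qed
  have "f \<in> Cinf_chi char_II (I_ideal 2 l1 l2)"
    unfolding Cinf_chi_iff ideal_annihilates_iff[OF f(1)]
    using f annihilated_if_annihilated_on_NA[OF f _ q tr] by blast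
  then show ?thesis by (simp add: f_def c1_def c3_def)
qed

lemma whittaker_in_solution_space:
  fixes l1 l2 :: complex
  defines "\<nu> \<equiv> (l1 - l2 - 2) / 2"
  assumes "f \<in> MB \<nu>" "g \<in> MB \<nu>"
  shows "whittaker l1 l2 f g \<in> Cinf_chi_NA char_II (I_ideal 2 l1 l2)"
proof -
  obtain f1 where f: "bessel_pair \<nu> f f1" using assms by (auto simp: MB_iff_bessel_pair)
  obtain g1 where g: "bessel_pair \<nu> g g1" using assms by (auto simp: MB_iff_bessel_pair)
  let ?Y = "\<lambda>y. of_real y powr (1/2) * f (2 * pi * y)" and ?Z = "\<lambda>y. of_real y powr (1/2) * g (2 * pi * y)"
  have sm: "smooth_on {0<..} (\<lambda>y. of_real y powr (1/2) * f (2 * pi * y))" if "bessel_pair \<nu> f f1" for f f1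
    by (intro smooth_on_complex_mult smooth_on_cpowr
        smooth_on_compose_real[OF _ smooth_on_bounded_linear[OF _ bounded_linear_mult_right] _ smooth_on_bessel_pair[OF that]]) auto
  define h where "h = lift_NA (separated ((l1 + l2 - 1) / 2) ((l1 + l2 + 1) / 2) ?Y ?Z)"
  have "h \<in> Cinf_chi char_II (I_ideal 2 l1 l2)"
    unfolding h_def
    by (rule lift_separated_in_Cinf_chi[OF sm[OF f] sm[OF g] radial_of_bessel_pair(1,2)[OF f[unfolded \<nu>_def]]
            radial_of_bessel_pair(1,2)[OF g[unfolded \<nu>_def]]]; assumption)
  moreover have "Xi_II h = whittaker l1 l2 f g"
  proof (rule ext)
    fix p :: "real \<times> (real ^ 4)"
    obtain u a where p: "p = (u, a)" by (cases p)
    show "Xi_II h p = whittaker l1 l2 f g p"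
      unfolding p Xi_II_pt whittaker_def h_def by (simp add: lift_NA_pt separated_def x_of_a_def Let_def mult_ac)
  qed
  ultimately show ?thesis unfolding Cinf_chi_NA_def by (auto intro!: image_eqI[of _ _ h])
qed

section \<open>The solution space\<close>

lemma bessel_pair_zero_extension:
  "bessel_pair \<nu> f f1 \<Longrightarrow> bessel_pair \<nu> (\<lambda>x. if x > 0 then f x else 0) f1"
  unfolding bessel_pair_def
  by (auto intro: has_vector_derivative_transform_within_open[where S="{0<..}"])

text \<open>A vanishing combination has vanishing derivative, so that the Wronskian would be zero.\<close>
lemma bessel_pair_independent:
  assumes p: "bessel_pair \<nu> I I1" "bessel_pair \<nu> K K1" and W: "\<And>x. x > 0 \<Longrightarrow> I x * K1 x - I1 x * K x = 1"
    and \<epsilon>: "\<epsilon> \<ge> 0" and zero: "\<And>x. x > \<epsilon> \<Longrightarrow> a * I x + b * K x = 0"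
  shows "a = 0" "b = 0"
proof -
  let ?x = "\<epsilon> + 1"
  have x: "?x > 0" using \<epsilon> by simp
  have "((\<lambda>x. a * I x + b * K x) has_vector_derivative (a * I1 ?x + b * K1 ?x) / of_real ?x) (at ?x)"
    by (rule bessel_pairD(1)[OF bessel_pair_lincomb[OF p] x])
  moreover have "((\<lambda>x. a * I x + b * K x) has_vector_derivative 0) (at ?x)"
    by (rule has_vector_derivative_transform_within_open[of "\<lambda>x. 0" _ _ "{\<epsilon><..}"]) (auto simp: zero)
  ultimately have "(a * I1 ?x + b * K1 ?x) / of_real ?x = 0" by (rule vector_derivative_unique_at)
  moreover have "complex_of_real ?x \<noteq> 0" using x by (metis of_real_eq_0_iff less_irrefl)
  ultimately have 1: "a * I1 ?x + b * K1 ?x = 0" by (metis divide_eq_0_iff)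
  have 0: "a * I ?x + b * K ?x = 0" by (rule zero) simp
  have "a * (I ?x * K1 ?x - I1 ?x * K ?x) = 0" "b * (I ?x * K1 ?x - I1 ?x * K ?x) = 0"
    using 0 1 by algebra+
  then show "a = 0" "b = 0" unfolding W[OF x] by simp_all
qed

text \<open>For fixed \<open>z\<close> the function \<open>w\<close> is \<open>\<alpha>(z) I + \<beta>(z) K\<close>. Evaluating at two points \<open>y1\<close>, \<open>y2\<close> with
  nonzero determinant expresses \<open>\<alpha>\<close> and \<open>\<beta>\<close> through \<open>w y1\<close> and \<open>w y2\<close>, which are themselves
  combinations of \<open>I\<close> and \<open>K\<close>.\<close>
lemma bessel_tensor_decomposition:
  assumes p: "bessel_pair \<nu> I I1" "bessel_pair \<nu> K K1" and W: "\<And>x. x > 0 \<Longrightarrow> I x * K1 x - I1 x * K x = 1"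
    and y: "\<And>z. z > 0 \<Longrightarrow> \<exists>f1. bessel_pair \<nu> (\<lambda>y. w y z) f1"
    and z: "\<And>y. y > 0 \<Longrightarrow> \<exists>f1. bessel_pair \<nu> (\<lambda>z. w y z) f1"
  obtains c1 c2 c3 c4 where "\<And>y z. y > 0 \<Longrightarrow> z > 0 \<Longrightarrow>
    w y z = c1 * (I y * I z) + c2 * (I y * K z) + c3 * (K y * I z) + c4 * (K y * K z)"
proof -
  obtain y1 y2 where Y: "y1 > 0" "y2 > 0" "I y1 * K y2 - I y2 * K y1 \<noteq> 0"
  proof (rule ccontr)
    assume "\<not> thesis"
    with that have *: "\<And>y1 y2. y1 > 0 \<Longrightarrow> y2 > 0 \<Longrightarrow> I y1 * K y2 - I y2 * K y1 = 0" by blast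
    have "- K 1 * I y + I 1 * K y = 0" if "y > 0" for y using *[OF zero_less_one that] by (simp add: algebra_simps)
    from bessel_pair_independent[OF p W order.refl this] have "K 1 = 0" "I 1 = 0" by simp_all
    then show False using W[of 1] by simp
  qed
  let ?D = "I y1 * K y2 - I y2 * K y1"
  obtain f1 where f1: "bessel_pair \<nu> (\<lambda>z. w y1 z) f1" using z[OF Y(1)] by blast
  obtain f2 where f2: "bessel_pair \<nu> (\<lambda>z. w y2 z) f2" using z[OF Y(2)] by blast
  obtain p1 q1 where 1: "\<And>z. z > 0 \<Longrightarrow> w y1 z = p1 * I z + q1 * K z"
    using bessel_pair_in_span[OF p W f1] by metis
  obtain p2 q2 where 2: "\<And>z. z > 0 \<Longrightarrow> w y2 z = p2 * I z + q2 * K z"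
    using bessel_pair_in_span[OF p W f2] by metis
  have "w y z = ((p1 * K y2 - p2 * K y1) / ?D) * (I y * I z) + ((q1 * K y2 - q2 * K y1) / ?D) * (I y * K z)
      + ((p2 * I y1 - p1 * I y2) / ?D) * (K y * I z) + ((q2 * I y1 - q1 * I y2) / ?D) * (K y * K z)"
    if yz: "y > 0" "z > 0" for y z
  proof -
    obtain f3 where f3: "bessel_pair \<nu> (\<lambda>y. w y z) f3" using y[OF yz(2)] by blast
    obtain a b where ab: "\<And>y. y > 0 \<Longrightarrow> w y z = a * I y + b * K y"
      using bessel_pair_in_span[OF p W f3] by metis
    have e: "a * I y1 + b * K y1 = p1 * I z + q1 * K z" "a * I y2 + b * K y2 = p2 * I z + q2 * K z"
      using ab[OF Y(1)] ab[OF Y(2)] 1[OF yz(2)] 2[OF yz(2)] by simp_all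
    have "w y z * ?D = (p1 * K y2 - p2 * K y1) * (I y * I z) + (q1 * K y2 - q2 * K y1) * (I y * K z)
      + (p2 * I y1 - p1 * I y2) * (K y * I z) + (q2 * I y1 - q1 * I y2) * (K y * K z)"
      unfolding ab[OF yz(1)] using e by algebra
    then have "w y z = ((p1 * K y2 - p2 * K y1) * (I y * I z) + (q1 * K y2 - q2 * K y1) * (I y * K z)
      + (p2 * I y1 - p1 * I y2) * (K y * I z) + (q2 * I y1 - q1 * I y2) * (K y * K z)) / ?D"
      using Y(3) by (simp add: eq_divide_eq)
    then show ?thesis by (simp only: add_divide_distrib times_divide_eq_left)
  qed
  then show ?thesis using that by blast
qed

lemma Cinf_chi_add:
  assumes "f \<in> Cinf_chi char_II J" "h \<in> Cinf_chi char_II J"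
  shows "(\<lambda>g. f g + h g) \<in> Cinf_chi char_II J"
proof -
  note f = assms[unfolded Cinf_chi_iff]
  have "R_U X (\<lambda>g. f g + h g) g = R_U X f g + R_U X h g" for X g
    using f by (simp add: R_U_def R_free_arg_add)
  then show ?thesis
    using f unfolding Cinf_chi_iff left_equivariant_def right_invariant_def by (simp add: Cinf_add distrib_left)
qed

lemma Cinf_chi_cmult:
  assumes "f \<in> Cinf_chi char_II J"
  shows "(\<lambda>g. c * f g) \<in> Cinf_chi char_II J"
proof -
  note f = assms[unfolded Cinf_chi_iff]
  have "R_U X (\<lambda>g. c * f g) g = c * R_U X f g" for X g
    using f by (simp add: R_U_def R_free_arg_cmult)
  then show ?thesis
    using f unfolding Cinf_chi_iff left_equivariant_def right_invariant_def by (simp add: Cinf_cmult mult.left_commute)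
qed

lemma subspace_Cinf_chi_NA: "cfun.subspace (Cinf_chi_NA char_II J)"
  unfolding cfun.subspace_def
proof (intro conjI ballI allI)
  have "Xi_II (\<lambda>g. 0) = 0" by (auto simp: Xi_II_def fun_eq_iff)
  then show "0 \<in> Cinf_chi_NA char_II J"
    unfolding Cinf_chi_NA_def by (rule image_eqI[OF sym Cinf_zero_in_Cinf_chi])
next
  fix F H assume "F \<in> Cinf_chi_NA char_II J" "H \<in> Cinf_chi_NA char_II J"
  then obtain f h where "f \<in> Cinf_chi char_II J" "h \<in> Cinf_chi char_II J" "F = Xi_II f" "H = Xi_II h"
    by (auto simp: Cinf_chi_NA_def)
  moreover have "Xi_II (\<lambda>g. f g + h g) = Xi_II f + Xi_II h" by (auto simp: Xi_II_def fun_eq_iff)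
  ultimately show "F + H \<in> Cinf_chi_NA char_II J"
    unfolding Cinf_chi_NA_def by (intro image_eqI[where x="\<lambda>g. f g + h g"] Cinf_chi_add) simp_all
next
  fix c F assume "F \<in> Cinf_chi_NA char_II J"
  then obtain f where "f \<in> Cinf_chi char_II J" "F = Xi_II f" by (auto simp: Cinf_chi_NA_def)
  moreover have "Xi_II (\<lambda>g. c * f g) = (\<lambda>x. c * Xi_II f x)" by (auto simp: Xi_II_def fun_eq_iff)
  ultimately show "(\<lambda>x. c * F x) \<in> Cinf_chi_NA char_II J"
    unfolding Cinf_chi_NA_def by (intro image_eqI[where x="\<lambda>g. c * f g"] Cinf_chi_cmult) simp_all
qed

lemma whittaker_chart:
  assumes "y > 0" "z > 0"
  shows "whittaker l1 l2 f g (u, chart 1 1 y z) = of_real y powr (1/2) * of_real z powr (1/2) * (f (2 * pi * y) * g (2 * pi * z))"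
proof -
  have "chart 1 1 y z $ 1 * chart 1 1 y z $ 2 = 1" "chart 1 1 y z $ 3 * chart 1 1 y z $ 4 = 1"
    using assms by (simp_all add: chart_def powr_add[symmetric])
  then show ?thesis
    using chart_pos[OF zero_less_one zero_less_one assms] chart_ratio[OF zero_less_one zero_less_one assms]
    by (simp add: whittaker_def x_of_a_def Let_def mult_ac)
qed

lemma in_x_whittaker:
  assumes "\<forall>i. 0 < x $ i"
  shows "in_x (whittaker l1 l2 f g) (x, u) = of_real (x $ 1) powr ((l1 + l2 - 1) / 2) * of_real (x $ 2) powr (1 / 2) *
       of_real (x $ 3) powr ((l1 + l2 + 1) / 2) * of_real (x $ 4) powr (1 / 2) *
       (f (2 * pi * x $ 2) * g (2 * pi * x $ 4))"
proof -
  have "\<forall>i. 0 < a_of_x x $ i" using assms by (simp add: forall_4 a_of_x_def)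
  then show ?thesis by (simp add: in_x_def whittaker_def x_of_a_of_x[OF assms] Let_def)
qed

lemma norm_in_x_whittaker:
  assumes "\<forall>i. 0 < x $ i"
  shows "norm (in_x (whittaker l1 l2 f g) (x, u)) = x $ 1 powr Re ((l1 + l2 - 1) / 2) * x $ 3 powr Re ((l1 + l2 + 1) / 2) *
    (sqrt (x $ 2) * norm (f (2 * pi * x $ 2))) * (sqrt (x $ 4) * norm (g (2 * pi * x $ 4)))"
proof -
  have "x $ i \<ge> 0" for i using assms by (simp add: less_imp_le)
  then show ?thesis
    unfolding in_x_whittaker[OF assms] norm_mult
    by (simp add: norm_powr_real_powr powr_half_sqrt mult_ac)
qed

lemma powr_le_power:
  fixes t \<alpha> \<epsilon> :: real
  assumes "t > 0" "0 \<le> \<alpha> \<or> (\<epsilon> > 0 \<and> \<epsilon> < t)"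
  shows "t powr \<alpha> \<le> max 1 (\<epsilon> powr \<alpha>) * (1 + t) ^ nat \<lceil>\<bar>\<alpha>\<bar>\<rceil>"
proof (cases "0 \<le> \<alpha>")
  case True
  have "t powr \<alpha> \<le> (1 + t) powr \<alpha>" using assms True by (intro powr_mono2) auto
  also have "\<dots> \<le> (1 + t) powr real (nat \<lceil>\<bar>\<alpha>\<bar>\<rceil>)" using assms True by (intro powr_mono) (auto simp: le_nat_iff)
  also have "\<dots> = 1 * (1 + t) ^ nat \<lceil>\<bar>\<alpha>\<bar>\<rceil>" using assms by (subst powr_realpow) simp_all
  also have "\<dots> \<le> max 1 (\<epsilon> powr \<alpha>) * (1 + t) ^ nat \<lceil>\<bar>\<alpha>\<bar>\<rceil>" using assms by (intro mult_right_mono) auto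
  finally show ?thesis .
next
  case False
  then have e: "\<epsilon> > 0" "\<epsilon> < t" using assms by auto
  have "t powr \<alpha> \<le> \<epsilon> powr \<alpha>" using e False by (intro powr_mono2') auto
  also have "\<dots> \<le> max 1 (\<epsilon> powr \<alpha>) * 1" by simp
  also have "\<dots> \<le> max 1 (\<epsilon> powr \<alpha>) * (1 + t) ^ nat \<lceil>\<bar>\<alpha>\<bar>\<rceil>" using assms by (intro mult_left_mono one_le_power) auto
  finally show ?thesis .
qed

text \<open>The factors \<open>sqrt x\<^sub>2 K(2 \<pi> x\<^sub>2)\<close> and \<open>sqrt x\<^sub>4 K(2 \<pi> x\<^sub>4)\<close> are bounded. The powers of \<open>x\<^sub>1\<close>
  and \<open>x\<^sub>3\<close> grow polynomially, provided that the variable stays away from \<open>0\<close> or that the real part of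
  the exponent is not negative.\<close>
lemma whittaker_slowly_increasing:
  assumes \<epsilon>: "\<epsilon> \<ge> 0" "\<epsilon> > 0 \<or> 1 \<le> Re (l1 + l2)"
    and K: "\<And>x. x > 2 * pi * \<epsilon> \<Longrightarrow> sqrt x * norm (K x) \<le> C"
  shows "slowly_increasing_on (xu_domain \<epsilon>) (in_x (whittaker l1 l2 K K))"
proof -
  define \<alpha> where "\<alpha> = Re ((l1 + l2 - 1) / 2)"
  define \<beta> where "\<beta> = Re ((l1 + l2 + 1) / 2)"
  have \<alpha>\<beta>: "0 \<le> \<alpha> \<or> \<epsilon> > 0" "0 \<le> \<beta> \<or> \<epsilon> > 0" using \<epsilon>(2) by (auto simp: \<alpha>_def \<beta>_def)
  define M where "M = nat \<lceil>\<bar>\<alpha>\<bar>\<rceil>"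
  define M' where "M' = nat \<lceil>\<bar>\<beta>\<bar>\<rceil>"
  have C: "C \<ge> 0" using order_trans[OF _ K[of "2 * pi * \<epsilon> + 1"]] \<epsilon>(1) by simp
  have Kt: "sqrt t * norm (K (2 * pi * t)) \<le> C" if "t > \<epsilon>" for t
  proof -
    have t: "t > 0" using that \<epsilon> by simp
    have "1 * t \<le> 2 * pi * t" using t pi_gt_zero pi_ge_two by (intro mult_right_mono) auto
    then have "sqrt t * norm (K (2 * pi * t)) \<le> sqrt (2 * pi * t) * norm (K (2 * pi * t))"
      by (intro mult_right_mono) auto
    also have "\<dots> \<le> C" using that by (intro K) simp
    finally show ?thesis .
  qed
  have "norm (in_x (whittaker l1 l2 K K) p) / (1 + norm p) ^ (M + M') \<le> max 1 (\<epsilon> powr \<alpha>) * max 1 (\<epsilon> powr \<beta>) * C * C"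
    if p: "p \<in> xu_domain \<epsilon>" for p
  proof -
    obtain x u where xu: "p = (x, u)" "\<And>i. \<epsilon> < x $ i" using p by (auto simp: xu_domain_def)
    have pos: "0 < x $ i" for i using xu(2)[of i] \<epsilon>(1) by simp
    have le: "1 + x $ i \<le> 1 + norm p" for i
    proof -
      have "x $ i \<le> norm x" using component_le_norm_cart[of x i] by simp
      also have "\<dots> \<le> norm p" unfolding xu(1) norm_Pair by (rule real_sqrt_ge_abs1[THEN order_trans[rotated]]) simp
      finally show ?thesis by simp
    qed
    have bd: "x $ i powr \<gamma> \<le> max 1 (\<epsilon> powr \<gamma>) * (1 + norm p) ^ nat \<lceil>\<bar>\<gamma>\<bar>\<rceil>" if "0 \<le> \<gamma> \<or> \<epsilon> > 0" for i \<gamma>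
    proof -
      have "x $ i powr \<gamma> \<le> max 1 (\<epsilon> powr \<gamma>) * (1 + x $ i) ^ nat \<lceil>\<bar>\<gamma>\<bar>\<rceil>"
        using that pos xu(2) by (intro powr_le_power) auto
      also have "\<dots> \<le> max 1 (\<epsilon> powr \<gamma>) * (1 + norm p) ^ nat \<lceil>\<bar>\<gamma>\<bar>\<rceil>"
        using pos[of i] le[of i] by (intro mult_left_mono power_mono) auto
      finally show ?thesis .
    qed
    have "norm (in_x (whittaker l1 l2 K K) p) \<le> (max 1 (\<epsilon> powr \<alpha>) * (1 + norm p) ^ M) * (max 1 (\<epsilon> powr \<beta>) * (1 + norm p) ^ M') * C * C"
      unfolding xu(1) norm_in_x_whittaker[OF allI[OF pos]] unfolding xu(1)[symmetric] \<alpha>_def[symmetric] \<beta>_def[symmetric] M_def M'_def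
      using C pos by (intro mult_mono bd Kt xu(2) \<alpha>\<beta> mult_nonneg_nonneg) (auto simp: less_imp_le)
    then have "norm (in_x (whittaker l1 l2 K K) p) \<le> max 1 (\<epsilon> powr \<alpha>) * max 1 (\<epsilon> powr \<beta>) * C * C * (1 + norm p) ^ (M + M')"
      by (simp add: power_add mult_ac)
    moreover have "(1 + norm p) ^ (M + M') > 0" by (intro zero_less_power) (simp add: add_pos_nonneg)
    ultimately show ?thesis by (simp only: pos_divide_le_eq)
  qed
  then show ?thesis
    unfolding slowly_increasing_on_def by (intro exI[of _ "M + M'"] bdd_aboveI2)
qed

lemma exp_not_polynomially_bounded:
  assumes a: "a > (0::real)" and bound: "\<And>y. y > 1 \<Longrightarrow> a * exp y - b \<le> c * (d + y) ^ M"
  shows False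
proof -
  have "((\<lambda>s. c * (s ^ M / exp s) + b * inverse (exp s)) \<longlongrightarrow> c * 0 + b * 0) at_top"
    by (intro tendsto_intros tendsto_power_div_exp_0 tendsto_inverse_0_at_top exp_at_top)
  then have lim: "((\<lambda>s. c * (s ^ M / exp s) + b * inverse (exp s)) \<longlongrightarrow> 0) at_top" by simp
  have "a * exp (- d) \<le> 0"
  proof (rule tendsto_lowerbound[OF lim])
    show "\<forall>\<^sub>F s in at_top. a * exp (- d) \<le> c * (s ^ M / exp s) + b * inverse (exp s)"
      using eventually_gt_at_top[of "d + 1"]
    proof eventually_elim
      case (elim s)
      have "a * exp (s - d) \<le> c * s ^ M + b" using bound[of "s - d"] elim by simp
      then have "a * exp (s - d) / exp s \<le> (c * s ^ M + b) / exp s" by (intro divide_right_mono) auto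
      moreover have "a * exp (s - d) / exp s = a * exp (- d)" by (simp add: exp_diff exp_minus divide_inverse)
      ultimately have "a * exp (- d) \<le> (c * s ^ M + b) / exp s" by (simp only:)
      then show ?case by (simp only: divide_inverse distrib_right mult.assoc)
    qed
  qed simp
  then show False using a by (simp add: mult_le_0_iff)
qed

lemma slowly_increasing_subset:
  "slowly_increasing_on D F \<Longrightarrow> D' \<subseteq> D \<Longrightarrow> slowly_increasing_on D' F"
  unfolding slowly_increasing_on_def by (meson bdd_above_mono image_mono)

section \<open>Dimension and growth\<close>

text \<open>The solutions of \<open>bessel_fundamental_system\<close>, extended by zero so that they lie in \<open>MB \<nu>\<close>.\<close>
locale bessel_basis =
  fixes l1 l2 \<nu> :: complex and I I1 K K1 :: "real \<Rightarrow> complex" and x0 \<delta> C :: real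
  assumes \<nu>: "\<nu> = (l1 - l2 - 2) / 2"
    and pI: "bessel_pair \<nu> I I1" and pK: "bessel_pair \<nu> K K1"
    and W: "\<And>x. x > 0 \<Longrightarrow> I x * K1 x - I1 x * K x = 1"
    and zI: "\<And>x. x \<le> 0 \<Longrightarrow> I x = 0" and zK: "\<And>x. x \<le> 0 \<Longrightarrow> K x = 0"
    and x0: "x0 > 0" and \<delta>: "\<delta> > 0" and Igrow: "\<And>x. x \<ge> x0 \<Longrightarrow> \<delta> * exp (x / 2) \<le> sqrt x * norm (I x)"
    and Kbd: "\<And>x. x \<ge> x0 \<Longrightarrow> sqrt x * norm (K x) \<le> C"
    and Kbd0: "\<bar>Re \<nu>\<bar> \<le> 1/2 \<Longrightarrow> \<exists>C. \<forall>x>0. sqrt x * norm (K x) \<le> C"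
begin

abbreviation V where "V \<equiv> Cinf_chi_NA char_II (I_ideal 2 l1 l2)"

abbreviation wh where "wh \<equiv> whittaker l1 l2"

lemma IK_in_MB: "I \<in> MB \<nu>" "K \<in> MB \<nu>"
  using pI pK zI zK by (auto simp: MB_iff_bessel_pair)

definition basis_comb :: "complex \<Rightarrow> complex \<Rightarrow> complex \<Rightarrow> complex \<Rightarrow> real \<times> (real ^ 4) \<Rightarrow> complex" where
  "basis_comb c1 c2 c3 c4 p = c1 * wh I I p + c2 * wh I K p + c3 * wh K I p + c4 * wh K K p"

lemma V_subset_basis_comb:
  assumes "F \<in> V"
  obtains c1 c2 c3 c4 where "F = basis_comb c1 c2 c3 c4"
proof -
  obtain f where f: "f \<in> Cinf_chi char_II (I_ideal 2 l1 l2)" and F: "F = Xi_II f"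
    using assms by (auto simp: Cinf_chi_NA_def)
  define w where "w Y Z = of_real ((Y / (2 * pi)) powr (- 1/2)) * (of_real ((Z / (2 * pi)) powr (- 1/2)) *
     profile f (Y / (2 * pi)) (Z / (2 * pi)))" for Y Z
  have sc: "\<exists>g1. bessel_pair \<nu> (\<lambda>x. c * g x) g1" if ex: "\<exists>g1. bessel_pair \<nu> g g1" for g and c
  proof -
    obtain g1 where "bessel_pair \<nu> g g1" using ex by blast
    from bessel_pair_lincomb[OF this this, of c 0] show ?thesis by auto
  qed
  have wy: "\<exists>g1. bessel_pair \<nu> (\<lambda>Y. w Y Z) g1" if "Z > 0" for Z
  proof -
    have "\<exists>g1. bessel_pair \<nu> (\<lambda>Y. of_real ((Z / (2 * pi)) powr (- 1/2)) *
        (of_real ((Y / (2 * pi)) powr (- 1/2)) * profile f (Y / (2 * pi)) (Z / (2 * pi)))) g1"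
      using that unfolding \<nu> by (intro sc[unfolded \<nu>] profile_bessel(1)[OF f]) simp
    then show ?thesis unfolding w_def by (simp only: mult.left_commute)
  qed
  have wz: "\<exists>g1. bessel_pair \<nu> (\<lambda>Z. w Y Z) g1" if "Y > 0" for Y
    using that unfolding w_def \<nu> by (intro sc[unfolded \<nu>] profile_bessel(2)[OF f]) simp
  obtain c1 c2 c3 c4 where c: "\<And>y z. y > 0 \<Longrightarrow> z > 0 \<Longrightarrow>
    w y z = c1 * (I y * I z) + c2 * (I y * K z) + c3 * (K y * I z) + c4 * (K y * K z)"
    by (rule bessel_tensor_decomposition[OF pI pK W wy wz]) (assumption | rule that | blast)+
  have "F (u, a) = basis_comb c1 c2 c3 c4 (u, a)" for u a
  proof (cases "\<forall>i. 0 < a $ i")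
    case True
    then have ap: "a $ i > 0" for i by simp
    define y where "y = a $ 2 / a $ 1"
    define z where "z = a $ 4 / a $ 3"
    have yz: "y > 0" "z > 0" using ap by (simp_all add: y_def z_def)
    have half: "complex_of_real (t powr (- 1/2)) * of_real t powr (1/2) = 1" if "t > 0" for t
    proof -
      have "complex_of_real t powr (1/2) = of_real (t powr (1/2))" using that powr_of_real[of t "1/2"] by simp
      then show ?thesis using that by (simp add: powr_add[symmetric] flip: of_real_mult)
    qed
    have "profile f y z = (of_real (y powr (- 1/2)) * of_real y powr (1/2)) * (of_real (z powr (- 1/2)) * of_real z powr (1/2)) * profile f y z"
      by (simp only: half yz mult_1_left)
    also have "\<dots> = of_real y powr (1/2) * of_real z powr (1/2) * w (2 * pi * y) (2 * pi * z)"
      by (simp add: w_def mult_ac)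
    finally have pr: "profile f y z = of_real y powr (1/2) * of_real z powr (1/2) * w (2 * pi * y) (2 * pi * z)" .
    have cw: "w (2 * pi * y) (2 * pi * z) = c1 * (I (2 * pi * y) * I (2 * pi * z)) + c2 * (I (2 * pi * y) * K (2 * pi * z))
      + c3 * (K (2 * pi * y) * I (2 * pi * z)) + c4 * (K (2 * pi * y) * K (2 * pi * z))"
      by (rule c) (use yz in simp_all)
    define B where "B = of_real (a $ 1 * a $ 2) powr ((l1 + l2 - 1) / 2) * of_real (a $ 3 * a $ 4) powr ((l1 + l2 + 1) / 2)"
    have wh: "wh g h (u, a) = B * (of_real y powr (1/2) * of_real z powr (1/2)) * (g (2 * pi * y) * h (2 * pi * z))" for g h
      using True by (simp add: whittaker_def x_of_a_def Let_def B_def y_def z_def mult_ac)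
    have "F (u, a) = B * profile f y z"
      using True separation_of_scalings[OF f True] by (simp add: F Xi_II_pt B_def y_def z_def)
    then show ?thesis unfolding basis_comb_def wh pr cw by (simp only: distrib_left mult_ac)
  next
    case False
    then show ?thesis by (auto simp: F Xi_II_pt basis_comb_def whittaker_def)
  qed
  then show ?thesis using that by (metis ext surj_pair)
qed

lemma wh_in_V: "f \<in> MB \<nu> \<Longrightarrow> g \<in> MB \<nu> \<Longrightarrow> wh f g \<in> V"
  using whittaker_in_solution_space \<nu> by simp

abbreviation basis where "basis \<equiv> {wh I I, wh I K, wh K I, wh K K}"

lemma basis_comb_in_span: "basis_comb c1 c2 c3 c4 \<in> cspan basis"
proof -
  have "basis_comb c1 c2 c3 c4 = (\<lambda>p. c1 * wh I I p) + (\<lambda>p. c2 * wh I K p) + (\<lambda>p. c3 * wh K I p) + (\<lambda>p. c4 * wh K K p)"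
    by (simp add: fun_eq_iff basis_comb_def)
  also have "\<dots> \<in> cspan basis"
    by (intro cfun.span_add cfun.span_scale cfun.span_base) simp_all
  finally show ?thesis .
qed

lemma V_eq_spans: "V = cspan basis" "V = cspan {wh f g | f g. f \<in> MB \<nu> \<and> g \<in> MB \<nu>}"
proof -
  have 1: "V \<subseteq> cspan basis"
    using V_subset_basis_comb basis_comb_in_span by (metis subsetI)
  have 2: "cspan basis \<subseteq> cspan {wh f g | f g. f \<in> MB \<nu> \<and> g \<in> MB \<nu>}"
    by (rule cfun.span_mono) (use IK_in_MB in blast)
  have 3: "cspan {wh f g | f g. f \<in> MB \<nu> \<and> g \<in> MB \<nu>} \<subseteq> V"
    by (rule cfun.span_minimal) (use wh_in_V subspace_Cinf_chi_NA in auto)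
  show "V = cspan basis" "V = cspan {wh f g | f g. f \<in> MB \<nu> \<and> g \<in> MB \<nu>}" using 1 2 3 by blast+
qed

lemma basis_comb_chart:
  assumes "y > 0" "z > 0"
  shows "basis_comb c1 c2 c3 c4 (u, chart 1 1 y z) = of_real y powr (1/2) * of_real z powr (1/2) *
    ((c1 * I (2 * pi * z) + c2 * K (2 * pi * z)) * I (2 * pi * y) + (c3 * I (2 * pi * z) + c4 * K (2 * pi * z)) * K (2 * pi * y))"
  unfolding basis_comb_def whittaker_chart[OF assms] by algebra

lemma basis_comb_eq_0:
  assumes "basis_comb c1 c2 c3 c4 = (\<lambda>_. 0)"
  shows "c1 = 0" "c2 = 0" "c3 = 0" "c4 = 0"
proof -
  have *: "c1 * I Z + c2 * K Z = 0" "c3 * I Z + c4 * K Z = 0" if Z: "Z > 0" for Z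
  proof -
    have "(c1 * I Z + c2 * K Z) * I Y + (c3 * I Z + c4 * K Z) * K Y = 0" if Y: "Y > 0" for Y
    proof -
      have p: "Y / (2 * pi) > 0" "Z / (2 * pi) > 0" using Y Z by simp_all
      have "basis_comb c1 c2 c3 c4 (0, chart 1 1 (Y / (2 * pi)) (Z / (2 * pi))) = 0" using assms by simp
      then show ?thesis unfolding basis_comb_chart[OF p] using Y Z by simp
    qed
    from bessel_pair_independent[OF pI pK W order.refl this]
    show "c1 * I Z + c2 * K Z = 0" "c3 * I Z + c4 * K Z = 0" by simp_all
  qed
  show "c1 = 0" "c2 = 0" using bessel_pair_independent[OF pI pK W order.refl *(1)] by simp_all
  show "c3 = 0" "c4 = 0" using bessel_pair_independent[OF pI pK W order.refl *(2)] by simp_all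
qed

lemma basis_distinct:
  "wh I I \<noteq> wh I K" "wh I I \<noteq> wh K I" "wh I I \<noteq> wh K K" "wh I K \<noteq> wh K I" "wh I K \<noteq> wh K K" "wh K I \<noteq> wh K K"
  using basis_comb_eq_0[of 1 "-1" 0 0] basis_comb_eq_0[of 1 0 "-1" 0] basis_comb_eq_0[of 1 0 0 "-1"]
    basis_comb_eq_0[of 0 1 "-1" 0] basis_comb_eq_0[of 0 1 0 "-1"] basis_comb_eq_0[of 0 0 1 "-1"]
  by (auto simp: basis_comb_def[abs_def])

lemma dim_V: "cdim V = 4"
proof -
  have "cfun.independent basis"
  proof
    assume "cfun.dependent basis"
    then obtain u where u: "\<exists>v\<in>basis. u v \<noteq> 0" "(\<Sum>v\<in>basis. (\<lambda>x. u v * v x)) = 0"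
      using cfun.dependent_finite[of basis] by auto
    have "(\<Sum>v\<in>basis. (\<lambda>x. u v * v x)) = basis_comb (u (wh I I)) (u (wh I K)) (u (wh K I)) (u (wh K K))"
      using basis_distinct by (auto simp: fun_eq_iff basis_comb_def add.assoc)
    then have "basis_comb (u (wh I I)) (u (wh I K)) (u (wh K I)) (u (wh K K)) = (\<lambda>_. 0)"
      using u(2) by (simp add: zero_fun_def)
    from basis_comb_eq_0[OF this] u(1) show False by auto
  qed
  then have "cdim (cspan basis) = card basis"
    by (metis cfun.dim_span_eq_card_independent)
  also have "card basis = 4" using basis_distinct by simp
  finally show ?thesis using V_eq_spans(1) by simp
qed

lemma K_bounded_away_from_0:
  assumes "\<epsilon> > 0"
  obtains C' where "\<And>x. x > \<epsilon> \<Longrightarrow> sqrt x * norm (K x) \<le> C'"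
proof -
  have "continuous_on {\<epsilon>..x0} (\<lambda>x. sqrt x * norm (K x))"
    using assms by (intro continuous_intros continuous_at_imp_continuous_on ballI has_vector_derivative_continuous[OF bessel_pairD(1)[OF pK]]) auto
  then have "bounded ((\<lambda>x. sqrt x * norm (K x)) ` {\<epsilon>..x0})"
    by (intro compact_imp_bounded compact_continuous_image) simp_all
  then obtain B where B: "\<forall>y\<in>(\<lambda>x. sqrt x * norm (K x)) ` {\<epsilon>..x0}. norm y \<le> B" unfolding bounded_iff by blast
  have "sqrt x * norm (K x) \<le> max B C" if "x > \<epsilon>" for x
  proof (cases "x \<le> x0")
    case True
    then have "norm (sqrt x * norm (K x)) \<le> B" using that by (intro B[rule_format] imageI) simp
    then show ?thesis by simp
  next
    case False
    then show ?thesis using Kbd[of x] by simp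
  qed
  then show ?thesis using that by blast
qed

lemma recessive_slowly_increasing:
  "\<epsilon> > 0 \<Longrightarrow> slowly_increasing_on (xu_domain \<epsilon>) (in_x (wh K K))"
  "1 \<le> Re (l1 + l2) \<Longrightarrow> \<bar>Re \<nu>\<bar> \<le> 1/2 \<Longrightarrow> slowly_increasing_on (xu_domain 0) (in_x (wh K K))"
proof -
  assume e: "\<epsilon> > 0"
  then obtain C' where "\<And>x. x > 2 * pi * \<epsilon> \<Longrightarrow> sqrt x * norm (K x) \<le> C'"
    using K_bounded_away_from_0[of "2 * pi * \<epsilon>"] by auto
  then show "slowly_increasing_on (xu_domain \<epsilon>) (in_x (wh K K))"
    using e by (intro whittaker_slowly_increasing) auto
next
  assume "1 \<le> Re (l1 + l2)" "\<bar>Re \<nu>\<bar> \<le> 1/2"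
  then show "slowly_increasing_on (xu_domain 0) (in_x (wh K K))"
    using Kbd0 by (metis whittaker_slowly_increasing order.refl mult_zero_right)
qed

text \<open>A nonzero \<open>P\<close> would make the left hand side grow exponentially, since \<open>sqrt x K(x)\<close> is bounded.\<close>
lemma dominant_coefficient_vanishes:
  assumes bound: "\<And>y. y > 1 \<Longrightarrow> sqrt y * norm (P * I (2 * pi * y) + Q * K (2 * pi * y)) \<le> B * (d + y) ^ M"
  shows "P = 0"
proof (rule ccontr)
  assume P: "P \<noteq> 0"
  define m where "m = max 1 x0"
  let ?s = "sqrt (2 * pi)"
  have s: "?s > 0" by simp
  have b: "\<delta> * norm P * exp x' - norm Q * C \<le> (?s * B) * ((d + m) + x') ^ M" if x': "x' > 1" for x'
  proof -
    define y where "y = m + x'"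
    have m: "m \<ge> 1" "m \<ge> x0" by (simp_all add: m_def)
    have y: "y > 1" "y > 0" using m x' by (auto simp: y_def)
    have "1 * y \<le> 2 * pi * y" using y pi_ge_two by (intro mult_right_mono) auto
    moreover have "x0 \<le> y" using m x' by (simp add: y_def)
    ultimately have Y: "2 * pi * y \<ge> x0" by linarith
    have "exp x' \<le> exp (2 * pi * y / 2)"
    proof -
      have "x' \<le> 1 * y" using m by (simp add: y_def)
      also have "\<dots> \<le> pi * y" using y pi_ge_two by (intro mult_right_mono) auto
      finally show ?thesis by simp
    qed
    then have "\<delta> * norm P * exp x' \<le> \<delta> * norm P * exp (2 * pi * y / 2)" using \<delta> by (intro mult_left_mono) auto
    also have "\<dots> = norm P * (\<delta> * exp (2 * pi * y / 2))" by simp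
    also have "\<dots> \<le> norm P * (sqrt (2 * pi * y) * norm (I (2 * pi * y)))" by (intro mult_left_mono Igrow Y) simp
    also have "\<dots> = sqrt (2 * pi * y) * norm (P * I (2 * pi * y))" by (simp add: norm_mult)
    also have "\<dots> \<le> sqrt (2 * pi * y) * (norm (P * I (2 * pi * y) + Q * K (2 * pi * y)) + norm (Q * K (2 * pi * y)))"
      using norm_triangle_ineq4[of "P * I (2 * pi * y) + Q * K (2 * pi * y)" "Q * K (2 * pi * y)"] y by (intro mult_left_mono) auto
    also have "\<dots> = ?s * (sqrt y * norm (P * I (2 * pi * y) + Q * K (2 * pi * y))) + norm Q * (sqrt (2 * pi * y) * norm (K (2 * pi * y)))"
      by (simp add: real_sqrt_mult norm_mult algebra_simps)
    also have "\<dots> \<le> ?s * (B * (d + y) ^ M) + norm Q * C"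
      by (intro add_mono mult_left_mono bound y Kbd Y) (use s in auto)
    finally show ?thesis by (simp add: y_def add_ac mult_ac)
  qed
  have "\<delta> * norm P > 0" using \<delta> P by simp
  from exp_not_polynomially_bounded[OF this b] show False by blast
qed

text \<open>Let \<open>x\<^sub>2\<close> tend to infinity while the other coordinates are fixed: the coefficient of \<open>I(2 \<pi> x\<^sub>2)\<close>
  has to vanish. The same holds for \<open>I(2 \<pi> x\<^sub>4)\<close> as \<open>x\<^sub>4\<close> tends to infinity.\<close>
lemma slowly_increasing_unique:
  assumes H: "H \<in> V" and slow: "slowly_increasing_on (xu_domain 1) (in_x H)"
  shows "\<exists>c. H = (\<lambda>p. c * wh K K p)"
proof -
  obtain c1 c2 c3 c4 where Hc: "H = basis_comb c1 c2 c3 c4" using V_subset_basis_comb[OF H] by blast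
  obtain M B where "\<forall>p\<in>xu_domain 1. norm (in_x H p) / (1 + norm p) ^ M \<le> B"
    using slow by (auto simp: slowly_increasing_on_def bdd_above_def)
  then have B: "norm (in_x H p) \<le> B * (1 + norm p) ^ M" if "p \<in> xu_domain 1" for p
  proof -
    have "(1 + norm p) ^ M > 0" by (intro zero_less_power) (simp add: add_pos_nonneg)
    moreover have "norm (in_x H p) / (1 + norm p) ^ M \<le> B" using \<open>\<forall>p\<in>xu_domain 1. _\<close> that by blast
    ultimately show ?thesis by (simp only: pos_divide_le_eq)
  qed
  have B0: "B \<ge> 0"
  proof -
    have "(vector [2, 2, 2, 2], 0) \<in> xu_domain 1" by (simp add: xu_domain_def forall_4)
    then have "norm (in_x H (vector [2, 2, 2, 2], 0)) / (1 + norm (vector [2, 2, 2, 2] :: real ^ 4, 0 :: real)) ^ M \<le> B"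
      using \<open>\<forall>p\<in>xu_domain 1. _\<close> by blast
    moreover have "0 \<le> norm (in_x H (vector [2, 2, 2, 2], 0)) / (1 + norm (vector [2, 2, 2, 2] :: real ^ 4, 0 :: real)) ^ M"
      by (intro divide_nonneg_nonneg zero_le_power) simp_all
    ultimately show ?thesis by linarith
  qed
  define A where "A = norm (complex_of_real 2 powr ((l1 + l2 - 1) / 2) * of_real 2 powr ((l1 + l2 + 1) / 2))"
  have A: "A > 0" by (simp add: A_def)
  have key: "sqrt y * sqrt z * norm ((c1 * I (2 * pi * z) + c2 * K (2 * pi * z)) * I (2 * pi * y)
      + (c3 * I (2 * pi * z) + c4 * K (2 * pi * z)) * K (2 * pi * y)) \<le> B / A * (5 + z + y) ^ M"
    if yz: "y > 1" "z > 1" for y z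
  proof -
    \<comment> \<open>\<open>2\<close> is an arbitrary value for \<open>x1\<close> and \<open>x3\<close> inside the domain.\<close>
    define x :: "real ^ 4" where "x = vector [2, y, 2, z]"
    have x1: "\<forall>i. 1 < x $ i" using yz by (simp add: x_def forall_4)
    then have xp: "\<forall>i. 0 < x $ i" by (metis less_trans zero_less_one)
    have dom: "(x, 0::real) \<in> xu_domain 1" using x1 by (simp add: xu_domain_def)
    have "norm (x, 0::real) \<le> 4 + y + z"
    proof -
      have "norm (x, 0::real) = norm x" by (simp add: norm_Pair)
      also have "\<dots> \<le> (\<Sum>i\<in>UNIV. \<bar>x $ i\<bar>)" by (rule norm_le_l1_cart)
      also have "\<dots> = 4 + y + z" using yz by (simp add: sum_4 x_def)
      finally show ?thesis .
    qed
    then have "B * (1 + norm (x, 0::real)) ^ M \<le> B * (5 + z + y) ^ M"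
      using B0 by (intro mult_left_mono power_mono) auto
    with B[OF dom] have 1: "norm (in_x H (x, 0)) \<le> B * (5 + z + y) ^ M" by linarith
    have in_x_basis_comb: "in_x H (x, 0) = c1 * in_x (wh I I) (x, 0) + c2 * in_x (wh I K) (x, 0) + c3 * in_x (wh K I) (x, 0) + c4 * in_x (wh K K) (x, 0)"
      by (simp add: Hc in_x_def basis_comb_def)
    have in_x_H: "in_x H (x, 0) = (complex_of_real 2 powr ((l1 + l2 - 1) / 2) * of_real 2 powr ((l1 + l2 + 1) / 2)) *
        (of_real y powr (1/2) * of_real z powr (1/2) *
        ((c1 * I (2 * pi * z) + c2 * K (2 * pi * z)) * I (2 * pi * y)
      + (c3 * I (2 * pi * z) + c4 * K (2 * pi * z)) * K (2 * pi * y)))"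
      unfolding in_x_basis_comb in_x_whittaker[OF xp] unfolding x_def vector4 by algebra
    then have "norm (in_x H (x, 0)) = A * (sqrt y * sqrt z * norm ((c1 * I (2 * pi * z) + c2 * K (2 * pi * z)) * I (2 * pi * y)
      + (c3 * I (2 * pi * z) + c4 * K (2 * pi * z)) * K (2 * pi * y)))"
    proof -
      have "norm (complex_of_real t powr (1/2)) = sqrt t" if "t > 1" for t
        using that by (simp add: norm_powr_real_powr powr_half_sqrt)
      then show ?thesis using yz by (simp only: in_x_H A_def norm_mult)
    qed
    with 1 A show ?thesis by (simp add: field_simps)
  qed
  have sq1: "sqrt t \<ge> 1" if "t > 1" for t using that by simp
  have "c1 * I Z + c2 * K Z = 0" if Z: "Z > 2 * pi" for Z
  proof (rule dominant_coefficient_vanishes)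
    fix y :: real assume y: "y > 1"
    have z: "Z / (2 * pi) > 1" using Z by (simp add: field_simps)
    let ?n = "norm ((c1 * I Z + c2 * K Z) * I (2 * pi * y) + (c3 * I Z + c4 * K Z) * K (2 * pi * y))"
    have "sqrt y * 1 * ?n \<le> sqrt y * sqrt (Z / (2 * pi)) * ?n"
      using y sq1[OF z] by (intro mult_right_mono mult_left_mono) auto
    also have "\<dots> \<le> B / A * (5 + Z / (2 * pi) + y) ^ M" using key[OF y z] by simp
    finally show "sqrt y * ?n \<le> B / A * (5 + Z / (2 * pi) + y) ^ M" by simp
  qed
  from bessel_pair_independent[where \<epsilon>="2 * pi", OF pI pK W _ this] have c12: "c1 = 0" "c2 = 0" by simp_all
  have "c1 * I Y + c3 * K Y = 0" if Y: "Y > 2 * pi" for Y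
  proof (rule dominant_coefficient_vanishes)
    fix z :: real assume z: "z > 1"
    have y: "Y / (2 * pi) > 1" using Y by (simp add: field_simps)
    let ?n = "norm ((c1 * I Y + c3 * K Y) * I (2 * pi * z) + (c2 * I Y + c4 * K Y) * K (2 * pi * z))"
    have "(c1 * I Y + c3 * K Y) * I (2 * pi * z) + (c2 * I Y + c4 * K Y) * K (2 * pi * z) =
      (c1 * I (2 * pi * z) + c2 * K (2 * pi * z)) * I Y + (c3 * I (2 * pi * z) + c4 * K (2 * pi * z)) * K Y"
      by algebra
    then have n: "sqrt (Y / (2 * pi)) * sqrt z * ?n \<le> B / A * (5 + z + Y / (2 * pi)) ^ M" using key[OF y z] by simp
    have "1 * sqrt z * ?n \<le> sqrt (Y / (2 * pi)) * sqrt z * ?n"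
      using z sq1[OF y] by (intro mult_right_mono) auto
    also note n
    finally show "sqrt z * ?n \<le> B / A * (5 + Y / (2 * pi) + z) ^ M" by (simp add: add_ac)
  qed
  from bessel_pair_independent[where \<epsilon>="2 * pi", OF pI pK W _ this] have "c3 = 0" by simp
  with c12 have "H = (\<lambda>p. c4 * wh K K p)" by (simp add: Hc basis_comb_def[abs_def])
  then show ?thesis by blast
qed

end

theorem theorem4p28:
  fixes l\<^sub>1 l\<^sub>2 :: complex
  assumes "l\<^sub>1 - l\<^sub>2 \<notin> \<int>"
  shows
    "let ch = character (lform 0 0 0 1 0 1);
         V\<^sub>1 = Cinf_chi_NA ch (I_ideal 1 l\<^sub>1 l\<^sub>2);
         V\<^sub>2 = Cinf_chi_NA ch (I_ideal 2 l\<^sub>1 l\<^sub>2);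
         B = MB ((l\<^sub>1 - l\<^sub>2 - 2) / 2);
         D = xu_domain 0
     in V\<^sub>1 = {\<lambda>_. 0} \<and>
        V\<^sub>2 = cspan {whittaker l\<^sub>1 l\<^sub>2 f g | f g. f \<in> B \<and> g \<in> B} \<and>
        cdim V\<^sub>2 = 4 \<and>
        (\<exists>F\<in>V\<^sub>2. F \<noteq> (\<lambda>_. 0) \<and>
           (1 \<le> Re (l\<^sub>1 + l\<^sub>2) \<and> \<bar>Re (l\<^sub>1 - l\<^sub>2) - 2\<bar> \<le> 1 \<longrightarrow>
              slowly_increasing_on D (in_x F)) \<and>
           (\<forall>H\<in>V\<^sub>2. slowly_increasing_on D (in_x H) \<longrightarrow> (\<exists>c. H = (\<lambda>p. c * F p))) \<and>
           (\<forall>\<epsilon>>0. slowly_increasing_on (xu_domain \<epsilon>) (in_x F)) \<and>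
           (\<forall>H\<in>V\<^sub>2. (\<forall>\<epsilon>>0. slowly_increasing_on (xu_domain \<epsilon>) (in_x H)) \<longrightarrow>
              (\<exists>c. H = (\<lambda>p. c * F p))))"
proof -
  let ?\<nu> = "(l\<^sub>1 - l\<^sub>2 - 2) / 2"
  have "?\<nu> \<notin> \<int>"
  proof
    assume "?\<nu> \<in> \<int>"
    then have "2 * ?\<nu> + 2 \<in> \<int>" by (intro Ints_add Ints_mult) auto
    moreover have "2 * ?\<nu> + 2 = l\<^sub>1 - l\<^sub>2" by (simp add: field_simps)
    ultimately show False using assms by (simp only:)
  qed
  then obtain I I\<^sub>1 K K\<^sub>1 x\<^sub>0 \<delta> C where b: "bessel_pair ?\<nu> I I\<^sub>1" "bessel_pair ?\<nu> K K\<^sub>1"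
    "\<And>x. x > 0 \<Longrightarrow> I x * K\<^sub>1 x - I\<^sub>1 x * K x = 1"
    "x\<^sub>0 > 0" "\<delta> > 0" "\<And>x. x \<ge> x\<^sub>0 \<Longrightarrow> \<delta> * exp (x / 2) \<le> sqrt x * norm (I x)"
    "\<And>x. x \<ge> x\<^sub>0 \<Longrightarrow> sqrt x * norm (K x) \<le> C"
    "\<bar>Re ?\<nu>\<bar> \<le> 1/2 \<Longrightarrow> \<exists>C. \<forall>x>0. sqrt x * norm (K x) \<le> C"
    using bessel_fundamental_system by metis
  interpret bessel_basis l\<^sub>1 l\<^sub>2 ?\<nu> "\<lambda>x. if x > 0 then I x else 0" I\<^sub>1 "\<lambda>x. if x > 0 then K x else 0" K\<^sub>1 x\<^sub>0 \<delta> C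
    using b(3-8) by unfold_locales (auto intro: bessel_pair_zero_extension b(1,2))
  have V1: "Cinf_chi_NA char_II (I_ideal 1 l\<^sub>1 l\<^sub>2) = {\<lambda>_. 0}"
  proof -
    have n2: "l\<^sub>1 - l\<^sub>2 \<noteq> 2" using assms by auto
    have 0: "Xi_II f = (\<lambda>_. 0)" if "f \<in> Cinf_chi char_II (I_ideal 1 l\<^sub>1 l\<^sub>2)" for f
      using vanishes_unless_shift[OF that _ refl n2] by (auto simp: fun_eq_iff Xi_II_pt)
    have "(\<lambda>_. 0) \<in> Cinf_chi_NA char_II (I_ideal 1 l\<^sub>1 l\<^sub>2)"
      unfolding Cinf_chi_NA_def
      by (rule image_eqI[where f=Xi_II and x="\<lambda>g. 0", OF 0[OF Cinf_zero_in_Cinf_chi, symmetric] Cinf_zero_in_Cinf_chi])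
    moreover have "Cinf_chi_NA char_II (I_ideal 1 l\<^sub>1 l\<^sub>2) \<subseteq> {\<lambda>_. 0}"
      unfolding Cinf_chi_NA_def using 0 by (intro image_subsetI) simp
    ultimately show ?thesis by blast
  qed
  let ?F = "wh (\<lambda>x. if x > 0 then K x else 0) (\<lambda>x. if x > 0 then K x else 0)"
  have "?F \<in> V" by (rule wh_in_V[OF IK_in_MB(2,2)])
  moreover have "?F \<noteq> (\<lambda>_. 0)" using basis_comb_eq_0(4)[of 0 0 0 1] by (auto simp: basis_comb_def[abs_def])
  moreover have "1 \<le> Re (l\<^sub>1 + l\<^sub>2) \<and> \<bar>Re (l\<^sub>1 - l\<^sub>2) - 2\<bar> \<le> 1 \<longrightarrow> slowly_increasing_on (xu_domain 0) (in_x ?F)"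
  proof
    assume *: "1 \<le> Re (l\<^sub>1 + l\<^sub>2) \<and> \<bar>Re (l\<^sub>1 - l\<^sub>2) - 2\<bar> \<le> 1"
    have "\<bar>Re ?\<nu>\<bar> = \<bar>Re (l\<^sub>1 - l\<^sub>2) - 2\<bar> / 2" by simp
    also have "\<dots> \<le> 1/2" using * by (intro divide_right_mono) auto
    finally have "\<bar>Re ?\<nu>\<bar> \<le> 1/2" .
    then show "slowly_increasing_on (xu_domain 0) (in_x ?F)" using * by (intro recessive_slowly_increasing(2)) auto
  qed
  moreover have "\<forall>\<epsilon>>0. slowly_increasing_on (xu_domain \<epsilon>) (in_x ?F)"
    using recessive_slowly_increasing(1) by blast
  moreover have "\<forall>H\<in>V. (\<forall>\<epsilon>>0. slowly_increasing_on (xu_domain \<epsilon>) (in_x H)) \<longrightarrow> (\<exists>c. H = (\<lambda>p. c * ?F p))"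
    using slowly_increasing_unique zero_less_one by blast
  moreover have "\<forall>H\<in>V. slowly_increasing_on (xu_domain 0) (in_x H) \<longrightarrow> (\<exists>c. H = (\<lambda>p. c * ?F p))"
  proof -
    have "xu_domain 1 \<subseteq> xu_domain 0" by (auto simp: xu_domain_def intro: less_trans[OF zero_less_one])
    then show ?thesis using slowly_increasing_unique slowly_increasing_subset by blast
  qed
  ultimately show ?thesis
    unfolding Let_def using V1 V_eq_spans(2) dim_V by blast
qed

end
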